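(* Let $A\subseteq\mathbb{R}^n$ be a linearly independent set of vectors with entries in $\{0,1,-1\}$. Then $A$ is a te-set if and only if $A$ is the disjoint union of mutually-tu te-bricks. More precisely, $A$ is a te-set if and only if $$A=U\sqcup L_1\sqcup\dots\sqcup L_k\sqcup S_1\sqcup\dots\sqcup S_\ell\sqcup T_1\sqcup\dots\sqcup T_m$$ where $U$ is a (possibly empty) tu-set, $L_1,\dots,L_k$ are te-laces, $S_1,\dots,S_\ell$ are thin te-interlaces, $T_1,\dots,T_m$ are thick te-interlaces, and these te-bricks are mutually-tu.
   Context: A set of vectors is identified with the matrix whose rows are these vectors. An $m\times n$ matrix is equimodular if it has full row rank $m$ and all its nonzero $m\times m$ minors have the same absolute value; this common absolute value is its equideterminant $\operatorname{eqdet}$. A matrix is totally equimodular if every set of linearly independent rows forms an equimodular matrix, and totally unimodular if all its square submatrices have determinant in $\{0,\pm1\}$. A linearly independent set of $\{0,\pm1\}$-vectors is: a te-set if its matrix is totally equimodular; a tu-set if its matrix is totally unimodular; a te-lace if it is a te-set, not a tu-set, and all its proper subsets are tu-sets; a te-interlace if it is a te-set, not a tu-set, and every pair of its vectors is a te-lace. A te-interlace of size $\ell$ is thin if its equideterminant is $2^{\ell-1}$ and thick if it is $2^{\ell}$. A te-brick is a tu-set, a te-lace, a thin te-interlace, or a thick te-interlace. Pairwise disjoint te-bricks are mutually-tu if every subset $X$ of their union which intersects at least two of them, contains none of those te-bricks that are te-laces, and contains at most one vector of each of those te-bricks that are te-interlaces, is a tu-set. *)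

theory Defs
  imports "Jordan_Normal_Form.Determinant" "Jordan_Normal_Form.DL_Submatrix"
begin

text \<open>Vectors of R^n are represented as elements of carrier_vec n (type real vec).
A finite set X of vectors is identified with the matrix whose rows are its elements,
listed in some fixed (arbitrary) order; all notions below are invariant under
reordering the rows.\<close>

definition pm1_set :: "nat \<Rightarrow> real vec set \<Rightarrow> bool" where
  "pm1_set n X \<longleftrightarrow> X \<subseteq> carrier_vec n \<and> (\<forall>v\<in>X. \<forall>i<n. v $ i \<in> {0, 1, -1})"

definition lin_indep_set :: "nat \<Rightarrow> real vec set \<Rightarrow> bool" where
  "lin_indep_set n X \<longleftrightarrow> finite X \<and> X \<subseteq> carrier_vec n \<and>
     (\<forall>c :: real vec \<Rightarrow> real. (\<forall>i<n. (\<Sum>x\<in>X. c x * x $ i) = 0) \<longrightarrow> (\<forall>x\<in>X. c x = 0))"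

definition rows_list :: "real vec set \<Rightarrow> real vec list" where
  "rows_list X = (SOME xs. distinct xs \<and> set xs = X)"

definition mat_of_set :: "nat \<Rightarrow> real vec set \<Rightarrow> real mat" where
  "mat_of_set n X = mat_of_rows n (rows_list X)"

definition max_minor :: "nat \<Rightarrow> real vec set \<Rightarrow> nat set \<Rightarrow> real" where
  "max_minor n X J = det (submatrix (mat_of_set n X) UNIV J)"

definition col_choice :: "nat \<Rightarrow> real vec set \<Rightarrow> nat set \<Rightarrow> bool" where
  "col_choice n X J \<longleftrightarrow> J \<subseteq> {..<n} \<and> card J = card X"

definition equimodular :: "nat \<Rightarrow> real vec set \<Rightarrow> bool" where
  "equimodular n X \<longleftrightarrow> lin_indep_set n X \<and>
     (\<forall>J J'. col_choice n X J \<and> col_choice n X J' \<and> max_minor n X J \<noteq> 0 \<and> max_minor n X J' \<noteq> 0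
        \<longrightarrow> \<bar>max_minor n X J\<bar> = \<bar>max_minor n X J'\<bar>)"

definition eqdet :: "nat \<Rightarrow> real vec set \<Rightarrow> real" where
  "eqdet n X = (THE d. \<exists>J. col_choice n X J \<and> max_minor n X J \<noteq> 0 \<and> d = \<bar>max_minor n X J\<bar>)"

definition totally_equimodular :: "nat \<Rightarrow> real vec set \<Rightarrow> bool" where
  "totally_equimodular n X \<longleftrightarrow> (\<forall>Y\<subseteq>X. lin_indep_set n Y \<longrightarrow> equimodular n Y)"

definition totally_unimodular :: "nat \<Rightarrow> real vec set \<Rightarrow> bool" where
  "totally_unimodular n X \<longleftrightarrow>
     (\<forall>I J. I \<subseteq> {..<card X} \<and> J \<subseteq> {..<n} \<and> card I = card J \<longrightarrow>
        det (submatrix (mat_of_set n X) I J) \<in> {0, 1, -1})"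

definition te_set :: "nat \<Rightarrow> real vec set \<Rightarrow> bool" where
  "te_set n X \<longleftrightarrow> pm1_set n X \<and> lin_indep_set n X \<and> totally_equimodular n X"

definition tu_set :: "nat \<Rightarrow> real vec set \<Rightarrow> bool" where
  "tu_set n X \<longleftrightarrow> pm1_set n X \<and> lin_indep_set n X \<and> totally_unimodular n X"

definition te_lace :: "nat \<Rightarrow> real vec set \<Rightarrow> bool" where
  "te_lace n X \<longleftrightarrow> te_set n X \<and> \<not> tu_set n X \<and> (\<forall>Y. Y \<subset> X \<longrightarrow> tu_set n Y)"

definition te_interlace :: "nat \<Rightarrow> real vec set \<Rightarrow> bool" where
  "te_interlace n X \<longleftrightarrow> te_set n X \<and> \<not> tu_set n X \<and>
     (\<forall>x\<in>X. \<forall>y\<in>X. x \<noteq> y \<longrightarrow> te_lace n {x, y})"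

definition thin_te_interlace :: "nat \<Rightarrow> real vec set \<Rightarrow> bool" where
  "thin_te_interlace n X \<longleftrightarrow> te_interlace n X \<and> eqdet n X = 2 ^ (card X - 1)"

definition thick_te_interlace :: "nat \<Rightarrow> real vec set \<Rightarrow> bool" where
  "thick_te_interlace n X \<longleftrightarrow> te_interlace n X \<and> eqdet n X = 2 ^ card X"

definition te_brick :: "nat \<Rightarrow> real vec set \<Rightarrow> bool" where
  "te_brick n X \<longleftrightarrow> tu_set n X \<or> te_lace n X \<or> thin_te_interlace n X \<or> thick_te_interlace n X"

definition pairwise_disjoint_list :: "'a set list \<Rightarrow> bool" where
  "pairwise_disjoint_list bs \<longleftrightarrow>
     (\<forall>i j. i < length bs \<and> j < length bs \<and> i \<noteq> j \<longrightarrow> bs ! i \<inter> bs ! j = {})"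

definition mutually_tu :: "nat \<Rightarrow> real vec set list \<Rightarrow> bool" where
  "mutually_tu n bs \<longleftrightarrow>
     (\<forall>X. X \<subseteq> \<Union>(set bs)
        \<and> card {i. i < length bs \<and> X \<inter> bs ! i \<noteq> {}} \<ge> 2
        \<and> (\<forall>i<length bs. te_lace n (bs ! i) \<longrightarrow> \<not> bs ! i \<subseteq> X)
        \<and> (\<forall>i<length bs. te_interlace n (bs ! i) \<longrightarrow> card (X \<inter> bs ! i) \<le> 1)
        \<longrightarrow> tu_set n X)"

end

theory Submission
  imports Defs
begin

text \<open>For a te-set \<open>A\<close> put \<open>f(X) = log 2 (eqdet X)\<close>. Row reduction along a basis of the columns of
  \<open>Y \<subseteq> A\<close> turns the remaining vectors, up to scaling, into \<open>{0,1,-1}\<close>-vectors whose \<open>2 \<times> 2\<close> minors all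
  have the same absolute value, \<open>1\<close> or \<open>2\<close>, and it is \<open>2\<close> exactly if the two vectors have the same support.
  So the second differences of \<open>f\<close> at \<open>Y\<close> lie in \<open>{0,1}\<close>, and being \<open>1\<close> is an equivalence relation on
  \<open>A - Y\<close>. A few facts about three or four \<open>{0,1,-1}\<close>-rows then suffice for a purely combinatorial
  argument: the tu-sets are the zeros of \<open>f\<close>, the te-laces are its minimal non-zeros, and two distinct
  te-laces meet only if both have size two. The te-laces of size two span the equivalence classes at
  \<open>Y = {}\<close>, which are the te-interlaces, and a parity argument with the inverse of a \<open>\<plusminus>1\<close>-matrix shows
  that they are thin or thick.

  Conversely, \<open>eqdet\<close> is multiplicative over mutually-tu bricks. By induction on the set, all rows except
  a clique \<open>S\<close> of one brick and a vector \<open>z\<close> outside of it are contracted. On the common support of \<open>S\<close>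
  the columns where \<open>z\<close> does not vanish are parallel, so \<open>z\<close> can be split off from every minor.\<close>

section \<open>Minors of row functions\<close>

text \<open>Contraction leaves the matrices with which the theorem starts: after row reduction and
  scaling, the rows are no longer the given vectors. Rows are therefore arbitrary functions of the
  column index, and all that is remembered of a system is the common absolute value of its minors.
  For the same reason the combinatorial part works with an axiomatized \<open>f\<close>: its axioms
  survive contraction, so inductions may contract freely. The size of \<open>f\<close> on an
  equivalence class is the one question that these axioms leave open. An inclusion-minimal
  \<open>M\<close> with \<open>f M \<ge> card M\<close> becomes a te-lace after contraction of any
  of its elements and loss of that element. If the class is larger, adding one more vector
  \<open>p\<close> fixes the determinants of \<open>M\<close>, of \<open>insert p M\<close> and of
  each \<open>insert p (M - {m})\<close>. These values bring the cofactors of a matrix of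
  \<open>insert p M\<close> down to 0, 1 and -1, and divisibility modulo 4 together with parity
  makes both \<open>card M\<close> and \<open>card M + 1\<close> even. In the converse,
  equimodularity is not yet known, so each step may only use proper subsets, which the induction
  supplies.\<close>

definition minor :: "('a \<Rightarrow> nat \<Rightarrow> real) \<Rightarrow> 'a list \<Rightarrow> nat list \<Rightarrow> real" where
  "minor r xs cs = det (mat (length xs) (length xs) (\<lambda>(i,j). r (xs ! i) (cs ! j)))"

lemma minor_Nil [simp]: "minor r [] cs = 1"
  by (simp add: minor_def)

lemma minor_cong:
  assumes "length xs = length xs'" "\<And>i j. i < length xs \<Longrightarrow> j < length xs \<Longrightarrow> r (xs ! i) (cs ! j) = r' (xs' ! i) (cs' ! j)"
  shows "minor r xs cs = minor r' xs' cs'"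
  unfolding minor_def by (rule arg_cong[of _ _ det], rule eq_matI) (use assms in auto)

lemma abs_signof [simp]: "\<bar>signof p :: real\<bar> = 1"
  by (cases p rule: sign_cases) (auto simp: sign_def)

lemma minor_perm_rows:
  assumes "mset xs = mset ys"
  shows "\<bar>minor r xs cs\<bar> = \<bar>minor r ys cs\<bar>"
proof -
  obtain p where p: "p permutes {..<length ys}" "permute_list p ys = xs"
    using mset_eq_permutation[OF assms] by blast
  have len: "length xs = length ys" using p by auto
  let ?A = "mat (length ys) (length ys) (\<lambda>(i,j). r (ys ! i) (cs ! j))"
  have "mat (length xs) (length xs) (\<lambda>(i,j). r (xs ! i) (cs ! j)) =
     mat (length ys) (length ys) (\<lambda>(i,j). ?A $$ (p i, j))"
  proof (rule eq_matI)
    fix i j assume "i < dim_row (mat (length ys) (length ys) (\<lambda>(i,j). ?A $$ (p i, j)))"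
      "j < dim_col (mat (length ys) (length ys) (\<lambda>(i,j). ?A $$ (p i, j)))"
    then have ij: "i < length ys" "j < length ys" by auto
    have "p i < length ys" using p(1) ij by (metis lessThan_iff permutes_in_image)
    moreover have "xs ! i = ys ! p i" using p ij permute_list_nth by blast
    ultimately show "mat (length xs) (length xs) (\<lambda>(i,j). r (xs ! i) (cs ! j)) $$ (i, j) =
     mat (length ys) (length ys) (\<lambda>(i,j). ?A $$ (p i, j)) $$ (i,j)" using ij len by simp
  qed (use len in auto)
  then have "minor r xs cs = signof p * minor r ys cs"
    unfolding minor_def using det_permute_rows[of ?A "length ys" p] p(1)
    by (simp add: atLeast0LessThan)
  then show ?thesis by (simp add: abs_mult)
qed

lemma minor_transpose:
  fixes r :: "nat \<Rightarrow> nat \<Rightarrow> real"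
  assumes "length xs = length cs"
  shows "minor r xs cs = minor (\<lambda>c x. r x c) cs xs"
proof -
  let ?A = "mat (length xs) (length xs) (\<lambda>(i,j). r (xs ! i) (cs ! j))"
  have "?A\<^sup>T = mat (length cs) (length cs) (\<lambda>(i,j). r (xs ! j) (cs ! i))"
    by (rule eq_matI) (use assms in auto)
  then show ?thesis using det_transpose[of ?A "length xs"] by (simp add: minor_def)
qed

text \<open>Naming rows by their positions gives rows and columns the same type, so that
  \<open>minor_transpose\<close> becomes applicable to rows of an arbitrary type.\<close>

lemma minor_index:
  "minor r xs cs = minor (\<lambda>i. r (xs ! i)) [0..<length xs] cs"
  unfolding minor_def by (rule arg_cong[of _ _ det], rule eq_matI) auto

lemma minor_perm_cols:
  assumes "mset cs = mset ds" "length cs = length xs"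
  shows "\<bar>minor r xs cs\<bar> = \<bar>minor r xs ds\<bar>"
proof -
  have len: "length ds = length xs" using assms mset_eq_length by metis
  have "\<bar>minor r xs cs\<bar> = \<bar>minor (\<lambda>c i. r (xs ! i) c) cs [0..<length xs]\<bar>"
    by (subst minor_index, subst minor_transpose) (use assms in auto)
  also have "\<dots> = \<bar>minor (\<lambda>c i. r (xs ! i) c) ds [0..<length xs]\<bar>"
    by (rule minor_perm_rows[OF assms(1)])
  also have "\<dots> = \<bar>minor r xs ds\<bar>"
    by (subst (2) minor_index, subst (2) minor_transpose) (use len in auto)
  finally show ?thesis .
qed

lemma minor_scale:
  assumes "length cs = length xs"
  shows "minor (\<lambda>x j. a x * r x j) xs cs = (\<Prod>x\<leftarrow>xs. a x) * minor r xs cs"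
proof -
  let ?n = "length xs"
  have pr: "(\<Prod>x\<leftarrow>xs. a x) = (\<Prod>i\<in>{0..<?n}. a (xs ! i))"
    by (simp add: prod.list_conv_set_nth)
  have "(\<Prod>i = 0..<?n. mat ?n ?n (\<lambda>(i, j). a (xs ! i) * r (xs ! i) (cs ! j)) $$ (i, p i)) =
     (\<Prod>i\<in>{0..<?n}. a (xs ! i)) * (\<Prod>i = 0..<?n. mat ?n ?n (\<lambda>(i, j). r (xs ! i) (cs ! j)) $$ (i, p i))"
    if "p permutes {0..<?n}" for p
  proof -
    have "p i < ?n" if "i < ?n" for i using \<open>p permutes _\<close> that by (metis atLeastLessThan_iff permutes_in_image zero_le)
    then show ?thesis unfolding prod.distrib[symmetric] by (intro prod.cong) auto
  qed
  then show ?thesis unfolding minor_def det_def pr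
    by (auto simp: sum_distrib_left intro!: sum.cong)
qed

lemma minor_Cons:
  assumes "length cs = Suc (length xs)"
  shows "minor r (x # xs) cs = (\<Sum>j<Suc (length xs). (-1)^j * r x (cs ! j) * minor r xs (take j cs @ drop (Suc j) cs))"
proof -
  let ?A = "mat (Suc (length xs)) (Suc (length xs)) (\<lambda>(i,j). r ((x # xs) ! i) (cs ! j))"
  have A: "?A \<in> carrier_mat (Suc (length xs)) (Suc (length xs))" by simp
  have "minor r (x # xs) cs = (\<Sum>j<Suc (length xs). ?A $$ (0,j) * cofactor ?A 0 j)"
    unfolding minor_def using laplace_expansion_row[OF A, of 0] by simp
  also have "\<dots> = (\<Sum>j<Suc (length xs). (-1)^j * r x (cs ! j) * minor r xs (take j cs @ drop (Suc j) cs))"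
  proof (rule sum.cong[OF refl])
    fix j assume "j \<in> {..<Suc (length xs)}"
    then have j: "j < Suc (length xs)" by simp
    have "mat_delete ?A 0 j = mat (length xs) (length xs) (\<lambda>(i,k). r (xs ! i) ((take j cs @ drop (Suc j) cs) ! k))"
      unfolding mat_delete_def
      by (rule eq_matI) (use j assms in \<open>auto simp: nth_append\<close>)
    then show "?A $$ (0,j) * cofactor ?A 0 j = (-1)^j * r x (cs ! j) * minor r xs (take j cs @ drop (Suc j) cs)"
      using j by (simp add: cofactor_def minor_def)
  qed
  finally show ?thesis .
qed

lemma minor_single: "minor r [x] [j] = r x j"
  by (simp add: minor_Cons)

lemma minor_2: "minor r [x,y] [j,k] = r x j * r y k - r x k * r y j"
  by (simp add: minor_Cons minor_single numeral_2_eq_2)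

lemma minor_3: "minor r [x,y,z] [j,k,l] = r x j * (r y k * r z l - r y l * r z k)
   - r x k * (r y j * r z l - r y l * r z j) + r x l * (r y j * r z k - r y k * r z j)"
  by (simp add: minor_Cons minor_2 numeral_3_eq_3)

lemma minor_eq_0_zero_row:
  assumes "length cs = length xs" "x \<in> set xs" "\<And>j. j \<in> set cs \<Longrightarrow> r x j = 0"
  shows "minor r xs cs = 0"
proof -
  obtain ys where ys: "mset xs = mset (x # ys)"
    using assms(2) by (metis ex_mset mset.simps(2) multi_member_split set_mset_mset)
  then have len: "length cs = Suc (length ys)" using assms(1) mset_eq_length by fastforce
  have "minor r (x # ys) cs = 0"
    using len assms(3) by (auto simp: minor_Cons intro!: sum.neutral)
  then show ?thesis using minor_perm_rows[OF ys, of r cs] by simp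
qed

section \<open>Block matrices, row operations and contraction\<close>

lemma minor_block:
  assumes "length bs = length ys" "length cs = length xs"
    and zero: "\<And>x b. x \<in> set xs \<Longrightarrow> b \<in> set bs \<Longrightarrow> r x b = 0"
  shows "minor r (ys @ xs) (bs @ cs) = minor r ys bs * minor r xs cs"
proof -
  let ?n = "length ys" and ?m = "length xs"
  let ?A = "mat ?n ?n (\<lambda>(i,j). r (ys ! i) (bs ! j))"
  let ?B = "mat ?n ?m (\<lambda>(i,j). r (ys ! i) (cs ! j))"
  let ?C = "mat ?m ?m (\<lambda>(i,j). r (xs ! i) (cs ! j))"
  have "mat (length (ys @ xs)) (length (ys @ xs)) (\<lambda>(i,j). r ((ys @ xs) ! i) ((bs @ cs) ! j))
     = four_block_mat ?A ?B (0\<^sub>m ?m ?n) ?C"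
    by (rule eq_matI) (use assms in \<open>auto simp: nth_append not_less intro!: zero\<close>)
  then show ?thesis unfolding minor_def
    using det_four_block_mat_lower_left_zero[of ?A ?n ?B ?m "0\<^sub>m ?m ?n" ?C] by simp
qed

lemma minor_block_upper:
  assumes "length bs = length ys" "length cs = length xs"
    and zero: "\<And>y c. y \<in> set ys \<Longrightarrow> c \<in> set cs \<Longrightarrow> r y c = 0"
  shows "minor r (ys @ xs) (bs @ cs) = minor r ys bs * minor r xs cs"
proof -
  let ?n = "length ys" and ?m = "length xs"
  let ?A = "mat ?n ?n (\<lambda>(i,j). r (ys ! i) (bs ! j))"
  let ?B = "mat ?m ?n (\<lambda>(i,j). r (xs ! i) (bs ! j))"
  let ?C = "mat ?m ?m (\<lambda>(i,j). r (xs ! i) (cs ! j))"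
  have "mat (length (ys @ xs)) (length (ys @ xs)) (\<lambda>(i,j). r ((ys @ xs) ! i) ((bs @ cs) ! j))
     = four_block_mat ?A (0\<^sub>m ?n ?m) ?B ?C"
    by (rule eq_matI) (use assms in \<open>auto simp: nth_append not_less intro!: zero\<close>)
  then show ?thesis unfolding minor_def
    using det_four_block_mat_upper_right_zero[of ?A ?n "0\<^sub>m ?n ?m" ?m ?B ?C] by simp
qed

text \<open>Left multiplication by a block triangular matrix with unit diagonal. The coefficients
  \<open>c\<close> may depend on the row, so all rows of \<open>xs\<close> are reduced at
  once.\<close>

lemma minor_row_op:
  assumes "length cs = length ys + length xs"
    and ys: "\<And>y j. y \<in> set ys \<Longrightarrow> r' y j = r y j"
    and xs: "\<And>x j. x \<in> set xs \<Longrightarrow> r' x j = r x j - (\<Sum>i<length ys. c x i * r (ys ! i) j)"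
  shows "minor r' (ys @ xs) cs = minor r (ys @ xs) cs"
proof -
  let ?n = "length ys" and ?m = "length xs"
  let ?P = "four_block_mat (1\<^sub>m ?n) (0\<^sub>m ?n ?m) (mat ?m ?n (\<lambda>(i,j). - c (xs ! i) j)) (1\<^sub>m ?m) :: real mat"
  let ?M = "mat (?n+?m) (?n+?m) (\<lambda>(i,j). r ((ys @ xs) ! i) (cs ! j))"
  have "mat (?n+?m) (?n+?m) (\<lambda>(i,j). r' ((ys @ xs) ! i) (cs ! j)) = ?P * ?M"
  proof (rule eq_matI)
    fix i j assume "i < dim_row (?P * ?M)" "j < dim_col (?P * ?M)"
    then have i: "i < ?n + ?m" and j: "j < ?n + ?m" by auto
    have split: "(\<Sum>k = 0..<?n + ?m. f k) = (\<Sum>k<?n. f k) + (\<Sum>k<?m. f (?n + k))" for f :: "nat \<Rightarrow> real"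
      by (simp add: sum.nat_group[symmetric] atLeast0LessThan sum_up_index_split)
        (metis (no_types, lifting) atLeast0LessThan add.commute sum.atLeastLessThan_concat sum.shift_bounds_nat_ivl le_add1 add_0 sum.cong)
    have "(?P * ?M) $$ (i,j) = (\<Sum>k = 0..<?n + ?m. ?P $$ (i,k) * ?M $$ (k,j))"
      using i j by (simp add: scalar_prod_def)
    also have "\<dots> = (\<Sum>k<?n. ?P $$ (i,k) * r (ys ! k) (cs ! j)) + (\<Sum>k<?m. ?P $$ (i,?n + k) * r (xs ! k) (cs ! j))"
      unfolding split using j by (intro arg_cong2[of _ _ _ _ "(+)"] sum.cong) (auto simp: nth_append)
    also have "\<dots> = r' ((ys @ xs) ! i) (cs ! j)"
    proof (cases "i < ?n")
      case True
      then have "(\<Sum>k<?n. ?P $$ (i,k) * r (ys ! k) (cs ! j)) = (\<Sum>k<?n. if k = i then r (ys ! k) (cs ! j) else 0)"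
        by (intro sum.cong) auto
      moreover have "(\<Sum>k<?m. ?P $$ (i,?n + k) * r (xs ! k) (cs ! j)) = 0"
        using True by (intro sum.neutral) auto
      ultimately show ?thesis using True ys by (simp add: nth_append)
    next
      case False
      then have "(\<Sum>k<?n. ?P $$ (i,k) * r (ys ! k) (cs ! j)) = - (\<Sum>k<?n. c (xs ! (i - ?n)) k * r (ys ! k) (cs ! j))"
        unfolding sum_negf[symmetric] using i by (intro sum.cong) auto
      moreover have "(\<Sum>k<?m. ?P $$ (i,?n + k) * r (xs ! k) (cs ! j)) = (\<Sum>k<?m. if k = i - ?n then r (xs ! k) (cs ! j) else 0)"
        using False i by (intro sum.cong) auto
      moreover have "i - ?n < ?m" using False i by auto
      ultimately show ?thesis using False i xs[of "xs ! (i - ?n)"] by (simp add: nth_append)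
    qed
    finally show "mat (?n+?m) (?n+?m) (\<lambda>(i,j). r' ((ys @ xs) ! i) (cs ! j)) $$ (i,j) = (?P * ?M) $$ (i,j)"
      using i j by simp
  qed auto
  moreover have "det ?P = 1"
    by (subst det_four_block_mat_upper_right_zero[where n = ?n and m = ?m]) auto
  moreover have "det (?P * ?M) = det ?P * det ?M"
    by (rule det_mult[where n = "?n + ?m"]) auto
  ultimately show ?thesis by (simp add: minor_def)
qed

text \<open>Laplace expansion along the rows of \<open>xs\<close>, one after the other: a nonzero
  sum has a nonzero term. The columns deleted on the way are collected in \<open>cs\<close>, so that
  the columns of \<open>js\<close> are only rearranged.\<close>

lemma minor_sub_nonzero:
  assumes "minor r (xs @ ys) js \<noteq> 0" "length js = length xs + length ys"
  shows "\<exists>bs cs. mset js = mset (bs @ cs) \<and> length bs = length ys \<and> length cs = length xs \<and> minor r ys bs \<noteq> 0"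
  using assms
proof (induction xs arbitrary: js)
  case Nil
  then show ?case by (intro exI[of _ js] exI[of _ "[]"]) auto
next
  case (Cons x xs)
  have "\<exists>j<Suc (length (xs @ ys)). minor r (xs @ ys) (take j js @ drop (Suc j) js) \<noteq> 0"
  proof (rule ccontr)
    assume "\<not> ?thesis"
    then have "minor r (x # (xs @ ys)) js = 0" using Cons.prems(2)
      by (subst minor_Cons) (auto intro!: sum.neutral)
    then show False using Cons.prems by simp
  qed
  then obtain j where j: "j < Suc (length (xs @ ys))" "minor r (xs @ ys) (take j js @ drop (Suc j) js) \<noteq> 0"
    by blast
  have len: "length (take j js @ drop (Suc j) js) = length xs + length ys" using j Cons.prems(2) by auto
  obtain bs cs where bc: "mset (take j js @ drop (Suc j) js) = mset (bs @ cs)" "length bs = length ys"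
    "length cs = length xs" "minor r ys bs \<noteq> 0" using Cons.IH[OF j(2) len] by blast
  have "js = take j js @ js ! j # drop (Suc j) js" using j Cons.prems(2) by (intro id_take_nth_drop) auto
  then have "mset js = mset ((take j js @ drop (Suc j) js) @ [js ! j])"
    by (metis add_mset_add_single mset.simps(2) mset_append union_mset_add_mset_right mset_single_iff_right append.assoc append_Cons append_Nil mset.simps(1) union_code)
  then have "mset js = mset (bs @ cs @ [js ! j])" using bc(1) by simp
  then show ?case using bc by (intro exI[of _ bs] exI[of _ "cs @ [js ! j]"]) auto
qed

text \<open>This is the Schur complement: \<open>\<phi>\<close> subtracts from a row the combination
  of the rows of \<open>ys\<close> that agrees with it on the columns \<open>bs\<close>. The second
  property keeps the new columns among the old ones; the third traces \<open>\<phi>\<close> back to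
  linear dependences.\<close>

lemma contraction:
  assumes len: "length bs = length ys" and nz: "minor r ys bs \<noteq> 0"
  obtains \<phi> where
    "\<And>xs cs. length cs = length xs \<Longrightarrow> set xs \<inter> set ys = {} \<Longrightarrow>
       minor r (ys @ xs) (bs @ cs) = minor r ys bs * minor \<phi> xs cs"
    "\<And>xs cs. length cs = length ys + length xs \<Longrightarrow> set xs \<inter> set ys = {} \<Longrightarrow> minor r (ys @ xs) cs \<noteq> 0 \<Longrightarrow>
       \<exists>ds. set ds \<subseteq> set cs \<and> length ds = length xs \<and> minor \<phi> xs ds \<noteq> 0"
    "\<And>x. \<exists>c. \<forall>j. \<phi> x j = r x j - (\<Sum>i<length ys. c i * r (ys ! i) j)"
proof -
  let ?n = "length ys"
  define M where "M = mat ?n ?n (\<lambda>(i,j). r (ys ! i) (bs ! j))"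
  have M: "M \<in> carrier_mat ?n ?n" by (simp add: M_def)
  have d: "det M \<noteq> 0" using nz by (simp add: minor_def M_def)
  \<comment> \<open>Cramer's rule: the part of row \<open>x\<close> in the columns \<open>bs\<close>
    times the inverse of \<open>M\<close>, written through the adjugate.\<close>
  define c where "c x i = (\<Sum>k<?n. r x (bs ! k) * adj_mat M $$ (k,i)) / det M" for x i
  define \<phi> where "\<phi> x j = r x j - (\<Sum>i<?n. c x i * r (ys ! i) j)" for x j
  have adj: "(\<Sum>i<?n. adj_mat M $$ (k,i) * r (ys ! i) (bs ! l)) = (if k = l then det M else 0)"
    if "k < ?n" "l < ?n" for k l
  proof -
    have "(adj_mat M * M) $$ (k,l) = (\<Sum>i\<in>{0..<?n}. adj_mat M $$ (k,i) * r (ys ! i) (bs ! l))"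
      using that adj_mat(1)[OF M] M by (simp add: scalar_prod_def M_def)
    then show ?thesis using adj_mat(3)[OF M] that by (simp add: atLeast0LessThan split: if_splits)
  qed
  have zero: "\<phi> x b = 0" if b: "b \<in> set bs" for x b
  proof -
    obtain l where l: "l < ?n" "b = bs ! l" using b len by (metis in_set_conv_nth)
    have "(\<Sum>i<?n. c x i * r (ys ! i) b) = (\<Sum>i<?n. \<Sum>k<?n. r x (bs ! k) * (adj_mat M $$ (k,i) * r (ys ! i) b)) / det M"
      unfolding c_def by (simp add: sum_divide_distrib sum_distrib_right sum_distrib_left mult_ac)
    also have "(\<Sum>i<?n. \<Sum>k<?n. r x (bs ! k) * (adj_mat M $$ (k,i) * r (ys ! i) b))
       = (\<Sum>k<?n. r x (bs ! k) * (\<Sum>i<?n. adj_mat M $$ (k,i) * r (ys ! i) b))"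
      by (subst sum.swap) (simp add: sum_distrib_left)
    also have "\<dots> = (\<Sum>k<?n. if k = l then r x (bs ! k) * det M else 0)"
      by (rule sum.cong) (use l in \<open>auto simp: adj\<close>)
    also have "\<dots> = r x b * det M" using l by simp
    finally show ?thesis using d by (simp add: \<phi>_def)
  qed
  \<comment> \<open>Only rows outside of \<open>ys\<close> are reduced; this is the reason for
    requiring \<open>xs\<close> and \<open>ys\<close> to be disjoint.\<close>
  define r' where "r' x = (if x \<in> set ys then r x else \<phi> x)" for x
  have op: "minor r (ys @ xs) cs = minor r' (ys @ xs) cs"
    if "length cs = length ys + length xs" "set xs \<inter> set ys = {}" for xs cs
    by (rule minor_row_op[symmetric, where c = c]) (use that in \<open>auto simp: r'_def \<phi>_def\<close>)
  have r'ys: "minor r' ys cs = minor r ys cs" for cs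
    by (rule minor_cong) (auto simp: r'_def)
  have r'xs: "minor r' xs cs = minor \<phi> xs cs" if "set xs \<inter> set ys = {}" for xs cs
    by (rule minor_cong) (use that in \<open>auto simp: r'_def disjoint_iff in_set_conv_nth\<close>)
  show thesis
  proof
    fix xs and cs :: "nat list"
    assume xs: "length cs = length xs" "set xs \<inter> set ys = {}"
    then have "minor r (ys @ xs) (bs @ cs) = minor r' (ys @ xs) (bs @ cs)" using len by (intro op) auto
    also have "\<dots> = minor r' ys bs * minor r' xs cs"
      by (rule minor_block) (use len xs zero in \<open>auto simp: r'_def\<close>)
    finally show "minor r (ys @ xs) (bs @ cs) = minor r ys bs * minor \<phi> xs cs"
      using r'ys r'xs xs by simp
  next
    fix xs and cs :: "nat list"
    assume xs: "length cs = length ys + length xs" "set xs \<inter> set ys = {}" "minor r (ys @ xs) cs \<noteq> 0"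
    then have "minor r' (ys @ xs) cs \<noteq> 0" using op by simp
    then obtain bs' ds where "mset cs = mset (bs' @ ds)" "length bs' = length xs" "minor r' xs bs' \<noteq> 0"
      using minor_sub_nonzero[of r' ys xs cs] xs by auto
    moreover from this have "set bs' \<subseteq> set cs" by (metis Un_upper1 mset_eq_setD set_append)
    ultimately show "\<exists>ds. set ds \<subseteq> set cs \<and> length ds = length xs \<and> minor \<phi> xs ds \<noteq> 0"
      using r'xs xs by auto
  next
    show "\<exists>c. \<forall>j. \<phi> x j = r x j - (\<Sum>i<?n. c i * r (ys ! i) j)" for x
      unfolding \<phi>_def by blast
  qed
qed

section \<open>Equimodular systems of row functions and their contractions\<close>

definition eqmod :: "nat \<Rightarrow> ('a \<Rightarrow> nat \<Rightarrow> real) \<Rightarrow> 'a set \<Rightarrow> real \<Rightarrow> bool" where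
  "eqmod n r X d \<longleftrightarrow> finite X \<and> d > 0 \<and>
     (\<forall>xs cs. distinct xs \<and> set xs = X \<and> set cs \<subseteq> {..<n} \<and> length cs = length xs \<longrightarrow> \<bar>minor r xs cs\<bar> \<in> {0, d}) \<and>
     (\<exists>xs cs. distinct xs \<and> set xs = X \<and> set cs \<subseteq> {..<n} \<and> length cs = length xs \<and> minor r xs cs \<noteq> 0)"

lemma minor_abs_cong_set:
  assumes "distinct xs" "distinct xs'" "set xs = set xs'"
  shows "\<bar>minor r xs cs\<bar> = \<bar>minor r xs' cs\<bar>"
  using assms by (intro minor_perm_rows) (simp add: set_eq_iff_mset_eq_distinct[symmetric])

lemma eqmodI:
  assumes "distinct xs" "set xs = X" "d > 0"
    and "\<And>cs. set cs \<subseteq> {..<n} \<Longrightarrow> length cs = length xs \<Longrightarrow> minor r xs cs \<noteq> 0 \<Longrightarrow> \<bar>minor r xs cs\<bar> = d"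
    and "set ds \<subseteq> {..<n}" "length ds = length xs" "minor r xs ds \<noteq> 0"
  shows "eqmod n r X d"
  unfolding eqmod_def
proof (intro conjI allI impI)
  fix xs' cs assume a: "distinct xs' \<and> set xs' = X \<and> set cs \<subseteq> {..<n} \<and> length cs = length xs'"
  then have "length xs' = length xs" using assms(1,2) distinct_card by metis
  then show "\<bar>minor r xs' cs\<bar> \<in> {0, d}"
    using a assms(4)[of cs] minor_abs_cong_set[of xs xs' r cs] assms(1,2) by (cases "minor r xs cs = 0") auto
qed (use assms in auto)

lemma eqmod_finite: "eqmod n r X d \<Longrightarrow> finite X" and eqmod_pos: "eqmod n r X d \<Longrightarrow> d > 0"
  by (auto simp: eqmod_def)

lemma eqmod_minor:
  assumes "eqmod n r X d" "distinct xs" "set xs = X" "set cs \<subseteq> {..<n}" "length cs = length xs"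
  shows "\<bar>minor r xs cs\<bar> = 0 \<or> \<bar>minor r xs cs\<bar> = d"
  using assms unfolding eqmod_def by blast

lemma eqmod_nonzero:
  assumes "eqmod n r X d" "distinct xs" "set xs = X"
  obtains cs where "set cs \<subseteq> {..<n}" "length cs = length xs" "\<bar>minor r xs cs\<bar> = d"
proof -
  obtain xs' cs where a: "distinct xs'" "set xs' = X" "set cs \<subseteq> {..<n}" "length cs = length xs'" "minor r xs' cs \<noteq> 0"
    using assms(1) unfolding eqmod_def by blast
  have "length xs' = length xs" using assms(2,3) a distinct_card by metis
  moreover have "\<bar>minor r xs cs\<bar> \<noteq> 0"
    using a(5) minor_abs_cong_set[of xs xs' r cs] assms(2,3) a(1,2) by auto
  ultimately show thesis using that[of cs] eqmod_minor[OF assms(1-3), of cs] a by auto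
qed

lemma eqmod_unique:
  assumes "eqmod n r X d" "eqmod n r X d'"
  shows "d = d'"
proof -
  obtain xs where xs: "distinct xs" "set xs = X"
    using finite_distinct_list[OF eqmod_finite[OF assms(1)]] by blast
  obtain cs where cs: "set cs \<subseteq> {..<n}" "length cs = length xs" "\<bar>minor r xs cs\<bar> = d"
    using eqmod_nonzero[OF assms(1) xs] .
  then show ?thesis using eqmod_minor[OF assms(2) xs cs(1,2)] eqmod_pos[OF assms(1)] by auto
qed

lemma eqmod_empty: "eqmod n r {} 1"
  by (rule eqmodI[of "[]" _ _ _ _ "[]"]) auto

lemma eqmod_scale:
  assumes "eqmod n r X d" "\<And>x. x \<in> X \<Longrightarrow> a x > 0"
  shows "eqmod n (\<lambda>x j. a x * r x j) X ((\<Prod>x\<in>X. a x) * d)"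
proof -
  obtain xs where xs: "distinct xs" "set xs = X"
    using finite_distinct_list[OF eqmod_finite[OF assms(1)]] by blast
  obtain ds where ds: "set ds \<subseteq> {..<n}" "length ds = length xs" "\<bar>minor r xs ds\<bar> = d"
    using eqmod_nonzero[OF assms(1) xs] .
  have P: "(\<Prod>x\<in>X. a x) > 0" by (rule prod_pos) (use assms in auto)
  have e: "minor (\<lambda>x j. a x * r x j) xs cs = (\<Prod>x\<in>X. a x) * minor r xs cs" if "length cs = length xs" for cs
    using minor_scale[OF that, of a r] prod.distinct_set_conv_list[OF xs(1), of a] xs(2) by simp
  have dp: "d > 0" using assms(1) eqmod_pos by blast
  show ?thesis
    by (rule eqmodI[OF xs _ _ ds(1,2)])
      (use e eqmod_minor[OF assms(1) xs] P ds dp in \<open>auto simp: abs_mult\<close>)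
qed

text \<open>A minor of \<open>\<phi>\<close> is a quotient of two minors of \<open>r\<close>, namely
  that of \<open>ys @ xs\<close> on \<open>bs @ cs\<close> and that of \<open>ys\<close> on
  \<open>bs\<close>. Common absolute values in numerator and denominator give a common one for the
  quotient.\<close>

lemma eqmod_contract:
  assumes Y: "distinct ys" and len: "length bs = length ys" and bs: "set bs \<subseteq> {..<n}"
    and nz: "minor r ys bs \<noteq> 0" and EY: "eqmod n r (set ys) dY"
  obtains \<phi> where
    "\<And>xs cs. length cs = length xs \<Longrightarrow> set xs \<inter> set ys = {} \<Longrightarrow>
       \<bar>minor r (ys @ xs) (bs @ cs)\<bar> = dY * \<bar>minor \<phi> xs cs\<bar>"
    "\<And>X d. X \<inter> set ys = {} \<Longrightarrow> eqmod n r (set ys \<union> X) d \<Longrightarrow> eqmod n \<phi> X (d / dY)"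
proof -
  obtain \<phi> where \<phi>: "\<And>xs cs. length cs = length xs \<Longrightarrow> set xs \<inter> set ys = {} \<Longrightarrow>
       minor r (ys @ xs) (bs @ cs) = minor r ys bs * minor \<phi> xs cs"
    "\<And>xs cs. length cs = length ys + length xs \<Longrightarrow> set xs \<inter> set ys = {} \<Longrightarrow> minor r (ys @ xs) cs \<noteq> 0 \<Longrightarrow>
       \<exists>ds. set ds \<subseteq> set cs \<and> length ds = length xs \<and> minor \<phi> xs ds \<noteq> 0"
    by (rule contraction[OF len nz]) (rule that; assumption)
  have dY: "\<bar>minor r ys bs\<bar> = dY" "dY > 0"
    using eqmod_minor[OF EY Y refl bs len] nz eqmod_pos[OF EY] by auto
  have 1: "\<bar>minor r (ys @ xs) (bs @ cs)\<bar> = dY * \<bar>minor \<phi> xs cs\<bar>"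
    if "length cs = length xs" "set xs \<inter> set ys = {}" for xs cs
    using \<phi>(1)[OF that] dY by (simp add: abs_mult)
  show thesis
  proof (rule that[OF 1])
    fix X d assume X: "X \<inter> set ys = {}" and E: "eqmod n r (set ys \<union> X) d"
    obtain xs where xs: "distinct xs" "set xs = X"
      using finite_distinct_list eqmod_finite[OF E] by (metis finite_Un)
    have d: "distinct (ys @ xs)" "set (ys @ xs) = set ys \<union> X" using xs X Y by auto
    obtain js where js: "set js \<subseteq> {..<n}" "length js = length (ys @ xs)" "\<bar>minor r (ys @ xs) js\<bar> = d"
      using eqmod_nonzero[OF E d] .
    have dp: "d > 0" using E eqmod_pos by blast
    obtain ds where ds: "set ds \<subseteq> set js" "length ds = length xs" "minor \<phi> xs ds \<noteq> 0"
      using \<phi>(2)[of js xs] js xs X dp by auto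
    show "eqmod n \<phi> X (d / dY)"
    proof (rule eqmodI[OF xs _ _ _ ds(2,3)])
      fix cs assume cs: "set cs \<subseteq> {..<n}" "length cs = length xs" "minor \<phi> xs cs \<noteq> 0"
      have "\<bar>minor r (ys @ xs) (bs @ cs)\<bar> = dY * \<bar>minor \<phi> xs cs\<bar>" using 1 cs xs X by auto
      moreover have "\<bar>minor r (ys @ xs) (bs @ cs)\<bar> = 0 \<or> \<bar>minor r (ys @ xs) (bs @ cs)\<bar> = d"
        by (rule eqmod_minor[OF E d]) (use cs bs len in auto)
      ultimately show "\<bar>minor \<phi> xs cs\<bar> = d / dY" using dY cs by (auto simp: field_simps)
    qed (use dp dY js ds in auto)
  qed
qed

text \<open>Scaling row \<open>x\<close> by \<open>d (set ys) / d (insert x (set ys))\<close> gives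
  every contracted singleton determinant 1. The entries are then 0, 1 or -1 again, as the lemmas on
  few rows require.\<close>

lemma eqmod_contract_normalized:
  assumes Y: "distinct ys" and len: "length bs = length ys" and bs: "set bs \<subseteq> {..<n}"
    and nz: "minor r ys bs \<noteq> 0" and EY: "eqmod n r (set ys) (d (set ys))"
    and Ex: "\<And>x. x \<in> A \<Longrightarrow> eqmod n r (insert x (set ys)) (d (insert x (set ys)))"
    and A: "A \<inter> set ys = {}"
  obtains \<psi> where
    "\<And>xs cs. length cs = length xs \<Longrightarrow> set xs \<subseteq> A \<Longrightarrow> distinct xs \<Longrightarrow>
       \<bar>minor r (ys @ xs) (bs @ cs)\<bar> = d (set ys) * (\<Prod>x\<in>set xs. d (insert x (set ys)) / d (set ys)) * \<bar>minor \<psi> xs cs\<bar>"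
    "\<And>X. X \<subseteq> A \<Longrightarrow> eqmod n r (set ys \<union> X) (d (set ys \<union> X)) \<Longrightarrow>
       eqmod n \<psi> X ((\<Prod>x\<in>X. d (set ys) / d (insert x (set ys))) * (d (set ys \<union> X) / d (set ys)))"
proof -
  obtain \<phi> where \<phi>: "\<And>xs cs. length cs = length xs \<Longrightarrow> set xs \<inter> set ys = {} \<Longrightarrow>
       \<bar>minor r (ys @ xs) (bs @ cs)\<bar> = d (set ys) * \<bar>minor \<phi> xs cs\<bar>"
    "\<And>X d'. X \<inter> set ys = {} \<Longrightarrow> eqmod n r (set ys \<union> X) d' \<Longrightarrow> eqmod n \<phi> X (d' / d (set ys))"
    using eqmod_contract[OF Y len bs nz EY] by blast
  define a where "a x = d (set ys) / d (insert x (set ys))" for x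
  define \<psi> where "\<psi> x j = a x * \<phi> x j" for x j
  have dY: "d (set ys) > 0" using EY eqmod_pos by blast
  have dx: "d (insert x (set ys)) > 0" if "x \<in> A" for x using Ex[OF that] eqmod_pos by blast
  have apos: "a x > 0" if "x \<in> A" for x using dx[OF that] dY by (simp add: a_def)
  show thesis
  proof
    fix xs and cs :: "nat list" assume xs: "length cs = length xs" "set xs \<subseteq> A" "distinct xs"
    have P: "(\<Prod>x\<in>set xs. a x) > 0" by (rule prod_pos) (use xs apos in auto)
    have "minor \<psi> xs cs = (\<Prod>x\<in>set xs. a x) * minor \<phi> xs cs"
      using minor_scale[OF xs(1), of a \<phi>] xs by (simp add: \<psi>_def[abs_def] prod.distinct_set_conv_list)
    moreover have "(\<Prod>x\<in>set xs. a x) * (\<Prod>x\<in>set xs. d (insert x (set ys)) / d (set ys)) = 1"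
      unfolding prod.distrib[symmetric] using dx dY xs by (intro prod.neutral) (force simp: a_def)
    ultimately show "\<bar>minor r (ys @ xs) (bs @ cs)\<bar> =
        d (set ys) * (\<Prod>x\<in>set xs. d (insert x (set ys)) / d (set ys)) * \<bar>minor \<psi> xs cs\<bar>"
      using \<phi>(1)[of cs xs] xs A P
      by (simp add: abs_mult mult.assoc disjoint_iff subset_iff) (simp add: mult_ac)
  next
    fix X assume X: "X \<subseteq> A" "eqmod n r (set ys \<union> X) (d (set ys \<union> X))"
    have "eqmod n \<phi> X (d (set ys \<union> X) / d (set ys))" using \<phi>(2) X A by blast
    from eqmod_scale[OF this, of a] show "eqmod n \<psi> X ((\<Prod>x\<in>X. d (set ys) / d (insert x (set ys))) * (d (set ys \<union> X) / d (set ys)))"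
      using apos X by (auto simp: \<psi>_def[abs_def] a_def)
  qed
qed

section \<open>Systems of few rows\<close>

lemma minor_nonzero_distinct_cols:
  assumes "length cs = length xs" "minor r xs cs \<noteq> 0"
  shows "distinct cs"
proof (rule ccontr)
  assume "\<not> distinct cs"
  then obtain i j where ij: "i < length xs" "j < length xs" "i \<noteq> j" "cs ! i = cs ! j"
    using assms(1) by (auto simp: distinct_conv_nth)
  let ?M = "mat (length xs) (length xs) (\<lambda>(i,j). r (xs ! i) (cs ! j))"
  have "col ?M i = col ?M j" using ij by (intro eq_vecI) auto
  then have "det ?M = 0"
    using det_identical_columns[of ?M "length xs" i j] ij by simp
  then show False using assms(2) by (simp add: minor_def)
qed

text \<open>After transposition, subtracting \<open>c\<close> times the row of \<open>k\<close> from
  the row of \<open>j\<close> leaves a zero row.\<close>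

lemma minor_parallel_cols:
  assumes "length cs = length xs" "j \<in> set cs" "k \<in> set cs" "j \<noteq> k"
    and par: "\<And>x. x \<in> set xs \<Longrightarrow> r x j = c * r x k"
  shows "minor r xs cs = 0"
proof (rule ccontr)
  assume nz: "minor r xs cs \<noteq> 0"
  have d: "distinct cs" using minor_nonzero_distinct_cols[OF assms(1) nz] .
  define ds where "ds = filter (\<lambda>i. i \<noteq> k \<and> i \<noteq> j) cs"
  have m: "mset cs = mset ([k] @ (j # ds))"
    using d assms(2-4) by (subst set_eq_iff_mset_eq_distinct[symmetric]) (auto simp: ds_def)
  then have len: "Suc (Suc (length ds)) = length xs"
    using assms(1) mset_eq_length by fastforce
  define q where "q = (\<lambda>c i. r (xs ! i) c)"
  define q' where "q' = q(j := (\<lambda>_. 0))"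
  have "\<bar>minor r xs cs\<bar> = \<bar>minor r xs ([k] @ (j # ds))\<bar>"
    by (rule minor_perm_cols[OF m assms(1)])
  also have "\<dots> = \<bar>minor q ([k] @ (j # ds)) [0..<length xs]\<bar>"
    unfolding q_def by (subst minor_index, subst minor_transpose) (use len in auto)
  also have "minor q ([k] @ (j # ds)) [0..<length xs] =
      minor (\<lambda>x i. if x = j then r (xs ! i) j - c * r (xs ! i) k else q x i) ([k] @ (j # ds)) [0..<length xs]"
    by (rule minor_row_op[symmetric, where c = "\<lambda>x i. if x = j then c else 0"])
      (use len assms(4) in \<open>auto simp: q_def ds_def\<close>)
  also have "\<dots> = 0"
    by (rule minor_eq_0_zero_row[where x = j]) (use len par in auto)
  finally show False using nz by simp
qed

lemma eqmod_unit_entries: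
  assumes "eqmod n r {x} 1"
  shows "j < n \<Longrightarrow> r x j = 0 \<or> r x j = 1 \<or> r x j = -1" "\<exists>j<n. r x j \<noteq> 0"
proof -
  show "r x j = 0 \<or> r x j = 1 \<or> r x j = -1" if "j < n"
    using eqmod_minor[OF assms, of "[x]" "[j]"] that by (auto simp: minor_single abs_if split: if_splits)
  obtain cs where "set cs \<subseteq> {..<n}" "length cs = length [x]" "\<bar>minor r [x] cs\<bar> = 1"
    using eqmod_nonzero[OF assms, of "[x]"] by auto
  then show "\<exists>j<n. r x j \<noteq> 0" by (cases cs) (auto simp: minor_single)
qed

lemma eqmod_pair_nonzero:
  assumes "eqmod n r {x, y} e" "x \<noteq> y"
  shows "\<exists>j<n. \<exists>k<n. \<bar>r x j * r y k - r x k * r y j\<bar> = e"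
proof -
  obtain cs where "set cs \<subseteq> {..<n}" "length cs = length [x,y]" "\<bar>minor r [x,y] cs\<bar> = e"
    using eqmod_nonzero[OF assms(1), of "[x,y]"] assms(2) by auto
  then obtain j k where "cs = [j,k]" by (auto simp: length_Suc_conv)
  then show ?thesis using \<open>set cs \<subseteq> _\<close> \<open>\<bar>_\<bar> = e\<close> by (auto simp: minor_2)
qed

lemma eqmod_pair_minor:
  assumes "eqmod n r {x, y} e" "x \<noteq> y" "j < n" "k < n"
  shows "\<bar>r x j * r y k - r x k * r y j\<bar> = 0 \<or> \<bar>r x j * r y k - r x k * r y j\<bar> = e"
  using eqmod_minor[OF assms(1), of "[x,y]" "[j,k]"] assms by (simp add: minor_2)

lemma eqmod_triple_minor:
  assumes "eqmod n r {x, y, z} e" "distinct [x, y, z]" "j < n" "k < n" "l < n"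
  shows "\<bar>minor r [x,y,z] [j,k,l]\<bar> = 0 \<or> \<bar>minor r [x,y,z] [j,k,l]\<bar> = e"
  using eqmod_minor[OF assms(1), of "[x,y,z]" "[j,k,l]"] assms by simp

lemma eqmod_triple_nonzero:
  assumes "eqmod n r {x, y, z} e" "distinct [x, y, z]"
  shows "\<exists>j<n. \<exists>k<n. \<exists>l<n. \<bar>minor r [x,y,z] [j,k,l]\<bar> = e"
proof -
  obtain cs where "set cs \<subseteq> {..<n}" "length cs = length [x,y,z]" "\<bar>minor r [x,y,z] cs\<bar> = e"
    using eqmod_nonzero[OF assms(1), of "[x,y,z]"] assms(2) by auto
  moreover from this obtain j k l where "cs = [j,k,l]" by (auto simp: length_Suc_conv)
  ultimately show ?thesis by auto
qed

section \<open>Supports and signs of two, three and four rows\<close>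

definition same_supp :: "nat \<Rightarrow> ('a \<Rightarrow> nat \<Rightarrow> real) \<Rightarrow> 'a \<Rightarrow> 'a \<Rightarrow> bool" where
  "same_supp n r x y \<longleftrightarrow> (\<forall>j<n. r x j = 0 \<longleftrightarrow> r y j = 0)"

text \<open>A 2 by 2 minor with entries 0, 1, -1 has absolute value 2 only if no entry vanishes. A
  column where just one row is nonzero, combined with a column where the other row is nonzero, gives
  absolute value 1. On equal supports a nonzero minor has no zero entry and is therefore
  even.\<close>

lemma eqmod_pair:
  assumes x: "eqmod n r {x} 1" and y: "eqmod n r {y} 1" and xy: "eqmod n r {x, y} e" and ne: "x \<noteq> y"
  shows "e = 1 \<or> e = 2" "e = 2 \<longleftrightarrow> same_supp n r x y"
proof -
  note ex = eqmod_unit_entries(1)[OF x] and ey = eqmod_unit_entries(1)[OF y]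
  have e0: "e > 0" using eqmod_pos[OF xy] .
  obtain j k where jk: "j < n" "k < n" "\<bar>r x j * r y k - r x k * r y j\<bar> = e"
    using eqmod_pair_nonzero[OF xy ne] by blast
  show 12: "e = 1 \<or> e = 2"
    using ex[OF jk(1)] ex[OF jk(2)] ey[OF jk(1)] ey[OF jk(2)] jk(3) e0 by (elim disjE) simp_all
  show "e = 2 \<longleftrightarrow> same_supp n r x y"
  proof
    assume s: "same_supp n r x y"
    have "r x j = 0 \<longleftrightarrow> r y j = 0" "r x k = 0 \<longleftrightarrow> r y k = 0" using s jk by (auto simp: same_supp_def)
    then show "e = 2"
      using ex[OF jk(1)] ex[OF jk(2)] ey[OF jk(1)] ey[OF jk(2)] jk(3) e0
      by (elim disjE) simp_all
  next
    assume e2: "e = 2"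
    have *: "r x j = 0" if "j < n" "r y j = 0" for j
    proof (rule ccontr)
      assume nz: "r x j \<noteq> 0"
      obtain k where k: "k < n" "r y k \<noteq> 0" using eqmod_unit_entries(2)[OF y] by blast
      have "\<bar>r x j * r y k - r x k * r y j\<bar> = 1"
        using ex[OF that(1)] ey[OF k(1)] nz k that by auto
      then show False using eqmod_pair_minor[OF xy ne that(1) k(1)] e2 by auto
    qed
    have "r y j = 0" if "j < n" "r x j = 0" for j
    proof (rule ccontr)
      assume nz: "r y j \<noteq> 0"
      obtain k where k: "k < n" "r x k \<noteq> 0" using eqmod_unit_entries(2)[OF x] by blast
      have "\<bar>r x j * r y k - r x k * r y j\<bar> = 1"
        using ey[OF that(1)] ex[OF k(1)] nz k that by auto
      then show False using eqmod_pair_minor[OF xy ne that(1) k(1)] e2 by auto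
    qed
    with * show "same_supp n r x y" unfolding same_supp_def by blast
  qed
qed

lemma same_supp_trans: "same_supp n r x y \<Longrightarrow> same_supp n r y z \<Longrightarrow> same_supp n r x z"
  by (simp add: same_supp_def)

text \<open>A nonzero minor uses only columns of the common support, and a 3 by 3 matrix with
  entries 1 and -1 has determinant 0, 4 or -4.\<close>

lemma eqmod_triple_same_supp:
  assumes x: "eqmod n r {x} 1" and y: "eqmod n r {y} 1" and z: "eqmod n r {z} 1"
    and xyz: "eqmod n r {x, y, z} e" and d: "distinct [x, y, z]"
    and s: "same_supp n r x y" "same_supp n r y z"
  shows "e = 4"
proof -
  note ex = eqmod_unit_entries(1)[OF x] and ey = eqmod_unit_entries(1)[OF y] and ez = eqmod_unit_entries(1)[OF z]
  have e0: "e > 0" using eqmod_pos[OF xyz] .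
  obtain j k l where jkl: "j < n" "k < n" "l < n" "\<bar>minor r [x,y,z] [j,k,l]\<bar> = e"
    using eqmod_triple_nonzero[OF xyz d] by blast
  have nz: "r x i = 1 \<or> r x i = -1" "r y i = 1 \<or> r y i = -1" "r z i = 1 \<or> r z i = -1" if "i \<in> {j,k,l}" for i
  proof -
    have "i < n" using that jkl by auto
    have "r x i \<noteq> 0"
    proof
      assume 0: "r x i = 0"
      then have "r y i = 0" "r z i = 0" using s \<open>i < n\<close> by (auto simp: same_supp_def)
      then have "minor r [x,y,z] [j,k,l] = 0" using 0 that by (auto simp: minor_3)
      then show False using jkl e0 by simp
    qed
    moreover from this have "r y i \<noteq> 0" "r z i \<noteq> 0" using s \<open>i < n\<close> by (auto simp: same_supp_def)
    ultimately show "r x i = 1 \<or> r x i = -1" "r y i = 1 \<or> r y i = -1" "r z i = 1 \<or> r z i = -1"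
      using ex[OF \<open>i < n\<close>] ey[OF \<open>i < n\<close>] ez[OF \<open>i < n\<close>] by auto
  qed
  \<comment> \<open>Scaling the columns by the entries of \<open>x\<close> turns the first row into
    ones. These are the entries of the other two rows after that scaling.\<close>
  define a b c a' b' c' where "a = r x j * r y j" "b = r x k * r y k" "c = r x l * r y l"
    "a' = r x j * r z j" "b' = r x k * r z k" "c' = r x l * r z l"
  have pm2: "u * v = 1 \<or> u * v = -1" if "u = 1 \<or> u = -1" "v = 1 \<or> v = -1" for u v :: real
    using that by auto
  have pm: "a = 1 \<or> a = -1" "b = 1 \<or> b = -1" "c = 1 \<or> c = -1" "a' = 1 \<or> a' = -1" "b' = 1 \<or> b' = -1" "c' = 1 \<or> c' = -1"
    unfolding a_b_c_a'_b'_c'_def by (rule pm2; rule nz; simp)+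
  have sq: "r x i * r x i = 1" if "i \<in> {j,k,l}" for i using nz(1)[OF that] by auto
  have "r y i = r x i * (r x i * r y i)" "r z i = r x i * (r x i * r z i)" if "i \<in> {j,k,l}" for i
    using sq[OF that] by (simp_all add: mult.assoc[symmetric])
  then have e': "r y j = r x j * a" "r y k = r x k * b" "r y l = r x l * c"
     "r z j = r x j * a'" "r z k = r x k * b'" "r z l = r x l * c'"
    unfolding a_b_c_a'_b'_c'_def by blast+
  have "minor r [x,y,z] [j,k,l] = r x j * r x k * r x l * ((b * c' - c * b') - (a * c' - c * a') + (a * b' - b * a'))"
    unfolding minor_3 e' by (simp add: algebra_simps)
  moreover have "\<bar>r x j * r x k * r x l\<bar> = 1" using nz(1)[of j] nz(1)[of k] nz(1)[of l] by auto
  ultimately have "e = \<bar>(b * c' - c * b') - (a * c' - c * a') + (a * b' - b * a')\<bar>"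
    using jkl(4) by (simp add: abs_mult)
  then show ?thesis using pm e0 by (elim disjE) simp_all
qed

text \<open>Two columns of the common support in which the rows are related by different signs would
  give a minor of absolute value 2.\<close>

lemma eqmod_pair_sign:
  assumes x: "eqmod n r {x} 1" and y: "eqmod n r {y} 1" and xy: "eqmod n r {x, y} 1" and ne: "x \<noteq> y"
  shows "\<exists>\<sigma>\<in>{1,-1}. \<forall>j<n. r x j \<noteq> 0 \<longrightarrow> r y j \<noteq> 0 \<longrightarrow> r x j = \<sigma> * r y j"
proof (cases "\<exists>k<n. r x k \<noteq> 0 \<and> r y k \<noteq> 0")
  case False
  then show ?thesis by auto
next
  case True
  note ex = eqmod_unit_entries(1)[OF x] and ey = eqmod_unit_entries(1)[OF y]
  obtain k where k: "k < n" "r x k \<noteq> 0" "r y k \<noteq> 0" using True by blast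
  have "r x j = (r x k * r y k) * r y j" if j: "j < n" "r x j \<noteq> 0" "r y j \<noteq> 0" for j
    using eqmod_pair_minor[OF xy ne j(1) k(1)] ex[OF j(1)] ey[OF j(1)] ex[OF k(1)] ey[OF k(1)] k(2,3) j(2,3)
    by (elim disjE) simp_all
  moreover have "r x k * r y k \<in> {1,-1}" using ex[OF k(1)] ey[OF k(1)] k(2,3) by auto
  ultimately show ?thesis by blast
qed

text \<open>Extend two columns on which \<open>z\<close> and \<open>w\<close> have a nonzero minor
  by column \<open>l\<close>. The new minor is a signed sum of the three entries of column
  \<open>l\<close>, and it is even, so an even number of them are nonzero. A vanishing coefficient
  would give \<open>x\<close> the support of \<open>z\<close> or of \<open>w\<close>, contrary to
  the pair determinants 1.\<close>

lemma eqmod_even_triple_supp: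
  assumes x: "eqmod n r {x} 1" and z: "eqmod n r {z} 1" and w: "eqmod n r {w} 1"
    and xz: "eqmod n r {x, z} 1" and xw: "eqmod n r {x, w} 1" and zw: "eqmod n r {z, w} 1"
    and xzw: "eqmod n r {x, z, w} 2" and d: "distinct [x, z, w]" and l: "l < n"
  shows "r x l = 0 \<longleftrightarrow> (r z l = 0 \<longleftrightarrow> r w l = 0)"
proof -
  note ex = eqmod_unit_entries(1)[OF x] and ez = eqmod_unit_entries(1)[OF z] and ew = eqmod_unit_entries(1)[OF w]
  have ne: "x \<noteq> z" "x \<noteq> w" "z \<noteq> w" using d by auto
  obtain j k where jk: "j < n" "k < n" "\<bar>r z j * r w k - r z k * r w j\<bar> = 1"
    using eqmod_pair_nonzero[OF zw ne(3)] by blast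
  define \<alpha> \<beta> \<gamma> where "\<alpha> = r x j * r w k - r x k * r w j" "\<beta> = r x j * r z k - r x k * r z j"
    "\<gamma> = r z j * r w k - r z k * r w j"
  have \<alpha>: "\<alpha> = 0 \<or> \<alpha> = 1 \<or> \<alpha> = -1" using eqmod_pair_minor[OF xw ne(2) jk(1,2)] unfolding \<alpha>_\<beta>_\<gamma>_def by (auto simp: abs_if split: if_splits)
  have \<beta>: "\<beta> = 0 \<or> \<beta> = 1 \<or> \<beta> = -1" using eqmod_pair_minor[OF xz ne(1) jk(1,2)] unfolding \<alpha>_\<beta>_\<gamma>_def by (auto simp: abs_if split: if_splits)
  have \<gamma>: "\<gamma> = 1 \<or> \<gamma> = -1" using jk(3) unfolding \<alpha>_\<beta>_\<gamma>_def by (auto simp: abs_if split: if_splits)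
  have *: "\<bar>\<gamma> * r x l - \<alpha> * r z l + \<beta> * r w l\<bar> = 0 \<or> \<bar>\<gamma> * r x l - \<alpha> * r z l + \<beta> * r w l\<bar> = 2" if "l < n" for l
  proof -
    have "minor r [x,z,w] [j,k,l] = \<gamma> * r x l - \<alpha> * r z l + \<beta> * r w l"
      unfolding minor_3 \<alpha>_\<beta>_\<gamma>_def by (simp add: algebra_simps)
    then show ?thesis using eqmod_triple_minor[OF xzw d jk(1,2) that] by simp
  qed
  have "\<alpha> \<noteq> 0"
  proof
    assume 0: "\<alpha> = 0"
    have s: "r x l = 0 \<longleftrightarrow> \<beta> * r w l = 0" if "l < n" for l
      using *[OF that] \<beta> \<gamma> 0 ex[OF that] ew[OF that] by (elim disjE) simp_all
    have "\<beta> \<noteq> 0" using s eqmod_unit_entries(2)[OF x] by auto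
    then have "same_supp n r x w" using s by (simp add: same_supp_def)
    then show False using eqmod_pair(2)[OF x w xw ne(2)] by simp
  qed
  moreover have "\<beta> \<noteq> 0"
  proof
    assume 0: "\<beta> = 0"
    have s: "r x l = 0 \<longleftrightarrow> \<alpha> * r z l = 0" if "l < n" for l
      using *[OF that] \<alpha> \<gamma> 0 ex[OF that] ez[OF that] by (elim disjE) simp_all
    have "\<alpha> \<noteq> 0" using s eqmod_unit_entries(2)[OF x] by auto
    then have "same_supp n r x z" using s by (simp add: same_supp_def)
    then show False using eqmod_pair(2)[OF x z xz ne(1)] by simp
  qed
  ultimately have ab: "\<alpha> = 1 \<or> \<alpha> = -1" "\<beta> = 1 \<or> \<beta> = -1" using \<alpha> \<beta> by auto
  show ?thesis
    using *[OF l] ab \<gamma> ex[OF l] ez[OF l] ew[OF l] by (elim disjE) simp_all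
qed

text \<open>The sign of \<open>x\<close> relative to \<open>z\<close> determines its sign relative
  to \<open>w\<close>: with the opposite choice \<open>x\<close> would be a linear combination of
  \<open>z\<close> and \<open>w\<close>, and all minors of the triple would vanish.\<close>

lemma eqmod_even_triple_form:
  assumes x: "eqmod n r {x} 1" and z: "eqmod n r {z} 1" and w: "eqmod n r {w} 1"
    and xz: "eqmod n r {x, z} 1" and xw: "eqmod n r {x, w} 1" and zw: "eqmod n r {z, w} 1"
    and xzw: "eqmod n r {x, z, w} 2" and d: "distinct [x, z, w]"
    and \<sigma>: "\<sigma> \<in> {1,-1}" "\<forall>j<n. r z j \<noteq> 0 \<longrightarrow> r w j \<noteq> 0 \<longrightarrow> r z j = \<sigma> * r w j"
  shows "\<exists>\<tau>\<in>{1,-1}. \<forall>j<n. r x j = (if r z j \<noteq> 0 \<and> r w j \<noteq> 0 then 0 else \<tau> * (r z j + \<sigma> * r w j))"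
proof -
  have ne: "x \<noteq> z" "x \<noteq> w" "z \<noteq> w" using d by auto
  note supp = eqmod_even_triple_supp[OF x z w xz xw zw xzw d]
  obtain \<tau> where \<tau>: "\<tau> \<in> {1,-1}" "\<forall>j<n. r x j \<noteq> 0 \<longrightarrow> r z j \<noteq> 0 \<longrightarrow> r x j = \<tau> * r z j"
    using eqmod_pair_sign[OF x z xz ne(1)] by blast
  obtain \<upsilon> where \<upsilon>: "\<upsilon> \<in> {1,-1}" "\<forall>j<n. r x j \<noteq> 0 \<longrightarrow> r w j \<noteq> 0 \<longrightarrow> r x j = \<upsilon> * r w j"
    using eqmod_pair_sign[OF x w xw ne(2)] by blast
  have "\<upsilon> \<noteq> - \<tau> * \<sigma>"
  proof
    assume a: "\<upsilon> = - \<tau> * \<sigma>"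
    \<comment> \<open>On the common support of \<open>z\<close> and \<open>w\<close> the two terms
      cancel, in accordance with \<open>supp\<close>.\<close>
    have lin: "r x j = \<tau> * r z j + \<upsilon> * r w j" if "j < n" for j
      using supp[OF that] \<tau>(2) \<upsilon>(2) \<sigma>(2) a that by (cases "r z j = 0"; cases "r w j = 0"; cases "r x j = 0") auto
    obtain j k l where jkl: "j < n" "k < n" "l < n" "\<bar>minor r [x,z,w] [j,k,l]\<bar> = 2"
      using eqmod_triple_nonzero[OF xzw d] by blast
    have "minor r [x,z,w] [j,k,l] = 0"
      unfolding minor_3 lin[OF jkl(1)] lin[OF jkl(2)] lin[OF jkl(3)] by (simp add: algebra_simps)
    then show False using jkl(4) by simp
  qed
  then have u: "\<upsilon> = \<tau> * \<sigma>" using \<tau>(1) \<upsilon>(1) \<sigma>(1) by auto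
  have "\<forall>j<n. r x j = (if r z j \<noteq> 0 \<and> r w j \<noteq> 0 then 0 else \<tau> * (r z j + \<sigma> * r w j))"
  proof (intro allI impI)
    fix j assume j: "j < n"
    show "r x j = (if r z j \<noteq> 0 \<and> r w j \<noteq> 0 then 0 else \<tau> * (r z j + \<sigma> * r w j))"
      using supp[OF j] \<tau>(2) \<upsilon>(2) u j by (cases "r z j = 0"; cases "r w j = 0"; cases "r x j = 0") auto
  qed
  then show ?thesis using \<tau>(1) by blast
qed

text \<open>In an even triple, two rows determine the third up to sign. So \<open>x\<close> and
  \<open>y\<close> are parallel, and \<open>{x, y}\<close> has no nonzero minor.\<close>

lemma eqmod_no_two_even_triples:
  assumes x: "eqmod n r {x} 1" and y: "eqmod n r {y} 1" and z: "eqmod n r {z} 1" and w: "eqmod n r {w} 1"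
    and xz: "eqmod n r {x, z} 1" and xw: "eqmod n r {x, w} 1" and zw: "eqmod n r {z, w} 1"
    and yz: "eqmod n r {y, z} 1" and yw: "eqmod n r {y, w} 1" and xy: "eqmod n r {x, y} e"
    and xzw: "eqmod n r {x, z, w} 2" and yzw: "eqmod n r {y, z, w} 2" and d: "distinct [x, y, z, w]"
  shows False
proof -
  have ne: "z \<noteq> w" "x \<noteq> y" and d': "distinct [x,z,w]" "distinct [y,z,w]" using d by auto
  obtain \<sigma> where \<sigma>: "\<sigma> \<in> {1,-1}" "\<forall>j<n. r z j \<noteq> 0 \<longrightarrow> r w j \<noteq> 0 \<longrightarrow> r z j = \<sigma> * r w j"
    using eqmod_pair_sign[OF z w zw ne(1)] by blast
  obtain \<tau> where \<tau>: "\<tau> \<in> {1,-1}" "\<forall>j<n. r x j = (if r z j \<noteq> 0 \<and> r w j \<noteq> 0 then 0 else \<tau> * (r z j + \<sigma> * r w j))"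
    using eqmod_even_triple_form[OF x z w xz xw zw xzw d'(1) \<sigma>] by blast
  obtain \<upsilon> where \<upsilon>: "\<upsilon> \<in> {1,-1}" "\<forall>j<n. r y j = (if r z j \<noteq> 0 \<and> r w j \<noteq> 0 then 0 else \<upsilon> * (r z j + \<sigma> * r w j))"
    using eqmod_even_triple_form[OF y z w yz yw zw yzw d'(2) \<sigma>] by blast
  have par: "r y j = \<upsilon> * \<tau> * r x j" if "j < n" for j
    using \<tau> \<upsilon>(2) that by auto
  obtain j k where jk: "j < n" "k < n" "\<bar>r x j * r y k - r x k * r y j\<bar> = e"
    using eqmod_pair_nonzero[OF xy ne(2)] by blast
  have "r x j * r y k - r x k * r y j = 0" unfolding par[OF jk(1)] par[OF jk(2)] by simp
  then show False using jk(3) eqmod_pos[OF xy] by simp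
qed

text \<open>On the common support of the \<open>xs\<close> every row of \<open>xs\<close> agrees with \<open>z\<close> up to a sign wherever \<open>z\<close> does
  not vanish, so these columns are parallel and a nonzero minor uses at most one of them. Hence the row
  of \<open>z\<close> can be split off together with one column.\<close>

lemma minor_add_row_same_supp:
  assumes ux: "\<And>x. x \<in> set xs \<Longrightarrow> eqmod n r {x} 1" and uz: "eqmod n r {z} 1"
    and pair: "\<And>x. x \<in> set xs \<Longrightarrow> eqmod n r {x, z} 1" and z: "z \<notin> set xs"
    and same: "\<And>x y. x \<in> set xs \<Longrightarrow> y \<in> set xs \<Longrightarrow> same_supp n r x y"
    and ex: "eqmod n r (set xs) d" and xs: "distinct xs"
    and cs: "set cs \<subseteq> {..<n}" "length cs = Suc (length xs)" and nz: "minor r (xs @ [z]) cs \<noteq> 0"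
  shows "\<bar>minor r (xs @ [z]) cs\<bar> = d"
proof -
  have split: "\<bar>minor r (xs @ [z]) cs\<bar> = d"
    if j: "j \<in> set cs" "r z j \<noteq> 0"
      and zero: "(\<forall>x\<in>set xs. r x j = 0) \<or> (\<forall>k\<in>set cs - {j}. r z k = 0)" for j
  proof -
    have dc: "distinct cs" using minor_nonzero_distinct_cols[OF _ nz] cs by simp
    define ds where "ds = remove1 j cs"
    have m: "mset cs = mset (ds @ [j])" using j by (simp add: ds_def)
    have len: "length ds = length xs" using cs(2) j by (simp add: ds_def length_remove1)
    have sd: "set ds = set cs - {j}" using dc by (simp add: ds_def)
    have "minor r (xs @ [z]) (ds @ [j]) = minor r xs ds * minor r [z] [j]"
      using zero
    proof
      assume "\<forall>x\<in>set xs. r x j = 0"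
      then show ?thesis by (intro minor_block_upper) (use len in auto)
    next
      assume "\<forall>k\<in>set cs - {j}. r z k = 0"
      then show ?thesis by (intro minor_block) (use len sd in auto)
    qed
    moreover have "\<bar>r z j\<bar> = 1" using eqmod_unit_entries(1)[OF uz, of j] j subsetD[OF cs(1) j(1)] by auto
    moreover have "\<bar>minor r (xs @ [z]) cs\<bar> = \<bar>minor r (xs @ [z]) (ds @ [j])\<bar>"
      by (rule minor_perm_cols[OF m]) (use cs in simp)
    ultimately have "\<bar>minor r (xs @ [z]) cs\<bar> = \<bar>minor r xs ds\<bar>" by (simp add: abs_mult minor_single)
    moreover have "\<bar>minor r xs ds\<bar> = 0 \<or> \<bar>minor r xs ds\<bar> = d"
      by (rule eqmod_minor[OF ex xs refl]) (use sd cs len in auto)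
    ultimately show ?thesis using nz by auto
  qed
  have "\<exists>j\<in>set cs. r z j \<noteq> 0"
    using minor_eq_0_zero_row[of cs "xs @ [z]" z r] nz cs by auto
  then obtain j where j: "j \<in> set cs" "r z j \<noteq> 0" by blast
  show ?thesis
  proof (cases "\<exists>j\<in>set cs. r z j \<noteq> 0 \<and> (\<forall>x\<in>set xs. r x j = 0)")
    case True
    then show ?thesis using split by blast
  next
    case False
    have nzx: "r x k \<noteq> 0" if "k \<in> set cs" "r z k \<noteq> 0" "x \<in> set xs" for k x
    proof
      assume "r x k = 0"
      then have "\<forall>y\<in>set xs. r y k = 0" using same[OF that(3)] that(1) cs(1) by (auto simp: same_supp_def)
      then show False using False that by blast
    qed
    have "r z k = 0" if k: "k \<in> set cs - {j}" for k
    proof (rule ccontr)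
      assume rk: "r z k \<noteq> 0"
      have "r x j = (r z j / r z k) * r x k" if x: "x \<in> set (xs @ [z])" for x
      proof (cases "x = z")
        case True
        then show ?thesis using rk by simp
      next
        case False
        then have x: "x \<in> set xs" using x by simp
        have jk: "j < n" "k < n" using j k cs(1) by auto
        obtain \<sigma> where \<sigma>: "\<forall>j<n. r x j \<noteq> 0 \<longrightarrow> r z j \<noteq> 0 \<longrightarrow> r x j = \<sigma> * r z j"
          using eqmod_pair_sign[OF ux[OF x] uz pair[OF x] False] by blast
        have "r x j = \<sigma> * r z j" using \<sigma> nzx[OF j x] jk(1) j(2) by blast
        moreover have "r x k = \<sigma> * r z k" using \<sigma> nzx[OF _ rk x] jk(2) k rk by blast
        ultimately show ?thesis using rk by simp
      qed
      moreover have "length cs = length (xs @ [z])" "k \<in> set cs" "j \<noteq> k" using cs k by auto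
      ultimately have "minor r (xs @ [z]) cs = 0" using j(1) minor_parallel_cols by blast
      then show False using nz by simp
    qed
    then show ?thesis using split j by blast
  qed
qed

section \<open>An abstract defect function\<close>

lemma pair_neq_if_card_ge_3: "card L \<ge> 3 \<Longrightarrow> {a, b} \<noteq> L"
  by (cases "a = b") auto

lemma card_2_other:
  assumes "card S = 2" "w \<in> S" obtains x where "S = {x, w}" "x \<noteq> w"
proof -
  obtain a b where "S = {a, b}" "a \<noteq> b" using assms(1) by (auto simp: card_2_iff)
  then show thesis using that[of a] that[of b] assms(2) by auto
qed

definition gap :: "('a set \<Rightarrow> real) \<Rightarrow> 'a set \<Rightarrow> 'a \<Rightarrow> 'a \<Rightarrow> real" where
  "gap f Y x y = f (insert x (insert y Y)) + f Y - f (insert x Y) - f (insert y Y)"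

lemma gap_commute: "gap f Y x y = gap f Y y x"
  by (simp add: gap_def insert_commute)

text \<open>Both sides are the third difference of \<open>f\<close> at \<open>Y\<close> in the
  directions \<open>x\<close>, \<open>y\<close>, \<open>z\<close>, which is symmetric in
  them.\<close>

lemma gap_exchange: "gap f (insert z Y) x y - gap f Y x y = gap f (insert y Y) x z - gap f Y x z"
  by (simp add: gap_def insert_commute)

definition flace :: "('a set \<Rightarrow> real) \<Rightarrow> 'a set \<Rightarrow> bool" where
  "flace f L \<longleftrightarrow> f L \<noteq> 0 \<and> (\<forall>X. X \<subset> L \<longrightarrow> f X = 0)"

lemma flace_psubset: "flace f L \<Longrightarrow> X \<subset> L \<Longrightarrow> f X = 0"
  and flace_nonzero: "flace f L \<Longrightarrow> f L \<noteq> 0"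
  and flaceI: "f L \<noteq> 0 \<Longrightarrow> (\<And>X. X \<subset> L \<Longrightarrow> f X = 0) \<Longrightarrow> flace f L"
  and flace_subset_eq: "flace f L \<Longrightarrow> flace f L' \<Longrightarrow> L \<subseteq> L' \<Longrightarrow> L = L'"
  by (auto simp: flace_def)

text \<open>The sum renormalizes contracted singletons to \<open>0\<close>.\<close>

definition contr :: "('a set \<Rightarrow> real) \<Rightarrow> 'a \<Rightarrow> 'a set \<Rightarrow> real" where
  "contr f z X = f (insert z X) - (\<Sum>x\<in>X. f {z, x})"

lemma gap_contr:
  assumes "finite Y" "x \<notin> Y" "y \<notin> Y" "x \<noteq> y"
  shows "gap (contr f z) Y x y = gap f (insert z Y) x y"
  using assms by (simp add: gap_def contr_def insert_commute)

text \<open>The axioms abstract \<open>f(X) = log 2 (eqdet X)\<close> on the subsets of a te-set: \<open>gap f Y x y = 1\<close> says that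
  \<open>x\<close> and \<open>y\<close> have the same support after contraction of \<open>Y\<close>, and minimal sets with \<open>f \<noteq> 0\<close> (\<open>flace\<close>)
  stand for te-laces. The last two axioms are the facts on three and four rows.\<close>

locale excess =
  fixes A :: "'a set" and f :: "'a set \<Rightarrow> real"
  assumes finA: "finite A" and f_empty: "f {} = 0" and f_single: "x \<in> A \<Longrightarrow> f {x} = 0"
    and gap01: "Y \<subseteq> A \<Longrightarrow> distinct [x,y] \<Longrightarrow> {x,y} \<subseteq> A - Y \<Longrightarrow> gap f Y x y = 0 \<or> gap f Y x y = 1"
    and gap_trans: "Y \<subseteq> A \<Longrightarrow> distinct [x,y,z] \<Longrightarrow> {x,y,z} \<subseteq> A - Y \<Longrightarrow>
       gap f Y x y = 1 \<Longrightarrow> gap f Y y z = 1 \<Longrightarrow> gap f Y x z = 1"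
    and gap_triple: "Y \<subseteq> A \<Longrightarrow> distinct [x,y,z] \<Longrightarrow> {x,y,z} \<subseteq> A - Y \<Longrightarrow>
       gap f Y x y = 1 \<Longrightarrow> gap f Y y z = 1 \<Longrightarrow> gap f (insert z Y) x y = 0"
    and no_two_triples: "Y \<subseteq> A \<Longrightarrow> distinct [x,y,z,w] \<Longrightarrow> {x,y,z,w} \<subseteq> A - Y \<Longrightarrow>
       gap f Y x z = 0 \<Longrightarrow> gap f Y x w = 0 \<Longrightarrow> gap f Y z w = 0 \<Longrightarrow> gap f Y y z = 0 \<Longrightarrow> gap f Y y w = 0 \<Longrightarrow>
       gap f (insert w Y) x z = 1 \<Longrightarrow> gap f (insert w Y) y z = 1 \<Longrightarrow> False"
begin

text \<open>By transitivity \<open>gap f Y x z\<close> is 0 too. In \<open>gap_exchange\<close> the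
  left side is then 0 or -1 and the right side 0 or 1, so both vanish: adding an element of another
  class changes nothing. The last claim is a second exchange.\<close>

lemma gap_persist:
  assumes "Y \<subseteq> A" "distinct [x,y,z]" "{x,y,z} \<subseteq> A - Y" "gap f Y x y = 1" "gap f Y y z = 0"
  shows "gap f (insert z Y) x y = 1" "gap f (insert y Y) x z = 0" "gap f (insert x Y) y z = 0"
proof -
  have "gap f Y x z \<noteq> 1"
    using gap_trans[of Y y x z] assms by (auto simp: gap_commute insert_commute)
  then have xz: "gap f Y x z = 0" using gap01[of Y x z] assms by auto
  have "gap f (insert z Y) x y = 0 \<or> gap f (insert z Y) x y = 1"
    by (rule gap01) (use assms in auto)
  moreover have "gap f (insert y Y) x z = 0 \<or> gap f (insert y Y) x z = 1"
    by (rule gap01) (use assms in auto)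
  ultimately show *: "gap f (insert z Y) x y = 1" "gap f (insert y Y) x z = 0"
    using gap_exchange[of f z Y x y] assms xz by auto
  show "gap f (insert x Y) y z = 0"
    using gap_exchange[of f z Y y x] * assms by (simp add: gap_commute)
qed

lemma mono_insert:
  assumes "X \<subseteq> A" "x \<in> A" shows "f X \<le> f (insert x X)"
proof -
  have "finite X" using assms finA finite_subset by blast
  then show ?thesis using assms(1)
  proof (induction X)
    case empty
    then show ?case using f_empty f_single assms by simp
  next
    case (insert y X)
    show ?case
    proof (cases "x = y \<or> x \<in> X")
      case True
      then show ?thesis by (auto simp: insert_absorb)
    next
      case False
      then have "gap f X x y = 0 \<or> gap f X x y = 1" using insert assms by (intro gap01) auto
      then show ?thesis using insert by (auto simp: gap_def)
    qed
  qed
qed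

lemma mono:
  assumes "X \<subseteq> Y" "Y \<subseteq> A" shows "f X \<le> f Y"
proof -
  have "finite Y" using assms finA finite_subset by blast
  then have "finite (Y - X)" by simp
  have "f X \<le> f (X \<union> Z)" if "finite Z" "Z \<subseteq> Y - X" for Z
    using that
  proof (induction Z)
    case (insert z Z)
    then have "f (X \<union> Z) \<le> f (insert z (X \<union> Z))" using assms by (intro mono_insert) auto
    then show ?case using insert by simp
  qed simp
  from this[OF \<open>finite (Y - X)\<close>] show ?thesis using assms by (simp add: Un_absorb1)
qed

lemma nonneg: "X \<subseteq> A \<Longrightarrow> f X \<ge> 0"
  using mono[of "{}" X] f_empty by simp

lemma flace_exists:
  assumes "X \<subseteq> A" "f X \<noteq> 0" shows "\<exists>L\<subseteq>X. flace f L"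
proof -
  have "finite X" using assms finA finite_subset by blast
  then show ?thesis using assms
  proof (induction X rule: finite_psubset_induct)
    case (psubset X)
    show ?case
    proof (cases "\<exists>Z. Z \<subset> X \<and> f Z \<noteq> 0")
      case True
      then obtain Z where "Z \<subset> X" "f Z \<noteq> 0" by blast
      then show ?thesis using psubset.IH[of Z] psubset.prems by (meson psubset_imp_subset subset_trans)
    next
      case False
      then show ?thesis using psubset.prems by (auto simp: flace_def)
    qed
  qed
qed

lemma flace_two:
  assumes "L \<subseteq> A" "flace f L" obtains x y where "x \<in> L" "y \<in> L" "x \<noteq> y"
proof -
  have "L \<noteq> {}" using assms f_empty by (auto simp: flace_def)
  then obtain x where "x \<in> L" by blast
  moreover have "L \<noteq> {x}" using assms f_single by (auto simp: flace_def)
  ultimately show thesis using that by blast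
qed

lemma flace_finite: "L \<subseteq> A \<Longrightarrow> finite L"
  using finA finite_subset by blast

lemma flace_card:
  assumes "L \<subseteq> A" "flace f L" shows "card L \<ge> 2"
proof -
  obtain x y where "x \<in> L" "y \<in> L" "x \<noteq> y" using flace_two[OF assms] .
  then show ?thesis using card_mono[OF flace_finite[OF assms(1)], of "{x,y}"] by simp
qed

text \<open>All proper subsets have value 0, so the gap at \<open>L - {x,y}\<close> is
  \<open>f L\<close> itself.\<close>

lemma flace_gap:
  assumes "L \<subseteq> A" "flace f L" "x \<in> L" "y \<in> L" "x \<noteq> y"
  shows "gap f (L - {x,y}) x y = 1" "f L = 1"
proof -
  have i: "insert x (L - {x,y}) = L - {y}" "insert y (L - {x,y}) = L - {x}"
    "insert x (L - {x}) = L"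
    using assms by auto
  have p: "L - {x,y} \<subset> L" "L - {x} \<subset> L" "L - {y} \<subset> L" using assms by auto
  have *: "gap f (L - {x,y}) x y = f L"
    unfolding gap_def i p[THEN flace_psubset[OF assms(2)]] by simp
  moreover have "gap f (L - {x,y}) x y = 0 \<or> gap f (L - {x,y}) x y = 1"
    by (rule gap01) (use assms in auto)
  moreover have "f L \<noteq> 0" using assms by (simp add: flace_def)
  ultimately show "gap f (L - {x,y}) x y = 1" "f L = 1" by auto
qed

lemma gap_pair: "x \<in> A \<Longrightarrow> y \<in> A \<Longrightarrow> gap f {} x y = f {x, y}"
  using f_empty f_single by (simp add: gap_def)

lemma flace_pair: 
  assumes "x \<in> A" "y \<in> A" "f {x, y} \<noteq> 0" shows "flace f {x, y}"
proof -
  have "f X = 0" if "X \<subset> {x, y}" for X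
  proof -
    have "X = {} \<or> X = {x} \<or> X = {y}" using that by blast
    then show ?thesis using f_empty f_single assms by auto
  qed
  then show ?thesis using assms by (simp add: flace_def)
qed

text \<open>Up to an additive function, \<open>contr f z\<close> is \<open>f\<close> with
  \<open>z\<close> inserted. Its gaps are hence those of \<open>f\<close> with \<open>z\<close>
  added to \<open>Y\<close>, and each axiom is inherited.\<close>

lemma excess_contr:
  assumes z: "z \<in> A" shows "excess (A - {z}) (contr f z)"
proof
  have g: "gap (contr f z) Y x y = gap f (insert z Y) x y" if "Y \<subseteq> A - {z}" "x \<notin> Y" "y \<notin> Y" "x \<noteq> y" for Y x y
    by (rule gap_contr) (use that finA finite_subset in auto)
  fix x y Y assume a: "Y \<subseteq> A - {z}" "distinct [x,y]" "{x,y} \<subseteq> (A - {z}) - Y"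
  show "gap (contr f z) Y x y = 0 \<or> gap (contr f z) Y x y = 1"
  proof -
    have "gap f (insert z Y) x y = 0 \<or> gap f (insert z Y) x y = 1"
      by (rule gap01) (use a z in auto)
    moreover have "gap (contr f z) Y x y = gap f (insert z Y) x y" by (rule g) (use a in auto)
    ultimately show ?thesis by simp
  qed
next
  have g: "gap (contr f z) Y x y = gap f (insert z Y) x y" if "Y \<subseteq> A - {z}" "x \<notin> Y" "y \<notin> Y" "x \<noteq> y" for Y x y
    by (rule gap_contr) (use that finA finite_subset in auto)
  fix x y v Y assume a: "Y \<subseteq> A - {z}" "distinct [x,y,v]" "{x,y,v} \<subseteq> (A - {z}) - Y"
    "gap (contr f z) Y x y = 1" "gap (contr f z) Y y v = 1"
  then have b: "gap f (insert z Y) x y = 1" "gap f (insert z Y) y v = 1" using g by auto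
  have "gap f (insert z Y) x v = 1" by (rule gap_trans[OF _ _ _ b]) (use a z in auto)
  then show "gap (contr f z) Y x v = 1" using g a by auto
  have "gap f (insert v (insert z Y)) x y = 0" by (rule gap_triple[OF _ _ _ b]) (use a z in auto)
  then show "gap (contr f z) (insert v Y) x y = 0" using g[of "insert v Y" x y] a by (auto simp: insert_commute)
next
  have g: "gap (contr f z) Y x y = gap f (insert z Y) x y" if "Y \<subseteq> A - {z}" "x \<notin> Y" "y \<notin> Y" "x \<noteq> y" for Y x y
    by (rule gap_contr) (use that finA finite_subset in auto)
  fix x y v w Y assume a: "Y \<subseteq> A - {z}" "distinct [x,y,v,w]" "{x,y,v,w} \<subseteq> (A - {z}) - Y"
    "gap (contr f z) Y x v = 0" "gap (contr f z) Y x w = 0" "gap (contr f z) Y v w = 0"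
    "gap (contr f z) Y y v = 0" "gap (contr f z) Y y w = 0"
    "gap (contr f z) (insert w Y) x v = 1" "gap (contr f z) (insert w Y) y v = 1"
  have n: "x \<notin> Y" "y \<notin> Y" "v \<notin> Y" "w \<notin> Y" "x \<noteq> v" "x \<noteq> w" "v \<noteq> w" "y \<noteq> v" "y \<noteq> w" using a by auto
  have wY: "insert w Y \<subseteq> A - {z}" using a by auto
  show False
  proof (rule no_two_triples[of "insert z Y" x y v w])
    show "gap f (insert w (insert z Y)) x v = 1" "gap f (insert w (insert z Y)) y v = 1"
      using a(9,10) g[OF wY, of x v] g[OF wY, of y v] n by (simp_all add: insert_commute)
  qed (use a(4-8) g[OF a(1)] n in simp_all, use a(1-3) z in auto)
qed (use z finA f_single in \<open>auto simp: contr_def\<close>)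

text \<open>As \<open>card L \<ge> 3\<close>, the pairs \<open>{z, x}\<close> are proper subsets of
  \<open>L\<close>, and the renormalizing sum of \<open>contr\<close> vanishes inside
  \<open>L\<close>.\<close>

lemma contr_flace:
  assumes L: "L \<subseteq> A" "flace f L" "z \<in> L" "card L \<ge> 3"
  shows "flace (contr f z) (L - {z})"
proof -
  have 0: "f {z, x} = 0" if "x \<in> L" for x
  proof -
    have "{z,x} \<noteq> L" using pair_neq_if_card_ge_3[OF L(4)] by blast
    then have "{z, x} \<subset> L" using that L(3) by blast
    then show ?thesis by (rule flace_psubset[OF L(2)])
  qed
  have eq: "contr f z X = f (insert z X)" if "X \<subseteq> L - {z}" for X
    using 0 that by (auto simp: contr_def intro!: sum.neutral)
  have "contr f z X = 0" if "X \<subset> L - {z}" for X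
  proof -
    have "insert z X \<subset> L" using that L by auto
    then show ?thesis using eq[of X] that flace_psubset[OF L(2)] by simp
  qed
  moreover have "contr f z (L - {z}) \<noteq> 0"
    using eq[of "L - {z}"] flace_nonzero[OF L(2)] L(3) by (simp add: insert_absorb)
  ultimately show ?thesis by (intro flaceI)
qed

end

text \<open>Contracting a suitable element leaves two distinct laces that still meet, which is why
  the induction runs over all systems at once. It bottoms out at two triples with two common
  elements and at a triple meeting a pair; both contradict \<open>no_two_triples\<close>. The
  conclusion for \<open>L'\<close> follows by exchanging the roles.\<close>

lemma flaces_meet:
  assumes "excess A f" "L \<subseteq> A" "L' \<subseteq> A" "flace f L" "flace f L'" "L \<noteq> L'" "L \<inter> L' \<noteq> {}"
  shows "card L = 2"
  using assms
proof (induction "card (L \<union> L')" arbitrary: A f L L' rule: less_induct)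
  case less
  interpret excess A f by fact
  note LA = less.prems(2,3) and lace = less.prems(4,5) and ne = less.prems(6,7)
  have fin: "finite L" "finite L'" using LA flace_finite by auto
  have c2: "card L \<ge> 2" "card L' \<ge> 2" using flace_card LA lace by auto
  have ninc: "\<not> L \<subseteq> L'" "\<not> L' \<subseteq> L" using flace_subset_eq lace ne(1) by metis+
  show ?case
  proof (rule ccontr)
    assume L2: "card L \<noteq> 2"
    then have L3: "card L \<ge> 3" using c2 by simp
    obtain z where z: "z \<in> L" "z \<in> L'" using ne by blast
    have smaller: "card (M \<union> M') < card (L \<union> L')" if "M \<union> M' \<subset> L \<union> L'" for M M'
      using that fin by (intro psubset_card_mono) auto
    show False
    proof (cases "L \<inter> L' = {z}")
      case False
      then obtain w where w: "w \<in> L" "w \<in> L'" "w \<noteq> z" using z by blast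
      have L3': "card L' \<ge> 3"
      proof -
        obtain y where "y \<in> L'" "y \<notin> L" using ninc by blast
        then have "{y,z,w} \<subseteq> L'" "y \<noteq> z" "y \<noteq> w" using w z by auto
        then have "{y,z,w} \<subseteq> L'" "card {y,z,w} = 3" using w by auto
        then show ?thesis using card_mono[OF fin(2)] by metis
      qed
      have s: "card (L - {z} \<union> (L' - {z})) < card (L \<union> L')" using z by (intro smaller) auto
      \<comment> \<open>Contracting \<open>z\<close> leaves laces that still have \<open>w\<close>
        in common.\<close>
      have IH1: "card (L - {z}) = 2"
        by (rule less.hyps[OF s excess_contr[of z]])
          (use z LA w ne(1) contr_flace[OF LA(1) lace(1) z(1) L3] contr_flace[OF LA(2) lace(2) z(2) L3'] in auto)
      have s': "card (L' - {z} \<union> (L - {z})) < card (L \<union> L')" using z by (intro smaller) auto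
      have IH2: "card (L' - {z}) = 2"
        by (rule less.hyps[OF s' excess_contr[of z]])
          (use z LA w ne(1) contr_flace[OF LA(1) lace(1) z(1) L3] contr_flace[OF LA(2) lace(2) z(2) L3'] in auto)
      obtain x where x: "L - {z} = {x, w}" "x \<noteq> w" using card_2_other[OF IH1, of w] w by auto
      obtain y where y: "L' - {z} = {y, w}" "y \<noteq> w" using card_2_other[OF IH2, of w] w by auto
      have Le: "L = {x,z,w}" "L' = {y,z,w}" using x y z by auto
      have d: "distinct [x,y,z,w]" using x y w ne(1) Le by auto
      have A4: "{x,y,z,w} \<subseteq> A" using LA Le by auto
      have p0: "f X = 0" if "X \<subset> L \<or> X \<subset> L'" for X using that lace flace_psubset by metis
      have pr: "f {x,z} = 0" "f {x,w} = 0" "f {z,w} = 0" "f {y,z} = 0" "f {y,w} = 0"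
        using d by (auto intro!: p0 simp: Le)
      have t: "f {x,z,w} = 1" "f {y,z,w} = 1" using flace_gap(2)[OF LA(1) lace(1)] flace_gap(2)[OF LA(2) lace(2)] d
        unfolding Le by auto
      show False
        by (rule no_two_triples[of "{}" x y z w])
          (use d A4 pr t f_single f_empty in \<open>auto simp: gap_def insert_commute\<close>)
    next
      case True
      note int = True
      show False
      proof (cases "card L' = 2")
        case True
        then obtain y where y: "L' = {y, z}" "y \<noteq> z" using card_2_other[OF True z(2)] by auto
        have yL: "y \<notin> L" using y int by auto
        have yA: "y \<in> A" "z \<in> A" using LA y by auto
        have yz: "gap f {} y z = 1" using flace_gap(2)[OF LA(2) lace(2), of y z] y gap_pair yA by auto
        have z0: "gap f {} z u = 0" if "u \<in> L" "u \<noteq> z" for u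
        proof -
          have "{z,u} \<noteq> L" using pair_neq_if_card_ge_3[OF L3] by blast
          then have "{z, u} \<subset> L" using that z by auto
          then show ?thesis using gap_pair[of z u] flace_psubset[OF lace(1)] that LA z by auto
        qed
        obtain u where u: "u \<in> L" "u \<noteq> z" using flace_two[OF LA(1) lace(1)] by metis
        \<comment> \<open>The pair \<open>{y, z}\<close> remains a lace after contraction of
          \<open>u\<close>, because \<open>u\<close> is not in the class of
          \<open>z\<close>.\<close>
        have per: "gap f {u} y z = 1" "gap f {z} y u = 0"
          using gap_persist[of "{}" y z u] yz z0[OF u] u yL y yA LA by auto
        show False
        proof (cases "card L = 3")
          case True
          have "card (L - {z,u}) = 1" using True u z fin by (simp add: card_Diff_subset)
          then obtain v where v: "L - {z,u} = {v}" by (metis card_1_singletonE)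
          then have Le: "L = {z,u,v}" and d: "distinct [z,y,v,u]" using u z yL y by auto
          have A4: "{z,y,v,u} \<subseteq> A" using LA yA Le by auto
          have uv: "gap f {} v u = 0"
            using flace_psubset[OF lace(1), of "{v,u}"] d A4 by (subst gap_pair) (auto simp: Le)
          have yuv: "gap f {} y t = 0" if "t \<in> {u,v}" for t
          proof -
            have "gap f {} t y \<noteq> 1"
              using gap_trans[of "{}" t y z] z0[of t] yz d A4 that Le by (auto simp: gap_commute)
            then show ?thesis using gap01[of "{}" t y] d A4 that by (auto simp: gap_commute)
          qed
          have L1: "f {z,u,v} = 1" using flace_gap(2)[OF LA(1) lace(1), of z u] u z Le by auto
          have zv: "gap f {u} z v = 1"
          proof -
            have "{u,z} \<subset> L" "{u,v} \<subset> L" using d by (auto simp: Le)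
            then have "f {u,z} = 0" "f {u,v} = 0" using flace_psubset[OF lace(1)] by auto
            then show ?thesis using L1 A4 by (simp add: gap_def insert_commute f_single)
          qed
          \<comment> \<open>Over \<open>u\<close> the three elements \<open>y\<close>,
            \<open>z\<close>, \<open>v\<close> lie in one class, so \<open>{z, u, v}\<close> and
            \<open>{y, u, v}\<close> would both be even triples containing
            \<open>{u, v}\<close>.\<close>
          have yv: "gap f {u} y v = 1"
            by (rule gap_trans[OF _ _ _ per(1) zv]) (use d A4 in auto)
          show False
            by (rule no_two_triples[of "{}" z y v u])
              (use d A4 z0[of u] z0[of v] uv yuv zv yv Le in auto)
        next
          case False
          then have L4: "card L \<ge> 4" using L3 by simp
          have s: "card (L - {u} \<union> {y,z}) < card (L \<union> L')" using u yL y by (intro smaller) auto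
          interpret C: excess "A - {u}" "contr f u" using excess_contr u LA by auto
          have "contr f u {y, z} = 1"
            using per(1) gap_contr[of "{}" y z f u] y C.gap_pair[of y z] yA u yL by auto
          then have "flace (contr f u) {y, z}"
            using C.flace_pair[of y z] yA u yL by auto
          then have "card (L - {u}) = 2"
            by (intro less.hyps[OF s C.excess_axioms])
              (use contr_flace[OF LA(1) lace(1) u(1) L3] yA u yL z LA in auto)
          then show False using L4 u fin by simp
        qed
      next
        case False
        then have L3': "card L' \<ge> 3" using c2 by simp
        obtain u where u: "u \<in> L'" "u \<noteq> z" using flace_two[OF LA(2) lace(2)] by metis
        have uL: "u \<notin> L" using u int by auto
        have uA: "u \<in> A" using u LA by auto
        \<comment> \<open>A further element of \<open>L'\<close> makes \<open>insert u L\<close>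
          smaller than the union, so the induction hypothesis governs all laces inside it.\<close>
        have big: "insert u L \<subset> L \<union> L'"
        proof -
          have "L' \<noteq> {u, z}" using pair_neq_if_card_ge_3[OF L3'] by blast
          then obtain v where "v \<in> L'" "v \<noteq> u" "v \<noteq> z" using u z by auto
          then show ?thesis using u int by auto
        qed
        have only: "M = L" if M: "M \<subseteq> insert u L" "flace f M" for M
        proof (rule ccontr)
          assume "M \<noteq> L"
          have MA: "M \<subseteq> A" using M(1) LA(1) uA by blast
          obtain a b where "a \<in> M" "b \<in> M" "a \<noteq> b" using flace_two[OF MA M(2)] .
          then have i: "L \<inter> M \<noteq> {}" using M(1) by blast
          have "L \<union> M \<subset> L \<union> L'" using M(1) big by blast
          then have "card (L \<union> M) < card (L \<union> L')" by (rule smaller)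
          from less.hyps[OF this excess_axioms LA(1) MA lace(1) M(2) _ i]
          have "card L = 2" using \<open>M \<noteq> L\<close> by blast
          then show False using L2 by simp
        qed
        have z0: "f X = 0" if "X \<subset> insert u L" "X \<noteq> L" for X
        proof (rule ccontr)
          assume "f X \<noteq> 0"
          moreover have "X \<subseteq> A" using that(1) LA(1) uA by blast
          ultimately obtain M where M: "M \<subseteq> X" "flace f M" using flace_exists[of X] by blast
          have "M \<subseteq> insert u L" using M(1) that(1) by blast
          then have "M = L" using only M(2) by blast
          then show False using M(1) that uL by blast
        qed
        obtain x y where xy: "x \<in> L" "y \<in> L" "x \<noteq> y" using flace_two[OF LA(1) lace(1)] .
        define W where "W = L - {x,y}"
        have WA: "W \<subseteq> A" "{y,x,u} \<subseteq> A - W" "distinct [y,x,u]" using LA uA xy uL by (auto simp: W_def)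
        have yx: "gap f W y x = 1" using flace_gap(1)[OF LA(1) lace(1) xy] by (simp add: W_def gap_commute)
        have xW: "x \<notin> W" "y \<notin> W" "u \<notin> W" "x \<noteq> u" "y \<noteq> u" using xy uL by (auto simp: W_def)
        have Le: "L = insert x (insert y W)" using xy by (auto simp: W_def)
        have "f (insert x (insert u W)) = 0" "f (insert u W) = 0" "f W = 0" "f (insert x W) = 0"
          by (rule z0; use xW xy(3) in \<open>auto simp: Le\<close>)+
        then have xu: "gap f W x u = 0" unfolding gap_def by simp
        \<comment> \<open>\<open>u\<close> is unrelated to \<open>x\<close> at \<open>W\<close> and
          stays so once \<open>y\<close> is added; hence adding \<open>u\<close> to \<open>L\<close>
          keeps the value 1, and \<open>L\<close> remains a lace after contraction of
          \<open>u\<close>.\<close>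
        have "gap f (insert y W) x u = 0" by (rule gap_persist(3)[OF WA(1,3,2) yx xu])
        moreover have "f (insert u (insert y W)) = 0" "f (insert y W) = 0"
          by (rule z0; use xW xy(3) in \<open>auto simp: Le\<close>)+
        moreover have "f L = 1" using flace_gap(2)[OF LA(1) lace(1) xy] .
        ultimately have uL1: "f (insert u L) = 1" unfolding gap_def by (simp add: Le insert_commute)
        have pu: "f {u, x} = 0" if "x \<in> L" for x
        proof (rule z0)
          obtain v where "v \<in> L" "v \<noteq> x" using flace_two[OF LA(1) lace(1)] by metis
          then show "{u,x} \<subset> insert u L" "{u,x} \<noteq> L" using that uL by auto
        qed
        have ceq: "contr f u X = f (insert u X)" if "X \<subseteq> L" for X
          using pu that by (auto simp: contr_def intro!: sum.neutral)
        have "contr f u X = 0" if "X \<subset> L" for X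
          using ceq[of X] that uL by (auto intro!: z0)
        then have lL: "flace (contr f u) L" using uL1 ceq[of L] by (simp add: flace_def)
        have "card (L \<union> (L' - {u})) < card (L \<union> L')" using u uL by (intro smaller) auto
        then have "card L = 2"
          by (rule less.hyps[OF _ excess_contr[OF uA] _ _ lL contr_flace[OF LA(2) lace(2) u(1) L3']])
            (use LA uL z u ninc in auto)
        then show False using L2 by simp
      qed
    qed
  qed
qed

section \<open>Integrality, extensions of laces, and cliques\<close>

context excess
begin

text \<open>Integrality serves to turn strict bounds into bounds by the next integer in
  \<open>clique_excess\<close>.\<close>

lemma f_Ints: "X \<subseteq> A \<Longrightarrow> f X \<in> \<int>"
proof -
  have "finite X \<Longrightarrow> X \<subseteq> A \<Longrightarrow> f X \<in> \<int>" for X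
  proof (induction "card X" arbitrary: X rule: less_induct)
    case less
    show ?case
    proof (cases "\<exists>x\<in>X. \<exists>y\<in>X. x \<noteq> y")
      case False
      then have "X = {} \<or> (\<exists>x. X = {x})" by blast
      then show ?thesis using f_empty f_single less.prems by auto
    next
      case True
      then obtain x y where xy: "x \<in> X" "y \<in> X" "x \<noteq> y" by blast
      define Y where "Y = X - {x,y}"
      have i: "X = insert x (insert y Y)" "x \<notin> Y" "y \<notin> Y" using xy by (auto simp: Y_def)
      have IH: "f Z \<in> \<int>" if "Z \<subset> X" for Z
        using less.hyps[of Z] that less.prems psubset_card_mono finite_subset by (metis psubset_imp_subset subset_trans)
      have "f Y \<in> \<int>" "f (insert x Y) \<in> \<int>" "f (insert y Y) \<in> \<int>"
        by (rule IH; use i xy in blast)+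
      moreover have "gap f Y x y = 0 \<or> gap f Y x y = 1"
        by (rule gap01) (use i xy less.prems in auto)
      then have "gap f Y x y \<in> \<int>" by auto
      moreover have "f X = gap f Y x y - f Y + f (insert x Y) + f (insert y Y)" by (simp add: gap_def i(1))
      ultimately show ?thesis by (metis Ints_add Ints_diff)
    qed
  qed
  then show "X \<subseteq> A \<Longrightarrow> f X \<in> \<int>" using flace_finite by blast
qed

text \<open>By \<open>flaces_meet\<close>, \<open>L\<close> is the only lace inside
  \<open>insert u L\<close>. This makes all gaps between \<open>u\<close> and elements of
  \<open>L\<close> that occur here 0, so \<open>u\<close> adds nothing to
  \<open>f L\<close>.\<close>

lemma flace_extend:
  assumes L: "L \<subseteq> A" "flace f L" "card L \<ge> 3" and u: "u \<in> A" "u \<notin> L"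
  shows "X \<subset> insert u L \<Longrightarrow> X \<noteq> L \<Longrightarrow> f X = 0" and "f (insert u L) = 1"
proof -
  have z0: "f X = 0" if "X \<subset> insert u L" "X \<noteq> L" for X
  proof (rule ccontr)
    assume "f X \<noteq> 0"
    moreover have XA: "X \<subseteq> A" using that(1) L(1) u by blast
    ultimately obtain M where M: "M \<subseteq> X" "flace f M" using flace_exists[of X] by blast
    have MA: "M \<subseteq> A" using M XA by blast
    have "M \<noteq> L" using M(1) that u(2) by blast
    obtain a b where "a \<in> M" "b \<in> M" "a \<noteq> b" using flace_two[OF MA M(2)] .
    then have "L \<inter> M \<noteq> {}" using M(1) that(1) by blast
    then have "card L = 2" using flaces_meet[OF excess_axioms L(1) MA L(2) M(2)] \<open>M \<noteq> L\<close> by blast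
    then show False using L(3) by simp
  qed
  obtain x y where xy: "x \<in> L" "y \<in> L" "x \<noteq> y" using flace_two[OF L(1,2)] .
  define W where "W = L - {x,y}"
  have xW: "x \<notin> W" "y \<notin> W" "u \<notin> W" "x \<noteq> u" "y \<noteq> u" using xy u by (auto simp: W_def)
  have Le: "L = insert x (insert y W)" using xy by (auto simp: W_def)
  have WA: "W \<subseteq> A" "{y,x,u} \<subseteq> A - W" "distinct [y,x,u]" using L(1) u xy by (auto simp: W_def)
  have yx: "gap f W y x = 1" using flace_gap(1)[OF L(1,2) xy] by (simp add: W_def gap_commute)
  have "f (insert x (insert u W)) = 0" "f (insert u W) = 0" "f W = 0" "f (insert x W) = 0"
    by (rule z0; use xW xy(3) in \<open>auto simp: Le\<close>)+
  then have xu: "gap f W x u = 0" unfolding gap_def by simp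
  have "gap f (insert y W) x u = 0" by (rule gap_persist(3)[OF WA(1,3,2) yx xu])
  moreover have "f (insert u (insert y W)) = 0" "f (insert y W) = 0"
    by (rule z0; use xW xy(3) in \<open>auto simp: Le\<close>)+
  moreover have "f L = 1" using flace_gap(2)[OF L(1,2) xy] .
  ultimately show "f (insert u L) = 1" unfolding gap_def by (simp add: Le insert_commute)
  show "X \<subset> insert u L \<Longrightarrow> X \<noteq> L \<Longrightarrow> f X = 0" using z0 .
qed

text \<open>The two excluded values are those of thin and thick interlaces. Take \<open>M\<close>
  minimal with at least the thick value: contraction of any \<open>y\<close> in \<open>M\<close>
  makes \<open>M - {y}\<close> a lace, and \<open>flace_extend\<close> computes the values after
  adding \<open>p\<close>. The outcome is the configuration refuted by
  \<open>no_thick_extension\<close>.\<close>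

lemma clique_excess:
  assumes clique: "\<And>x y. x \<in> A \<Longrightarrow> y \<in> A \<Longrightarrow> x \<noteq> y \<Longrightarrow> f {x, y} = 1"
    and ne: "A \<noteq> {}" and neither: "f A \<noteq> card A - 1" "f A \<noteq> card A"
  obtains M p where "M \<subseteq> A" "p \<in> A - M" "card M \<ge> 4" "f M = card M"
    "\<And>X. X \<subset> M \<Longrightarrow> X \<noteq> {} \<Longrightarrow> f X = real (card X) - 1"
    "f (insert p M) = card M + 1"
    "\<And>m. m \<in> M \<Longrightarrow> f (insert p (M - {m})) = real (card M) - 1"
proof -
  have fin: "finite X" if "X \<subseteq> A" for X using that flace_finite by blast
  have ceq: "contr f y X = f (insert y X) - card X" if "y \<in> A" "X \<subseteq> A - {y}" for y X
  proof -
    have "(\<Sum>x\<in>X. f {y, x}) = (\<Sum>x\<in>X. 1)" by (rule sum.cong) (use clique that in auto)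
    then show ?thesis by (simp add: contr_def)
  qed
  \<comment> \<open>The excess of \<open>f X\<close> over the thin value is
    \<open>contr f y (X - {y})\<close>, which is nonnegative.\<close>
  have lower: "f X \<ge> real (card X) - 1" if X: "X \<subseteq> A" "X \<noteq> {}" for X
  proof -
    obtain y where y: "y \<in> X" using X by blast
    interpret C: excess "A - {y}" "contr f y" using excess_contr y X by blast
    have "contr f y (X - {y}) \<ge> 0" by (rule C.nonneg) (use X in auto)
    moreover have "card X = Suc (card (X - {y}))" using card_Suc_Diff1[OF fin[OF X(1)] y] by simp
    moreover have "y \<in> A" "X - {y} \<subseteq> A - {y}" "insert y (X - {y}) = X" using X y by auto
    ultimately show ?thesis using ceq[of y "X - {y}"] by simp
  qed
  have fA: "f A > real (card A) - 1"
    using lower[of A] ne neither(1) finA by (auto simp: of_nat_diff card_gt_0_iff Suc_leI)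
  obtain k where k: "f A = of_int k" using f_Ints[of A] by (auto elim: Ints_cases)
  have "k \<ge> int (card A)" using fA k by linarith
  then have "f A \<ge> real (card A)" using k by linarith
  then have "A \<in> {X. X \<subseteq> A \<and> X \<noteq> {} \<and> f X \<ge> real (card X)}" using ne by auto
  moreover have "finite {X. X \<subseteq> A \<and> X \<noteq> {} \<and> f X \<ge> real (card X)}" using finA by simp
  ultimately obtain M where M: "M \<in> {X. X \<subseteq> A \<and> X \<noteq> {} \<and> f X \<ge> real (card X)}"
    and Mmin: "\<And>X. X \<in> {X. X \<subseteq> A \<and> X \<noteq> {} \<and> f X \<ge> real (card X)} \<Longrightarrow> X \<subseteq> M \<Longrightarrow> X = M"
    using finite_has_minimal[of "{X. X \<subseteq> A \<and> X \<noteq> {} \<and> f X \<ge> real (card X)}"] by (metis (no_types, lifting) empty_iff)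
  have MA: "M \<subseteq> A" "M \<noteq> {}" "f M \<ge> real (card M)" using M by auto
  have thin: "f X = real (card X) - 1" if X: "X \<subset> M" "X \<noteq> {}" for X
  proof -
    have "X \<subseteq> A" using X MA by blast
    then have "f X < real (card X)" using Mmin[of X] X by force
    moreover obtain k where k: "f X = of_int k" using f_Ints[OF \<open>X \<subseteq> A\<close>] by (auto elim: Ints_cases)
    ultimately have "k = int (card X) - 1" using lower[OF \<open>X \<subseteq> A\<close> X(2)] by linarith
    then show ?thesis using k by simp
  qed
  have lace: "flace (contr f y) (M - {y})" "card (M - {y}) \<ge> 3" "f M = card M" if y: "y \<in> M" for y
  proof -
    have yA: "y \<in> A" using y MA by blast
    interpret C: excess "A - {y}" "contr f y" using excess_contr yA by blast
    have cM: "contr f y (M - {y}) = f M - card (M - {y})"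
      using ceq[OF yA, of "M - {y}"] MA y by (auto simp: insert_absorb)
    have c: "card M = Suc (card (M - {y}))" using card_Suc_Diff1[OF fin[OF MA(1)] y] by simp
    show l: "flace (contr f y) (M - {y})"
    proof (rule flaceI)
      show "contr f y (M - {y}) \<noteq> 0" using cM c MA(3) by simp
      fix X assume X: "X \<subset> M - {y}"
      have "insert y X \<subset> M" using X y by blast
      then have "f (insert y X) = real (card (insert y X)) - 1" by (rule thin) simp
      moreover have "card (insert y X) = Suc (card X)"
        using X MA by (intro card_insert_disjoint fin) auto
      moreover have "X \<subseteq> A - {y}" using X MA by blast
      ultimately show "contr f y X = 0" using ceq[OF yA] by simp
    qed
    have sub: "M - {y} \<subseteq> A - {y}" using MA by blast
    obtain a b where ab: "a \<in> M - {y}" "b \<in> M - {y}" "a \<noteq> b" using C.flace_two[OF sub l] .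
    have "contr f y (M - {y}) = 1" using C.flace_gap(2)[OF sub l ab] .
    then show "f M = card M" using cM c by simp
    \<comment> \<open>Triples are thin by \<open>gap_triple\<close>, so \<open>M\<close> has at
      least four elements and \<open>M - {y}\<close> is large enough for
      \<open>flace_extend\<close>.\<close>
    have "M - {y} \<noteq> {a, b}"
    proof
      assume eq: "M - {y} = {a, b}"
      have "a \<in> A" "b \<in> A" "a \<noteq> y" "b \<noteq> y" using ab MA by auto
      then have "gap f (insert y {}) a b = 0"
        using ab(3) yA clique gap_pair by (intro gap_triple) auto
      then have "f {a,b,y} = 2"
        using clique \<open>a \<in> A\<close> \<open>b \<in> A\<close> yA \<open>a \<noteq> y\<close> \<open>b \<noteq> y\<close> f_single by (simp add: gap_def)
      moreover have "M = {a,b,y}" using eq y by blast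
      ultimately show False using MA(3) ab(3) \<open>a \<noteq> y\<close> \<open>b \<noteq> y\<close> by simp
    qed
    then have "card (M - {y}) \<noteq> 2" using ab by (metis card_2_iff doubleton_eq_iff insertE singletonD)
    then show "card (M - {y}) \<ge> 3" using C.flace_card[OF sub l] by simp
  qed
  obtain y0 where y0: "y0 \<in> M" using MA by blast
  have "M \<noteq> A" using lace(3)[OF y0] neither by auto
  then obtain p where p: "p \<in> A" "p \<notin> M" using MA by blast
  show thesis
  proof (rule that[OF MA(1)])
    show "p \<in> A - M" using p by simp
    show "card M \<ge> 4" using lace(2)[OF y0] card_Suc_Diff1[OF fin[OF MA(1)] y0] by simp
    show "f M = card M" using lace(3)[OF y0] .
    show "f X = real (card X) - 1" if "X \<subset> M" "X \<noteq> {}" for X using thin that .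
    have ext: "f (insert p M) = card M + 1"
      "\<And>m. m \<in> M \<Longrightarrow> m \<noteq> y \<Longrightarrow> f (insert p (M - {m})) = real (card M) - 1" if y: "y \<in> M" for y
    proof -
      have yA: "y \<in> A" "p \<noteq> y" using y MA p by auto
      interpret C: excess "A - {y}" "contr f y" using excess_contr yA by blast
      have c: "card M = Suc (card (M - {y}))" using card_Suc_Diff1[OF fin[OF MA(1)] y] by simp
      have finM: "finite M" using fin MA by blast
      have sub: "M - {y} \<subseteq> A - {y}" "p \<in> A - {y}" "p \<notin> M - {y}" using MA p yA by auto
      note E = C.flace_extend[OF sub(1) lace(1)[OF y] lace(2)[OF y] sub(2,3)]
      have i: "insert y (insert p (M - {y})) = insert p M" using y by blast
      have "contr f y (insert p (M - {y})) = f (insert p M) - card (insert p (M - {y}))"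
        using ceq[OF yA(1), of "insert p (M - {y})"] sub unfolding i by blast
      moreover have "card (insert p (M - {y})) = card M" using c p finM by simp
      ultimately show "f (insert p M) = card M + 1" using E(2) by simp
      fix m assume m: "m \<in> M" "m \<noteq> y"
      have "contr f y (insert p (M - {y} - {m})) = 0"
        by (rule E(1)) (use m p in auto)
      moreover have i2: "insert y (insert p (M - {y} - {m})) = insert p (M - {m})" using y m by blast
      have "contr f y (insert p (M - {y} - {m})) = f (insert p (M - {m})) - card (insert p (M - {y} - {m}))"
        using ceq[OF yA(1), of "insert p (M - {y} - {m})"] sub unfolding i2 by blast
      moreover have "card (insert p (M - {y} - {m})) = card M - 1"
        using c p finM m card_Suc_Diff1[of "M - {y}" m] by simp
      ultimately show "f (insert p (M - {m})) = real (card M) - 1" using c by simp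
    qed
    show "f (insert p M) = card M + 1" using ext(1)[OF y0] .
    fix m assume m: "m \<in> M"
    have "M \<noteq> {m}" using lace(2)[OF m] by auto
    then obtain y where "y \<in> M" "m \<noteq> y" using m by blast
    then show "f (insert p (M - {m})) = real (card M) - 1" using ext(2) m by blast
  qed
qed

end

section \<open>Thick interlaces cannot be extended\<close>

lemma minor_Ints:
  assumes "length cs = length xs" "\<And>x c. x \<in> set xs \<Longrightarrow> c \<in> set cs \<Longrightarrow> r x c \<in> \<int>"
  shows "minor r xs cs \<in> \<int>"
  using assms
proof (induction xs arbitrary: cs)
  case (Cons x xs)
  have "minor r xs (take j cs @ drop (Suc j) cs) \<in> \<int>" if "j < Suc (length xs)" for j
    by (rule Cons.IH) (use Cons.prems that in \<open>auto dest: in_set_takeD in_set_dropD\<close>)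
  then show ?case using Cons.prems
    by (subst minor_Cons) (auto simp del: sum.lessThan_Suc intro!: Ints_sum Ints_mult Ints_power)
qed simp

text \<open>The cofactor matrix, with its rows named by the elements of \<open>xs\<close>. Its
  entries are minors with one row deleted, up to sign, and both products with the matrix are
  recorded: one yields relations within a column, the other orthogonality between rows.\<close>

lemma minor_adjugate:
  assumes d: "distinct xs" and len: "length cs = length xs"
  obtains w where
    "\<And>x j. x \<in> set xs \<Longrightarrow> j < length xs \<Longrightarrow> \<exists>xs' cs'. distinct xs' \<and> set xs' = set xs - {x} \<and>
       set cs' \<subseteq> set cs \<and> length cs' = length xs' \<and> \<bar>w x j\<bar> = \<bar>minor r xs' cs'\<bar>"
    "\<And>x y. x \<in> set xs \<Longrightarrow> y \<in> set xs \<Longrightarrow>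
       (\<Sum>j<length xs. r y (cs ! j) * w x j) = (if x = y then minor r xs cs else 0)"
    "\<And>j h. j < length xs \<Longrightarrow> h < length xs \<Longrightarrow>
       (\<Sum>x\<in>set xs. r x (cs ! j) * w x h) = (if j = h then minor r xs cs else 0)"
proof -
  let ?N = "length xs"
  define Q where "Q = mat ?N ?N (\<lambda>(i,j). r (xs ! i) (cs ! j))"
  have Q: "Q \<in> carrier_mat ?N ?N" by (simp add: Q_def)
  have det: "det Q = minor r xs cs" by (simp add: Q_def minor_def)
  \<comment> \<open>As the rows are distinct, exactly one index contributes; the sum translates an
    element into its position.\<close>
  define w where "w x j = (\<Sum>i<?N. if xs ! i = x then cofactor Q i j else 0)" for x j
  have w: "w (xs ! i) j = cofactor Q i j" if "i < ?N" for i j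
  proof -
    have "w (xs ! i) j = (\<Sum>i'<?N. if i' = i then cofactor Q i' j else 0)"
      unfolding w_def by (rule sum.cong) (use that d in \<open>auto simp: nth_eq_iff_index_eq\<close>)
    then show ?thesis using that by simp
  qed
  have adj: "adj_mat Q $$ (j,i) = cofactor Q i j" if "i < ?N" "j < ?N" for i j
    using that Q by (simp add: adj_mat_def)
  show thesis
  proof
    fix x j assume x: "x \<in> set xs" and j: "j < ?N"
    then obtain i where i: "i < ?N" "x = xs ! i" by (metis in_set_conv_nth)
    define xs' where "xs' = take i xs @ drop (Suc i) xs"
    define cs' where "cs' = take j cs @ drop (Suc j) cs"
    have xs: "xs = take i xs @ xs ! i # drop (Suc i) xs" using i(1) by (rule id_take_nth_drop)
    have xd: "distinct (take i xs @ xs ! i # drop (Suc i) xs)" using xs d by metis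
    have sx: "set xs = set (take i xs @ xs ! i # drop (Suc i) xs)" using xs by metis
    have "mat_delete Q i j = mat (length xs') (length xs') (\<lambda>(a,b). r (xs' ! a) (cs' ! b))"
      unfolding mat_delete_def Q_def xs'_def cs'_def
      by (rule eq_matI) (use i j len in \<open>auto simp: nth_append\<close>)
    then have "\<bar>w x j\<bar> = \<bar>minor r xs' cs'\<bar>"
      using w[OF i(1)] i by (simp add: cofactor_def minor_def abs_mult)
    moreover have "distinct xs'" using xd by (simp add: xs'_def)
    moreover have "set xs' = set xs - {x}" using xd sx i(2) by (auto simp: xs'_def)
    moreover have "set cs' \<subseteq> set cs" by (auto simp: cs'_def dest: in_set_takeD in_set_dropD)
    moreover have "length cs' = length xs'" using i j len by (simp add: xs'_def cs'_def)
    ultimately show "\<exists>xs' cs'. distinct xs' \<and> set xs' = set xs - {x} \<and>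
       set cs' \<subseteq> set cs \<and> length cs' = length xs' \<and> \<bar>w x j\<bar> = \<bar>minor r xs' cs'\<bar>" by blast
  next
    fix x y assume "x \<in> set xs" "y \<in> set xs"
    then obtain i k where i: "i < ?N" "x = xs ! i" and k: "k < ?N" "y = xs ! k" by (metis in_set_conv_nth)
    have "(Q * adj_mat Q) $$ (k,i) = (\<Sum>j\<in>{0..<?N}. Q $$ (k,j) * adj_mat Q $$ (j,i))"
      using i k adj_mat(1)[OF Q] Q by (simp add: scalar_prod_def)
    also have "\<dots> = (\<Sum>j<?N. r y (cs ! j) * w x j)"
      unfolding atLeast0LessThan by (rule sum.cong) (use i k adj w in \<open>auto simp: Q_def\<close>)
    finally show "(\<Sum>j<?N. r y (cs ! j) * w x j) = (if x = y then minor r xs cs else 0)"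
      using adj_mat(2)[OF Q] i k d by (simp add: det nth_eq_iff_index_eq split: if_splits)
  next
    fix j h assume jh: "j < ?N" "h < ?N"
    have "(adj_mat Q * Q) $$ (h,j) = (\<Sum>i\<in>{0..<?N}. adj_mat Q $$ (h,i) * Q $$ (i,j))"
      using jh adj_mat(1)[OF Q] Q by (simp add: scalar_prod_def)
    also have "\<dots> = (\<Sum>i<?N. r (xs ! i) (cs ! j) * w (xs ! i) h)"
      unfolding atLeast0LessThan by (rule sum.cong) (use jh adj w in \<open>auto simp: Q_def\<close>)
    also have "\<dots> = (\<Sum>x\<in>set xs. r x (cs ! j) * w x h)"
      by (rule sum.reindex_bij_betw[OF bij_betw_nth[OF d]]) auto
    finally show "(\<Sum>x\<in>set xs. r x (cs ! j) * w x h) = (if j = h then minor r xs cs else 0)"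
      using adj_mat(3)[OF Q] jh by (simp add: det split: if_splits)
  qed
qed

lemma sum_signs:
  fixes f :: "'b \<Rightarrow> real"
  assumes "finite S" "\<And>i. i \<in> S \<Longrightarrow> f i = 1 \<or> f i = -1"
  shows "\<exists>z::int. sum f S = real (card S) + 2 * of_int z"
  using assms
proof (induction S)
  case empty
  then show ?case by (auto intro!: exI[of _ 0])
next
  case (insert x S)
  then obtain z :: int where z: "sum f S = real (card S) + 2 * of_int z" by auto
  have "f x = 1 \<or> f x = -1" using insert by auto
  then show ?case
  proof
    assume "f x = 1"
    then show ?thesis using z insert by (intro exI[of _ z]) simp
  next
    assume "f x = -1"
    then show ?thesis using z insert by (intro exI[of _ "z - 1"]) simp
  qed
qed

lemma even_card_if_sum_signs:
  fixes f :: "'b \<Rightarrow> real"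
  assumes "finite S" "\<And>i. i \<in> S \<Longrightarrow> f i = 1 \<or> f i = -1" "sum f S = 2 * of_int z"
  shows "even (card S)"
proof -
  obtain z' :: int where "sum f S = real (card S) + 2 * of_int z'" using sum_signs[of S f] assms(1,2) by blast
  then have "of_int (int (card S)) = (of_int (2 * (z - z')) :: real)" using assms(3) by simp
  then have "int (card S) = 2 * (z - z')" by (simp only: of_int_eq_iff)
  then have "even (int (card S))" by simp
  then show ?thesis by simp
qed

text \<open>If a \<open>\<plusminus>1\<close>-combination of \<open>\<plusminus>1\<close> rows is constant modulo 4, then row operations pull a factor
  \<open>4\<close> out of one row and a factor \<open>2\<close> out of all others but one.\<close>

lemma minor_dvd_if_combination_const_mod_4:
  assumes d: "distinct (y # rest @ [t])" and len: "length cs = length (y # rest @ [t])"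
    and pm: "\<And>x c. x \<in> set (y # rest @ [t]) \<Longrightarrow> c \<in> set cs \<Longrightarrow> r x c = 1 \<or> r x c = -1"
    and b: "b t = 1 \<or> b t = -1"
    and comb: "\<And>c. c \<in> set cs \<Longrightarrow> (\<Sum>x\<in>set (y # rest @ [t]). b x * r x c) - a * r y c = 4 * of_int (z c)"
  shows "\<exists>m::int. minor r (y # rest @ [t]) cs = 4 * 2 ^ length rest * of_int m"
proof -
  \<comment> \<open>Chosen so that row \<open>t\<close> becomes \<open>b t\<close> times the given
    combination minus \<open>a\<close> times row \<open>y\<close>; the equation
    \<open>b t * b t = 1\<close> restores the coefficient 1 of row \<open>t\<close> itself.\<close>
  define co where "co s = (if s = y then a * b t - b t * b y else - b t * b s)" for s
  have bb: "b t * b t = 1" using b by auto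
  define r1 where "r1 x c = (if x = t then r t c - (\<Sum>i<length (y # rest). co ((y # rest) ! i) * r ((y # rest) ! i) c) else r x c)" for x c
  have r1t: "r1 t c = 4 * (b t * of_int (z c))" if c: "c \<in> set cs" for c
  proof -
    have "(\<Sum>i<length (y # rest). co ((y # rest) ! i) * r ((y # rest) ! i) c) = (\<Sum>s\<in>set (y # rest). co s * r s c)"
      using d by (intro sum.reindex_bij_betw[OF bij_betw_nth]) auto
    also have "\<dots> = co y * r y c + (\<Sum>s\<in>set rest. co s * r s c)" using d by simp
    also have "(\<Sum>s\<in>set rest. co s * r s c) = - b t * (\<Sum>s\<in>set rest. b s * r s c)"
      unfolding sum_distrib_left by (rule sum.cong) (use d in \<open>auto simp: co_def\<close>)
    finally have "r1 t c = r t c - (a * b t - b t * b y) * r y c + b t * (\<Sum>s\<in>set rest. b s * r s c)"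
      by (simp add: r1_def co_def)
    also have "\<dots> = b t * (b y * r y c + (\<Sum>s\<in>set rest. b s * r s c) + b t * r t c - a * r y c)"
      using bb by (simp add: algebra_simps)
    also have "b y * r y c + (\<Sum>s\<in>set rest. b s * r s c) + b t * r t c - a * r y c = 4 * of_int (z c)"
      using comb[OF c] d by (simp add: add_ac)
    finally show ?thesis by simp
  qed
  \<comment> \<open>Differences of two rows with entries 1 and -1 have only even entries.\<close>
  define r2 where "r2 x c = (if x \<in> set rest then r1 x c - r1 y c else r1 x c)" for x c
  define r3 where "r3 x c = (if x = t then b t * of_int (z c) else if x \<in> set rest then r2 x c / 2 else r x c)" for x c
  define e where "e x = (if x = t then 4 else if x \<in> set rest then 2 else (1::real))" for x
  have "minor r (y # rest @ [t]) cs = minor r1 ((y # rest) @ [t]) cs"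
  proof -
    have "minor r1 ((y # rest) @ [t]) cs = minor r ((y # rest) @ [t]) cs"
    proof (rule minor_row_op[where c = "\<lambda>_ i. co ((y # rest) ! i)"])
      show "r1 s j = r s j" if "s \<in> set (y # rest)" for s j
        using that d by (auto simp: r1_def)
    qed (use len in \<open>auto simp: r1_def\<close>)
    then show ?thesis by simp
  qed
  also have "\<dots> = minor r2 ([y] @ (rest @ [t])) cs"
  proof -
    have "minor r2 ([y] @ (rest @ [t])) cs = minor r1 ([y] @ (rest @ [t])) cs"
      by (rule minor_row_op[where c = "\<lambda>x i. if x = t then 0 else 1"])
        (use len d in \<open>auto simp: r2_def\<close>)
    then show ?thesis by simp
  qed
  also have "\<dots> = minor (\<lambda>x j. e x * r3 x j) (y # rest @ [t]) cs"
  proof (rule minor_cong)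
    fix i j assume "i < length ([y] @ rest @ [t])" "j < length ([y] @ rest @ [t])"
    then have "(y # rest @ [t]) ! i \<in> set (y # rest @ [t])" "cs ! j \<in> set cs"
      using len by (metis append_Cons append_Nil nth_mem) (use len \<open>j < _\<close> in auto)
    then show "r2 (([y] @ rest @ [t]) ! i) (cs ! j) = e ((y # rest @ [t]) ! i) * r3 ((y # rest @ [t]) ! i) (cs ! j)"
      using d r1t by (auto simp: r2_def e_def r3_def) (auto simp: r1_def)
  qed simp
  also have "\<dots> = (\<Prod>x\<leftarrow>y # rest @ [t]. e x) * minor r3 (y # rest @ [t]) cs"
    by (rule minor_scale[OF len])
  also have "(\<Prod>x\<leftarrow>y # rest @ [t]. e x) = 4 * 2 ^ length rest"
  proof -
    have "map e rest = map (\<lambda>_. 2) rest" using d by (auto simp: e_def)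
    then show ?thesis using d by (simp add: map_replicate_const prod_list_replicate) (simp add: e_def)
  qed
  finally have eq: "minor r (y # rest @ [t]) cs = 4 * 2 ^ length rest * minor r3 (y # rest @ [t]) cs" .
  have "minor r3 (y # rest @ [t]) cs \<in> \<int>"
  proof (rule minor_Ints[OF len])
    fix x c assume xc: "x \<in> set (y # rest @ [t])" "c \<in> set cs"
    show "r3 x c \<in> \<int>"
    proof (cases "x \<in> set rest")
      case True
      then have "x \<noteq> t" "y \<noteq> t" using d by auto
      then have "r3 x c = (r x c - r y c) / 2" using True by (simp add: r3_def r2_def r1_def)
      then show ?thesis using pm[OF xc] pm[of y c] xc(2) by auto
    next
      case False
      have "r3 x c = b t * of_int (z c) \<or> r3 x c = r x c" using False by (auto simp: r3_def)
      then show ?thesis using b pm[OF xc] by auto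
    qed
  qed
  then show ?thesis using eq by (auto elim: Ints_cases)
qed

text \<open>With \<open>card T = length rest + 2\<close>, the divisor
  \<open>4 * 2 ^ length rest\<close> equals \<open>2 ^ card T\<close>, twice the determinant of a
  thin set.\<close>

lemma thin_combination_not_const_mod_4:
  assumes E: "eqmod n r T (2 ^ (card T - 1))" and nz: "distinct ts" "set ts = T" "length bs = length ts"
      "set bs \<subseteq> {..<n}" "minor r ts bs \<noteq> 0"
    and pm: "\<And>x c. x \<in> T \<Longrightarrow> c \<in> set bs \<Longrightarrow> r x c = 1 \<or> r x c = -1"
    and b: "\<And>x. x \<in> T \<Longrightarrow> b x = 1 \<or> b x = -1" and T: "card T \<ge> 2"
    and comb: "\<And>y c. y \<in> T \<Longrightarrow> c \<in> set bs \<Longrightarrow> \<exists>z::int. (\<Sum>x\<in>T. b x * r x c) - a * r y c = 4 * of_int z"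
  shows False
proof -
  have "length ts = card T" using nz distinct_card by metis
  with T obtain y ts' where ts': "ts = y # ts'" "ts' \<noteq> []" by (cases ts; cases "tl ts") auto
  define rest t where "rest = butlast ts'" and "t = last ts'"
  have ts: "ts = y # rest @ [t]" using ts' by (simp add: rest_def t_def)
  have inT: "y \<in> T" "t \<in> T" using nz ts by auto
  obtain z :: "nat \<Rightarrow> int" where z: "\<And>c. c \<in> set bs \<Longrightarrow> (\<Sum>x\<in>T. b x * r x c) - a * r y c = 4 * of_int (z c)"
    using comb[OF inT(1)] by metis
  obtain m :: int where m: "minor r (y # rest @ [t]) bs = 4 * 2 ^ length rest * of_int m"
    using minor_dvd_if_combination_const_mod_4[of y rest t bs r b a z] nz pm b[OF inT(2)] z
    unfolding ts by blast
  have "card T - 1 = Suc (length rest)" using \<open>length ts = card T\<close> ts by simp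
  then have "\<bar>minor r ts bs\<bar> = 2 * 2 ^ length rest"
    using eqmod_minor[OF E nz(1,2,4,3)] nz(5) by simp
  moreover define v where "v = real_of_int \<bar>m\<bar>"
  moreover have "\<bar>minor r ts bs\<bar> = 4 * 2 ^ length rest * v"
    unfolding ts m v_def by (simp add: abs_mult)
  ultimately have "4 * 2 ^ length rest * v = 2 * 2 ^ length rest" by metis
  then have "2 * v = 1" by simp
  then have "of_int (2 * \<bar>m\<bar>) = (of_int 1 :: real)"
    unfolding v_def by (simp only: of_int_mult of_int_numeral of_int_1)
  then have "2 * \<bar>m\<bar> = 1" by (simp only: of_int_eq_iff)
  then show False by presburger
qed

lemma minor_nonzero_subset:
  assumes "distinct xs" "length cs = length xs" "minor r xs cs \<noteq> 0" "T \<subseteq> set xs"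
  obtains ts bs where "distinct ts" "set ts = T" "length bs = length ts" "set bs \<subseteq> set cs" "minor r ts bs \<noteq> 0"
proof -
  define ts us where "ts = filter (\<lambda>x. x \<in> T) xs" and "us = filter (\<lambda>x. x \<notin> T) xs"
  have d: "distinct ts" "set ts = T" using assms by (auto simp: ts_def)
  have m: "mset xs = mset (us @ ts)" by (simp add: ts_def us_def)
  then have "minor r (us @ ts) cs \<noteq> 0" using minor_perm_rows[OF m, of r cs] assms(3) by auto
  moreover have "length cs = length us + length ts" using assms(2) mset_eq_length[OF m] by simp
  ultimately obtain bs ds where b: "mset cs = mset (bs @ ds)" "length bs = length ts" "minor r ts bs \<noteq> 0"
    using minor_sub_nonzero by blast
  have "set bs \<subseteq> set cs" using b(1) by (metis Un_upper1 mset_eq_setD set_append)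
  then show thesis using that d b by blast
qed

text \<open>Take a nonzero minor of \<open>insert p M\<close>. Deleting \<open>p\<close> leaves
  \<open>M\<close> and deleting \<open>m\<close> leaves \<open>insert p (M - {m})\<close>, so all
  cofactors are known up to sign and vanishing, and the adjugate relations become equations between
  small integers. Modulo 4 they show that no cofactor of a row in \<open>M\<close> vanishes; modulo
  2 they then make both \<open>card M\<close> and \<open>card M + 1\<close> even.\<close>

lemma no_thick_extension:
  assumes ms: "finite M" "p \<notin> M" "card M \<ge> 2"
    and unit: "\<And>x. x \<in> insert p M \<Longrightarrow> eqmod n r {x} 1"
    and same: "\<And>x y. x \<in> insert p M \<Longrightarrow> y \<in> insert p M \<Longrightarrow> same_supp n r x y"
    and EM: "eqmod n r M (2 ^ card M)"
    and thin: "\<And>X. X \<subset> M \<Longrightarrow> X \<noteq> {} \<Longrightarrow> eqmod n r X (2 ^ (card X - 1))"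
    and EpM: "eqmod n r (insert p M) (2 ^ (card M + 1))"
    and Epm: "\<And>m. m \<in> M \<Longrightarrow> eqmod n r (insert p (M - {m})) (2 ^ (card M - 1))"
  shows False
proof -
  define k where "k = card M"
  have k2: "k \<ge> 2" using ms k_def by simp
  obtain ms where ms': "distinct ms" "set ms = M" using finite_distinct_list[OF ms(1)] by blast
  define xs where "xs = p # ms"
  have xs: "distinct xs" "set xs = insert p M" using ms' ms(2) by (auto simp: xs_def)
  have N: "length xs = Suc k" using ms' distinct_card[of ms] by (simp add: xs_def k_def)
  obtain cs where cs: "set cs \<subseteq> {..<n}" "length cs = length xs" "\<bar>minor r xs cs\<bar> = 2 ^ (card M + 1)"
    using eqmod_nonzero[OF EpM xs] .
  have nz: "minor r xs cs \<noteq> 0" using cs(3) by auto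
  have dc: "distinct cs" using minor_nonzero_distinct_cols[OF cs(2) nz] .
  \<comment> \<open>By the common support, a zero entry would come with a zero column.\<close>
  have pm: "r x c = 1 \<or> r x c = -1" if x: "x \<in> insert p M" and c: "c \<in> set cs" for x c
  proof -
    have cn: "c < n" using c cs(1) by auto
    have "r x c \<noteq> 0"
    proof
      assume "r x c = 0"
      then have 0: "r y c = 0" if "y \<in> insert p M" for y using same[OF that x] cn by (simp add: same_supp_def)
      have "set cs \<noteq> {c}" using dc cs(2) N k2 distinct_card[OF dc] by auto
      then obtain c' where "c' \<in> set cs" "c \<noteq> c'" using c by blast
      then have "minor r xs cs = 0"
        by (intro minor_parallel_cols[of cs xs c c' r 0]) (use cs c xs 0 in auto)
      then show False using nz by simp
    qed
    then show ?thesis using eqmod_unit_entries(1)[OF unit[OF x] cn] by simp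
  qed
  have pmj: "r x (cs ! j) = 1 \<or> r x (cs ! j) = -1" if "x \<in> insert p M" "j < Suc k" for x j
    using pm[OF that(1)] that(2) cs(2) N by simp
  obtain w where w:
    "\<And>x j. x \<in> set xs \<Longrightarrow> j < length xs \<Longrightarrow> \<exists>xs' cs'. distinct xs' \<and> set xs' = set xs - {x} \<and>
       set cs' \<subseteq> set cs \<and> length cs' = length xs' \<and> \<bar>w x j\<bar> = \<bar>minor r xs' cs'\<bar>"
    "\<And>x y. x \<in> set xs \<Longrightarrow> y \<in> set xs \<Longrightarrow>
       (\<Sum>j<length xs. r y (cs ! j) * w x j) = (if x = y then minor r xs cs else 0)"
    "\<And>j h. j < length xs \<Longrightarrow> h < length xs \<Longrightarrow>
       (\<Sum>x\<in>set xs. r x (cs ! j) * w x h) = (if j = h then minor r xs cs else 0)"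
    using minor_adjugate[OF xs(1) cs(2)] by blast
  define P :: real where "P = 2 ^ (k - 1)"
  have P: "P > 0" "2 ^ k = 2 * P" using k2 by (auto simp: P_def power_Suc[symmetric])
  have wval: "\<bar>w x j\<bar> = 0 \<or> \<bar>w x j\<bar> = d" if "x \<in> insert p M" "j < Suc k" "eqmod n r (insert p M - {x}) d" for x j d
  proof -
    have "x \<in> set xs" "j < length xs" using that xs N by auto
    from w(1)[OF this] obtain xs' cs' where *: "distinct xs'" "set xs' = set xs - {x}" "set cs' \<subseteq> set cs"
      "length cs' = length xs'" "\<bar>w x j\<bar> = \<bar>minor r xs' cs'\<bar>" by blast
    have "\<bar>minor r xs' cs'\<bar> = 0 \<or> \<bar>minor r xs' cs'\<bar> = d"
      by (rule eqmod_minor[OF that(3) *(1) _ _ *(4)]) (use * xs cs(1) in auto)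
    then show ?thesis using * by simp
  qed
  have "insert p M - {p} = M" using ms(2) by blast
  then have wp: "\<bar>w p j\<bar> = 0 \<or> \<bar>w p j\<bar> = 2 * P" if "j < Suc k" for j
    using wval[OF _ that, of p] EM P by (simp add: k_def[symmetric])
  have wm: "\<bar>w m j\<bar> = 0 \<or> \<bar>w m j\<bar> = P" if "m \<in> M" "j < Suc k" for m j
  proof -
    have "insert p M - {m} = insert p (M - {m})" using that ms(2) by blast
    then show ?thesis using wval[of m j P] Epm[OF that(1)] that by (simp add: k_def[symmetric] P_def)
  qed
  \<comment> \<open>The divisors bring the nonzero cofactors to absolute value 1:
    \<open>2 * P\<close> is the determinant of \<open>M\<close>, and \<open>P\<close> that of
    \<open>insert p (M - {m})\<close>.\<close>
  define \<alpha> where "\<alpha> j = w p j / (2 * P)" for j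
  define b where "b m j = w m j / P" for m j
  have \<alpha>: "\<alpha> j = 0 \<or> \<alpha> j = 1 \<or> \<alpha> j = -1" if "j < Suc k" for j
    using wp[OF that] P by (auto simp: \<alpha>_def abs_if field_simps split: if_splits)
  have b: "b m j = 0 \<or> b m j = 1 \<or> b m j = -1" if "m \<in> M" "j < Suc k" for m j
    using wm[OF that] P by (auto simp: b_def abs_if field_simps split: if_splits)
  define D where "D = minor r xs cs / P"
  have D: "D = 4 \<or> D = -4" using cs(3) P by (auto simp: D_def k_def[symmetric] abs_if field_simps split: if_splits)
  have row: "(\<Sum>m\<in>M. b m h * r m (cs ! j)) = (if j = h then D else 0) - 2 * \<alpha> h * r p (cs ! j)"
    if "j < Suc k" "h < Suc k" for j h
  proof -
    have "(\<Sum>x\<in>set xs. r x (cs ! j) * w x h) = r p (cs ! j) * w p h + (\<Sum>m\<in>M. r m (cs ! j) * w m h)"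
      using xs ms by simp
    then have "r p (cs ! j) * w p h + (\<Sum>m\<in>M. r m (cs ! j) * w m h) = (if j = h then minor r xs cs else 0)"
      using w(3)[of j h] that N by simp
    moreover have "(\<Sum>m\<in>M. r m (cs ! j) * w m h) = P * (\<Sum>m\<in>M. b m h * r m (cs ! j))"
      using P by (simp add: b_def sum_distrib_left mult_ac)
    moreover have "w p h = P * (2 * \<alpha> h)" "minor r xs cs = P * D" using P by (simp_all add: \<alpha>_def D_def)
    ultimately have "P * (\<Sum>m\<in>M. b m h * r m (cs ! j)) = P * ((if j = h then D else 0) - 2 * \<alpha> h * r p (cs ! j))"
      by (auto simp: algebra_simps)
    then show ?thesis using P by simp
  qed
  have col: "(\<Sum>j<Suc k. r p (cs ! j) * b m j) = 0" if m: "m \<in> M" for m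
  proof -
    have "(\<Sum>j<Suc k. r p (cs ! j) * w m j) = 0"
      using w(2)[of m p] xs N m ms(2) by auto
    moreover have "(\<Sum>j<Suc k. r p (cs ! j) * b m j) = (\<Sum>j<Suc k. r p (cs ! j) * w m j) / P"
      by (simp add: b_def sum_divide_distrib del: sum.lessThan_Suc)
    ultimately show ?thesis by simp
  qed
  define T where "T h = {m \<in> M. b m h \<noteq> 0}" for h
  have Tsum: "(\<Sum>m\<in>M. b m h * r m c) = (\<Sum>m\<in>T h. b m h * r m c)" for h c
    by (rule sum.mono_neutral_right) (use ms in \<open>auto simp: T_def\<close>)
  have bT: "b m h = 1 \<or> b m h = -1" if "m \<in> T h" "h < Suc k" for m h
    using b[of m h] that by (auto simp: T_def)
  have finT: "finite (T h)" for h using ms by (simp add: T_def)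
  \<comment> \<open>The relation at column 0 equates a sum of \<open>card (T h)\<close> signs with
    an even number, since \<open>D\<close> is 4 or -4 and the term of \<open>p\<close> has the
    factor 2.\<close>
  have evenT: "even (card (T h))" if h: "h < Suc k" for h
  proof -
    have "\<alpha> h * r p (cs ! 0) \<in> \<int>" using \<alpha>[OF h] pmj[of p 0] by auto
    then obtain z1 :: int where z1: "\<alpha> h * r p (cs ! 0) = of_int z1" by (auto elim: Ints_cases)
    obtain z2 :: int where z2: "(if 0 = h then D else 0) = 2 * of_int z2"
    proof
      show "(if 0 = h then D else 0) = 2 * of_int (if 0 = h then (if D = 4 then 2 else -2) else 0)" using D by auto
    qed
    have "(\<Sum>m\<in>T h. b m h * r m (cs ! 0)) = 2 * of_int (z2 - z1)"
      using row[of 0 h] h z1 z2 by (simp add: Tsum[symmetric] algebra_simps)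
    moreover have "b m h * r m (cs ! 0) = 1 \<or> b m h * r m (cs ! 0) = -1" if m: "m \<in> T h" for m
      using bT[OF m h] pmj[of m 0] m by (auto simp: T_def)
    ultimately show ?thesis using even_card_if_sum_signs[OF finT, of h "\<lambda>m. b m h * r m (cs ! 0)"] by blast
  qed
  have full: "T h = M" if h: "h < Suc k" for h
  proof (rule ccontr)
    assume "T h \<noteq> M"
    then have sub: "T h \<subset> M" by (auto simp: T_def)
    have ne: "T h \<noteq> {}"
    proof
      assume e: "T h = {}"
      then have 0: "(if j = h then D else 0) = 2 * \<alpha> h * r p (cs ! j)" if "j < Suc k" for j
        using row[OF that h] by (simp add: Tsum)
      obtain j where j: "j < Suc k" "j \<noteq> h"
        using that[of 0] that[of 1] k2 by (cases "h = 0") auto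
      have "\<alpha> h = 0" using 0[OF j(1)] j(2) pmj[of p j] j(1) by auto
      then show False using 0[OF h] D by simp
    qed
    have "T h \<subseteq> set xs" using sub xs by auto
    then obtain ts bs where ts: "distinct ts" "set ts = T h" "length bs = length ts" "set bs \<subseteq> set cs" "minor r ts bs \<noteq> 0"
      using minor_nonzero_subset[OF xs(1) cs(2) nz] by blast
    \<comment> \<open>As \<open>r p c + r y c\<close> is even,
      \<open>- 2 * \<alpha> h * r p c\<close> and \<open>2 * \<alpha> h * r y c\<close> agree modulo
      4. So the row of \<open>p\<close> may be replaced by a row of \<open>T h\<close>, and
      \<open>D\<close> is divisible by 4.\<close>
    show False
    proof (rule thin_combination_not_const_mod_4[OF thin[OF sub ne] ts(1-3) _ ts(5), where b = "\<lambda>m. b m h" and a = "2 * \<alpha> h"])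
      show "set bs \<subseteq> {..<n}" using ts cs by blast
      show "r x c = 1 \<or> r x c = -1" if "x \<in> T h" "c \<in> set bs" for x c
        using pm[of x c] that sub ts(4) by blast
      show "b x h = 1 \<or> b x h = -1" if "x \<in> T h" for x using bT[OF that h] .
      have "card (T h) \<noteq> 0" using ne finT by simp
      then show "2 \<le> card (T h)" using evenT[OF h] by (cases "card (T h) = 1") auto
      fix y c assume y: "y \<in> T h" and c: "c \<in> set bs"
      then obtain j where j: "j < Suc k" "c = cs ! j" using ts(4) cs(2) N by (metis in_set_conv_nth subsetD)
      have "(\<Sum>x\<in>T h. b x h * r x c) - 2 * \<alpha> h * r y c
          = (if j = h then D else 0) - 2 * (\<alpha> h * (r p c + r y c))"
        using row[OF j(1) h] j(2) by (simp add: Tsum algebra_simps)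
      moreover obtain z1 :: int where "(if j = h then D else 0) = 4 * of_int z1"
      proof
        show "(if j = h then D else 0) = 4 * of_int (if j = h then (if D = 4 then 1 else -1) else 0)" using D by auto
      qed
      moreover obtain z2 :: int where "\<alpha> h = of_int z2"
      proof
        show "\<alpha> h = of_int (if \<alpha> h = 0 then 0 else if \<alpha> h = 1 then 1 else -1)" using \<alpha>[OF h] by auto
      qed
      moreover obtain z3 :: int where "r p c + r y c = 2 * of_int z3"
      proof
        have "c \<in> set cs" "y \<in> insert p M" using y sub c ts(4) by auto
        then show "r p c + r y c = 2 * of_int (if r p c = r y c then if r p c = 1 then 1 else -1 else 0)"
          using pm[of p c] pm[of y c] by auto
      qed
      ultimately have "(\<Sum>x\<in>T h. b x h * r x c) - 2 * \<alpha> h * r y c = 4 * of_int (z1 - z2 * z3)" by simp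
      then show "\<exists>z::int. (\<Sum>x\<in>T h. b x h * r x c) - 2 * \<alpha> h * r y c = 4 * of_int z" by blast
    qed
  qed
  have "even k" using evenT[of 0] full[of 0] by (simp add: k_def)
  \<comment> \<open>Row \<open>p\<close> is orthogonal to the cofactors of \<open>m\<close>, and all
    \<open>k + 1\<close> terms of this product are signs because each \<open>T j\<close> is
    \<open>M\<close>.\<close>
  moreover have "even (Suc k)"
  proof -
    obtain m where m: "m \<in> M" using ms k2 k_def by fastforce
    have "even (card {..<Suc k})"
    proof (rule even_card_if_sum_signs[of _ "\<lambda>j. r p (cs ! j) * b m j" 0])
      fix j assume "j \<in> {..<Suc k}"
      then have j: "j < Suc k" by simp
      then have "m \<in> T j" using full m by simp
      then show "r p (cs ! j) * b m j = 1 \<or> r p (cs ! j) * b m j = -1"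
        using bT[of m j] pmj[of p j] j by auto
    qed (use col[OF m] in auto)
    then show ?thesis by simp
  qed
  ultimately show False by simp
qed

section \<open>The defect of a totally equimodular system\<close>

locale te_rows =
  fixes n :: nat and r :: "'a \<Rightarrow> nat \<Rightarrow> real" and A :: "'a set" and d :: "'a set \<Rightarrow> real"
  assumes finite_A: "finite A" and eqm: "X \<subseteq> A \<Longrightarrow> eqmod n r X (d X)"
    and unit_rows: "x \<in> A \<Longrightarrow> eqmod n r {x} 1"
begin

lemma d_pos: "X \<subseteq> A \<Longrightarrow> d X > 0"
  using eqmod_pos[OF eqm] .

lemma d_empty: "d {} = 1"
  using eqmod_unique[OF eqm eqmod_empty] by simp

lemma d_single: "x \<in> A \<Longrightarrow> d {x} = 1"
  using eqmod_unique[OF eqm unit_rows] by simp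

definition lg :: "'a set \<Rightarrow> real" where "lg X = log 2 (d X)"

lemma d_lg: "X \<subseteq> A \<Longrightarrow> d X = 2 powr lg X"
  using d_pos by (simp add: lg_def)

text \<open>The determinant of \<open>X\<close> after contraction of \<open>Y\<close> and scaling of
  every remaining singleton to determinant 1.\<close>

definition rel :: "'a set \<Rightarrow> 'a set \<Rightarrow> real" where
  "rel Y X = (\<Prod>x\<in>X. d Y / d (insert x Y)) * (d (Y \<union> X) / d Y)"

lemma contract:
  assumes "Y \<subseteq> A"
  obtains \<psi> where "\<And>X. X \<subseteq> A - Y \<Longrightarrow> eqmod n \<psi> X (rel Y X)"
proof -
  obtain ys where ys: "distinct ys" "set ys = Y"
    using finite_distinct_list finite_subset[OF assms finite_A] by metis
  obtain bs where bs: "set bs \<subseteq> {..<n}" "length bs = length ys" "\<bar>minor r ys bs\<bar> = d Y"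
    using eqmod_nonzero[OF eqm[OF assms] ys] .
  have nz: "minor r ys bs \<noteq> 0" using bs(3) d_pos[OF assms] by auto
  show thesis
  proof (rule eqmod_contract_normalized[OF ys(1) bs(2,1) nz, of d "A - Y", unfolded ys(2)])
    show "eqmod n r Y (d Y)" using eqm assms .
    show "eqmod n r (insert x Y) (d (insert x Y))" if "x \<in> A - Y" for x using that assms by (intro eqm) auto
    fix \<psi> assume "\<And>X. X \<subseteq> A - Y \<Longrightarrow> eqmod n r (Y \<union> X) (d (Y \<union> X)) \<Longrightarrow>
       eqmod n \<psi> X ((\<Prod>x\<in>X. d Y / d (insert x Y)) * (d (Y \<union> X) / d Y))"
    then have "eqmod n \<psi> X (rel Y X)" if "X \<subseteq> A - Y" for X
      unfolding rel_def using that assms eqm[of "Y \<union> X"] by blast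
    then show thesis using that by blast
  qed auto
qed

lemma rel_single: "Y \<subseteq> A \<Longrightarrow> x \<in> A - Y \<Longrightarrow> rel Y {x} = 1"
  using d_pos[of Y] d_pos[of "insert x Y"] by (simp add: rel_def)

lemma rel_pair:
  assumes "Y \<subseteq> A" "{x,y} \<subseteq> A - Y" "x \<noteq> y"
  shows "rel Y {x,y} = 2 powr gap lg Y x y"
proof -
  have p: "d (insert x (insert y Y)) > 0" "d (insert x Y) > 0" "d (insert y Y) > 0" "d Y > 0"
    using assms by (auto intro!: d_pos)
  have "rel Y {x,y} = d (insert x (insert y Y)) * d Y / (d (insert x Y) * d (insert y Y))"
    using assms p by (simp add: rel_def insert_commute)
  moreover have "2 powr gap lg Y x y = 2 powr lg (insert x (insert y Y)) * 2 powr lg Y / (2 powr lg (insert x Y) * 2 powr lg (insert y Y))"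
    by (simp add: gap_def powr_add powr_diff)
  ultimately show ?thesis using p by (simp add: lg_def)
qed

text \<open>The exponent is written with a gap at \<open>insert z Y\<close> because the axioms on
  triples in \<open>excess\<close> speak of that gap.\<close>

lemma rel_triple:
  assumes "Y \<subseteq> A" "{x,y,z} \<subseteq> A - Y" "distinct [x,y,z]"
  shows "rel Y {x,y,z} = 2 powr (gap lg (insert z Y) x y + gap lg Y x z + gap lg Y y z)"
proof -
  have p: "d (insert x (insert y (insert z Y))) > 0" "d (insert x Y) > 0" "d (insert y Y) > 0" "d (insert z Y) > 0" "d Y > 0"
    using assms by (auto intro!: d_pos)
  have "rel Y {x,y,z} = d (insert x (insert y (insert z Y))) * d Y * d Y / (d (insert x Y) * d (insert y Y) * d (insert z Y))"
    using assms p by (simp add: rel_def insert_commute mult_ac)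
  moreover have "gap lg (insert z Y) x y + gap lg Y x z + gap lg Y y z
     = lg (insert x (insert y (insert z Y))) + lg Y + lg Y - (lg (insert x Y) + lg (insert y Y) + lg (insert z Y))"
    by (simp add: gap_def)
  then have "2 powr (gap lg (insert z Y) x y + gap lg Y x z + gap lg Y y z)
     = 2 powr lg (insert x (insert y (insert z Y))) * 2 powr lg Y * 2 powr lg Y /
       (2 powr lg (insert x Y) * 2 powr lg (insert y Y) * 2 powr lg (insert z Y))"
    by (simp only: powr_add powr_diff)
  ultimately show ?thesis using p by (simp add: lg_def)
qed

text \<open>Each axiom about gaps involves at most four elements outside of \<open>Y\<close>. After
  contraction of \<open>Y\<close> it is a statement on as many rows with entries 0, 1, -1.\<close>

sublocale excess A lg
proof
  show "finite A" by (rule finite_A)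
  show "lg {} = 0" by (simp add: lg_def d_empty)
  show "lg {x} = 0" if "x \<in> A" for x using that by (simp add: lg_def d_single)
next
  fix Y x y assume a: "Y \<subseteq> A" "distinct [x,y]" "{x,y} \<subseteq> A - Y"
  obtain \<psi> where \<psi>: "\<And>X. X \<subseteq> A - Y \<Longrightarrow> eqmod n \<psi> X (rel Y X)" using contract[OF a(1)] by blast
  have u: "eqmod n \<psi> {x} 1" "eqmod n \<psi> {y} 1"
    using \<psi>[of "{x}"] \<psi>[of "{y}"] rel_single[OF a(1)] a(3) by auto
  have "2 powr gap lg Y x y = 1 \<or> 2 powr gap lg Y x y = 2"
    using eqmod_pair(1)[OF u \<psi>[OF a(3)]] rel_pair[OF a(1,3)] a(2) by auto
  then show "gap lg Y x y = 0 \<or> gap lg Y x y = 1"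
    using powr_inj[of 2 "gap lg Y x y" 1] by auto
next
  fix Y x y z assume a: "Y \<subseteq> A" "distinct [x,y,z]" "{x,y,z} \<subseteq> A - Y"
    and g: "gap lg Y x y = 1" "gap lg Y y z = 1"
  obtain \<psi> where \<psi>: "\<And>X. X \<subseteq> A - Y \<Longrightarrow> eqmod n \<psi> X (rel Y X)" using contract[OF a(1)] by blast
  have u: "eqmod n \<psi> {x} 1" "eqmod n \<psi> {y} 1" "eqmod n \<psi> {z} 1"
    using \<psi>[of "{x}"] \<psi>[of "{y}"] \<psi>[of "{z}"] rel_single[OF a(1)] a(3) by auto
  have e: "eqmod n \<psi> {x,y} 2" "eqmod n \<psi> {y,z} 2" "eqmod n \<psi> {x,z} (2 powr gap lg Y x z)"
    using \<psi>[of "{x,y}"] \<psi>[of "{y,z}"] \<psi>[of "{x,z}"] rel_pair[OF a(1)] a(2,3) g by auto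
  have s: "same_supp n \<psi> x y" "same_supp n \<psi> y z"
    using eqmod_pair(2)[OF u(1,2) e(1)] eqmod_pair(2)[OF u(2,3) e(2)] a(2) by auto
  then have "2 powr gap lg Y x z = 2"
    using eqmod_pair(2)[OF u(1,3) e(3)] a(2) same_supp_trans[OF s] by auto
  then show xz: "gap lg Y x z = 1" using powr_inj[of 2 "gap lg Y x z" 1] by auto
  have "eqmod n \<psi> {x,y,z} (2 powr (gap lg (insert z Y) x y + gap lg Y x z + gap lg Y y z))"
    using \<psi>[OF a(3)] rel_triple[OF a(1,3,2)] by simp
  then have "2 powr (gap lg (insert z Y) x y + gap lg Y x z + gap lg Y y z) = 4"
    using eqmod_triple_same_supp[OF u _ a(2) s] by blast
  \<comment> \<open>The gaps of \<open>x\<close>, \<open>z\<close> and of \<open>y\<close>,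
    \<open>z\<close> at \<open>Y\<close> already account for the factor 4.\<close>
  then have "2 powr (gap lg (insert z Y) x y + 2) = 2 powr 2" using xz g by (simp add: add_ac)
  then show "gap lg (insert z Y) x y = 0" using powr_inj[of 2 "gap lg (insert z Y) x y + 2" 2] by simp
next
  fix Y x y z w assume a: "Y \<subseteq> A" "distinct [x,y,z,w]" "{x,y,z,w} \<subseteq> A - Y"
    and g: "gap lg Y x z = 0" "gap lg Y x w = 0" "gap lg Y z w = 0" "gap lg Y y z = 0" "gap lg Y y w = 0"
      "gap lg (insert w Y) x z = 1" "gap lg (insert w Y) y z = 1"
  obtain \<psi> where \<psi>: "\<And>X. X \<subseteq> A - Y \<Longrightarrow> eqmod n \<psi> X (rel Y X)" using contract[OF a(1)] by blast
  have u: "eqmod n \<psi> {v} 1" if "v \<in> {x,y,z,w}" for v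
    using \<psi>[of "{v}"] rel_single[OF a(1)] a(3) that by auto
  have p: "eqmod n \<psi> {u,v} (2 powr gap lg Y u v)" if "u \<in> {x,y,z,w}" "v \<in> {x,y,z,w}" "u \<noteq> v" for u v
  proof -
    have "{u,v} \<subseteq> A - Y" using that(1,2) a(3) by blast
    then show ?thesis using \<psi>[of "{u,v}"] rel_pair[OF a(1) _ that(3)] by simp
  qed
  have t: "eqmod n \<psi> {x,z,w} 2" "eqmod n \<psi> {y,z,w} 2"
    using \<psi>[of "{x,z,w}"] \<psi>[of "{y,z,w}"] rel_triple[OF a(1), of x z w] rel_triple[OF a(1), of y z w] a(2,3) g
    by auto
  show False
    by (rule eqmod_no_two_even_triples[OF u u u u _ _ _ _ _ _ t a(2)])
      (use p[of x z] p[of x w] p[of z w] p[of y z] p[of y w] p[of x y] a(2) g in simp_all)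
qed

lemma eqm_pow: "X \<subseteq> A \<Longrightarrow> lg X = real k \<Longrightarrow> eqmod n r X (2 ^ k)"
  using eqm[of X] d_lg[of X] by (simp add: powr_realpow)

lemma clique_lg:
  assumes S: "S \<subseteq> A" "S \<noteq> {}" and clique: "\<And>x y. x \<in> S \<Longrightarrow> y \<in> S \<Longrightarrow> x \<noteq> y \<Longrightarrow> lg {x, y} = 1"
  shows "lg S = card S - 1 \<or> lg S = card S"
proof (rule ccontr)
  assume "\<not> ?thesis"
  then have neg: "lg S \<noteq> card S - 1" "lg S \<noteq> card S" by auto
  \<comment> \<open>\<open>clique_excess\<close> speaks of the whole ground set, so the system is
    restricted to \<open>S\<close>.\<close>
  interpret R: te_rows n r S d
  proof
    show "finite S" using S(1) finite_A by (rule finite_subset)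
    show "eqmod n r X (d X)" if "X \<subseteq> S" for X using eqm that S(1) by simp
    show "eqmod n r {x} 1" if "x \<in> S" for x using unit_rows that S(1) by auto
  qed
  obtain M p where M: "M \<subseteq> S" "p \<in> S - M" "card M \<ge> 4" "lg M = card M"
    "\<And>X. X \<subset> M \<Longrightarrow> X \<noteq> {} \<Longrightarrow> lg X = real (card X) - 1"
    "lg (insert p M) = card M + 1"
    "\<And>m. m \<in> M \<Longrightarrow> lg (insert p (M - {m})) = real (card M) - 1"
    by (rule R.clique_excess[OF _ S(2) neg]) (rule clique that; assumption)+
  have MA: "M \<subseteq> A" "p \<in> A" "p \<notin> M" "insert p M \<subseteq> A" using M S by auto
  have finM: "finite M" using MA finite_A finite_subset by blast
  show False
  proof (rule no_thick_extension[OF finM MA(3)])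
    show "2 \<le> card M" using M(3) by simp
    show "eqmod n r {x} 1" if "x \<in> insert p M" for x using that MA unit_rows by blast
    show "same_supp n r x y" if "x \<in> insert p M" "y \<in> insert p M" for x y
    proof (cases "x = y")
      case False
      have xy: "x \<in> S" "y \<in> S" "{x, y} \<subseteq> A" using that M MA by auto
      have "eqmod n r {x, y} 2" using eqm_pow[OF xy(3), of 1] clique[OF xy(1,2) False] by simp
      then show ?thesis using eqmod_pair(2)[of n r x y 2] unit_rows xy False by auto
    qed (simp add: same_supp_def)
    show "eqmod n r M (2 ^ card M)" using eqm_pow[OF MA(1) M(4)] .
    show "eqmod n r X (2 ^ (card X - 1))" if X: "X \<subset> M" "X \<noteq> {}" for X
    proof (rule eqm_pow)
      have "card X > 0" using X finM finite_subset by (metis card_gt_0_iff psubset_imp_subset)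
      then show "lg X = real (card X - 1)" using M(5)[OF X] by (simp add: of_nat_diff)
    qed (use X MA in auto)
    show "eqmod n r (insert p M) (2 ^ (card M + 1))"
      by (rule eqm_pow) (use M(6) MA in auto)
    show "eqmod n r (insert p (M - {m})) (2 ^ (card M - 1))" if m: "m \<in> M" for m
      by (rule eqm_pow) (use M(3) M(7)[OF m] MA in \<open>auto simp: of_nat_diff\<close>)
  qed
qed

end

section \<open>Equimodularity in terms of minors\<close>

lemma rows_list: "finite X \<Longrightarrow> distinct (rows_list X) \<and> set (rows_list X) = X"
  unfolding rows_list_def by (rule someI_ex) (metis finite_distinct_list)

text \<open>Translates the column sets of \<open>submatrix\<close> into the column lists of
  \<open>minor\<close>.\<close>

lemma map_pick:
  assumes "finite J"
  shows "distinct (map (pick J) [0..<card J])" "set (map (pick J) [0..<card J]) = J"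
proof -
  have inj: "inj_on (pick J) {0..<card J}"
  proof (rule inj_onI)
    fix a b assume "a \<in> {0..<card J}" "b \<in> {0..<card J}" "pick J a = pick J b"
    then show "a = b" using pick_mono[of a J b] pick_mono[of b J a] by (cases a b rule: linorder_cases) auto
  qed
  then show "distinct (map (pick J) [0..<card J])" by (simp add: distinct_map)
  have "pick J ` {0..<card J} \<subseteq> J" using pick_in_set by auto
  moreover have "card (pick J ` {0..<card J}) = card J" using card_image[OF inj] by simp
  ultimately have "pick J ` {0..<card J} = J" using assms by (intro card_subset_eq) auto
  then show "set (map (pick J) [0..<card J]) = J" by simp
qed

lemma det_submatrix:
  assumes "I \<subseteq> {..<length xs}" "J \<subseteq> {..<n}" "card I = card J"
  shows "det (submatrix (mat_of_rows n xs) I J) =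
    minor ($) (map (\<lambda>i. xs ! pick I i) [0..<card I]) (map (pick J) [0..<card J])"
proof -
  have I: "{i. i < length xs \<and> i \<in> I} = I" and J: "{j. j < n \<and> j \<in> J} = J"
    using assms by auto
  have "submatrix (mat_of_rows n xs) I J =
    mat (card I) (card I) (\<lambda>(i,j). (map (\<lambda>i. xs ! pick I i) [0..<card I] ! i) $ (map (pick J) [0..<card J] ! j))"
  proof (rule eq_matI)
    fix i j assume "i < dim_row (mat (card I) (card I) (\<lambda>(i,j). (map (\<lambda>i. xs ! pick I i) [0..<card I] ! i) $ (map (pick J) [0..<card J] ! j)))"
      "j < dim_col (mat (card I) (card I) (\<lambda>(i,j). (map (\<lambda>i. xs ! pick I i) [0..<card I] ! i) $ (map (pick J) [0..<card J] ! j)))"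
    then have ij: "i < card I" "j < card J" using assms by auto
    have "pick I i \<in> I" "pick J j \<in> J" using ij pick_in_set by auto
    then have "pick I i < length xs" "pick J j < n" using assms by auto
    then show "submatrix (mat_of_rows n xs) I J $$ (i, j) =
      mat (card I) (card I) (\<lambda>(i,j). (map (\<lambda>i. xs ! pick I i) [0..<card I] ! i) $ (map (pick J) [0..<card J] ! j)) $$ (i, j)"
      using ij assms(3) by (simp add: submatrix_def I J mat_of_rows_def)
  qed (use assms in \<open>auto simp: dim_submatrix I J\<close>)
  then show ?thesis by (simp add: minor_def)
qed

lemma pick_lessThan: "i < k \<Longrightarrow> pick {..<k} i = i"
proof -
  assume i: "i < k"
  then have "{a \<in> {..<k}. a < i} = {..<i}" by auto
  then show "pick {..<k} i = i" using pick_card_in_set[of i "{..<k}"] i by simp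
qed

lemma max_minor_eq_minor:
  assumes "finite X" "col_choice n X J"
  shows "max_minor n X J = minor ($) (rows_list X) (map (pick J) [0..<card J])"
proof -
  let ?xs = "rows_list X"
  have len: "length ?xs = card X" using rows_list[OF assms(1)] distinct_card by metis
  \<comment> \<open>\<open>det_submatrix\<close> wants row sets within the range of row indices; all
    of that range selects the same rows as \<open>UNIV\<close>.\<close>
  have "submatrix (mat_of_rows n ?xs) UNIV J = submatrix (mat_of_rows n ?xs) {..<length ?xs} J"
  proof -
    have c: "{i. i < length ?xs \<and> i \<in> UNIV} = {..<length ?xs}" "{i. i < length ?xs \<and> i \<in> {..<length ?xs}} = {..<length ?xs}" by auto
    show ?thesis unfolding submatrix_def
      by (rule eq_matI) (use c in \<open>simp_all add: pick_UNIV pick_lessThan\<close>)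
  qed
  then have "max_minor n X J = det (submatrix (mat_of_rows n ?xs) {..<length ?xs} J)"
    by (simp add: max_minor_def mat_of_set_def)
  also have "\<dots> = minor ($) (map (\<lambda>i. ?xs ! pick {..<length ?xs} i) [0..<card {..<length ?xs}]) (map (pick J) [0..<card J])"
    by (rule det_submatrix) (use assms len in \<open>auto simp: col_choice_def\<close>)
  also have "map (\<lambda>i. ?xs ! pick {..<length ?xs} i) [0..<card {..<length ?xs}] = ?xs"
  proof (rule nth_equalityI)
    fix i assume "i < length (map (\<lambda>i. ?xs ! pick {..<length ?xs} i) [0..<card {..<length ?xs}])"
    then have i: "i < length ?xs" by simp
    then show "map (\<lambda>i. ?xs ! pick {..<length ?xs} i) [0..<card {..<length ?xs}] ! i = ?xs ! i" by (simp add: pick_lessThan)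
  qed simp
  finally show ?thesis .
qed

section \<open>Linear independence, equimodularity and total unimodularity through minors\<close>

lemma lin_indep_subset:
  assumes "lin_indep_set n A" "X \<subseteq> A" shows "lin_indep_set n X"
proof -
  have A: "finite A" "A \<subseteq> carrier_vec n" and
    ind: "\<And>c. (\<forall>i<n. (\<Sum>x\<in>A. c x * x $ i) = 0) \<Longrightarrow> (\<forall>x\<in>A. c x = 0)"
    using assms(1) unfolding lin_indep_set_def by blast+
  have "\<forall>x\<in>X. c x = 0" if "\<forall>i<n. (\<Sum>x\<in>X. c x * x $ i) = 0" for c :: "real vec \<Rightarrow> real"
  proof -
    have "(\<Sum>x\<in>A. (if x \<in> X then c x else 0) * x $ i) = (\<Sum>x\<in>X. c x * x $ i)" for i
      using assms(2) A(1) by (intro sum.mono_neutral_cong_right) auto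
    then have "\<forall>x\<in>A. (if x \<in> X then c x else 0) = 0" using that by (intro ind) simp
    then show ?thesis using assms(2) by (metis subsetD)
  qed
  then show ?thesis using A assms(2) finite_subset unfolding lin_indep_set_def by blast
qed

text \<open>Contract the earlier rows and choose a column where the contracted last row is nonzero.
  Without such a column, the last row would be a combination of the earlier ones.\<close>

lemma lin_indep_nonzero_minor:
  assumes "lin_indep_set n X" "distinct xs" "set xs = X"
  shows "\<exists>cs. set cs \<subseteq> {..<n} \<and> length cs = length xs \<and> minor ($) xs cs \<noteq> 0"
  using assms
proof (induction xs arbitrary: X rule: rev_induct)
  case Nil
  then show ?case by auto
next
  case (snoc x xs)
  have "lin_indep_set n (set xs)" by (rule lin_indep_subset[OF snoc.prems(1)]) (use snoc.prems in auto)
  then obtain bs where bs: "set bs \<subseteq> {..<n}" "length bs = length xs" "minor ($) xs bs \<noteq> 0"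
    using snoc.IH snoc.prems by auto
  obtain \<phi> where 1: "\<And>ys cs. length cs = length ys \<Longrightarrow> set ys \<inter> set xs = {} \<Longrightarrow>
       minor ($) (xs @ ys) (bs @ cs) = minor ($) xs bs * minor \<phi> ys cs"
    and 2: "\<And>x. \<exists>c. \<forall>j. \<phi> x j = x $ j - (\<Sum>i<length xs. c i * (xs ! i) $ j)"
    by (rule contraction[OF bs(2,3)]) (rule that; assumption)
  have x: "x \<notin> set xs" "distinct xs" using snoc.prems by auto
  have "\<exists>j<n. \<phi> x j \<noteq> 0"
  proof (rule ccontr)
    assume neg: "\<not> ?thesis"
    obtain c where c: "\<And>j. \<phi> x j = x $ j - (\<Sum>i<length xs. c i * (xs ! i) $ j)" using 2 by blast
    \<comment> \<open>The dependence read off from the contraction: coefficient 1 at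
      \<open>x\<close> and \<open>- c i\<close> at the row in position \<open>i\<close>.\<close>
    define g where "g v = (if v = x then 1 else - (\<Sum>i<length xs. if xs ! i = v then c i else 0))" for v
    have gi: "g (xs ! i) = - c i" if "i < length xs" for i
    proof -
      have "(\<Sum>k<length xs. if xs ! k = xs ! i then c k else 0) = (\<Sum>k<length xs. if k = i then c k else 0)"
        by (rule sum.cong) (use that x in \<open>auto simp: nth_eq_iff_index_eq\<close>)
      moreover have "xs ! i \<noteq> x" using x that by auto
      ultimately show ?thesis using that by (simp add: g_def)
    qed
    have "(\<Sum>v\<in>X. g v * v $ j) = 0" if "j < n" for j
    proof -
      have "(\<Sum>v\<in>set xs. g v * v $ j) = (\<Sum>i<length xs. g (xs ! i) * (xs ! i) $ j)"
        by (rule sum.reindex_bij_betw[OF bij_betw_nth[OF x(2)], symmetric]) auto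
      also have "\<dots> = - (\<Sum>i<length xs. c i * (xs ! i) $ j)"
        unfolding sum_negf[symmetric] by (rule sum.cong) (auto simp: gi)
      finally have "(\<Sum>v\<in>set xs. g v * v $ j) = - (\<Sum>i<length xs. c i * (xs ! i) $ j)" .
      moreover have "(\<Sum>v\<in>X. g v * v $ j) = g x * x $ j + (\<Sum>v\<in>set xs. g v * v $ j)"
      proof -
        have "X = insert x (set xs)" using snoc.prems by auto
        then show ?thesis using x by simp
      qed
      moreover have "\<phi> x j = 0" using neg that by blast
      ultimately show ?thesis using c[of j] by (simp add: g_def)
    qed
    then have "\<forall>v\<in>X. g v = 0" using snoc.prems(1) unfolding lin_indep_set_def by blast
    then show False using snoc.prems(3) by (auto simp: g_def)
  qed
  then obtain j where j: "j < n" "\<phi> x j \<noteq> 0" by blast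
  then have "minor ($) (xs @ [x]) (bs @ [j]) \<noteq> 0"
    using 1[of "[j]" "[x]"] x bs by (simp add: minor_single)
  then show ?case using bs j by (intro exI[of _ "bs @ [j]"]) auto
qed

lemma max_minor_minor:
  assumes X: "finite X" and xs: "distinct xs" "set xs = X"
    and cs: "set cs \<subseteq> {..<n}" "length cs = length xs" "minor ($) xs cs \<noteq> 0"
  shows "col_choice n X (set cs)" "\<bar>max_minor n X (set cs)\<bar> = \<bar>minor ($) xs cs\<bar>"
proof -
  have d: "distinct cs" using minor_nonzero_distinct_cols[OF cs(2,3)] .
  have len: "length xs = card X" using xs distinct_card by metis
  show cc: "col_choice n X (set cs)"
    using cs len distinct_card[OF d] by (simp add: col_choice_def)
  let ?ds = "map (pick (set cs)) [0..<card (set cs)]"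
  have m: "mset cs = mset ?ds"
    using map_pick[of "set cs"] d by (metis List.finite_set set_eq_iff_mset_eq_distinct)
  have "\<bar>minor ($) xs cs\<bar> = \<bar>minor ($) xs ?ds\<bar>" by (rule minor_perm_cols[OF m cs(2)])
  also have "\<dots> = \<bar>minor ($) (rows_list X) ?ds\<bar>"
    by (rule minor_abs_cong_set) (use rows_list[OF X] xs in auto)
  finally show "\<bar>max_minor n X (set cs)\<bar> = \<bar>minor ($) xs cs\<bar>"
    using max_minor_eq_minor[OF X cc] by simp
qed

lemma eqmod_max_minor:
  assumes E: "eqmod n ($) X d" and J: "col_choice n X J"
  shows "\<bar>max_minor n X J\<bar> = 0 \<or> \<bar>max_minor n X J\<bar> = d"
proof -
  have X: "finite X" using E eqmod_finite by blast
  have J': "finite J" "J \<subseteq> {..<n}" "card J = card X" using J finite_subset by (auto simp: col_choice_def)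
  have len: "length (rows_list X) = card X" using rows_list[OF X] distinct_card by metis
  have "set (map (pick J) [0..<card J]) \<subseteq> {..<n}" using map_pick(2)[OF J'(1)] J'(2) by simp
  then show ?thesis
    unfolding max_minor_eq_minor[OF X J]
    by (rule eqmod_minor[OF E conjunct1[OF rows_list[OF X]] conjunct2[OF rows_list[OF X]]]) (use J' len in simp)
qed

lemma equimodular_iff_eqmod:
  assumes "lin_indep_set n X"
  shows "equimodular n X \<longleftrightarrow> (\<exists>d. eqmod n ($) X d)"
proof
  have X: "finite X" using assms by (simp add: lin_indep_set_def)
  obtain xs where xs: "distinct xs" "set xs = X" using finite_distinct_list[OF X] by blast
  obtain cs where cs: "set cs \<subseteq> {..<n}" "length cs = length xs" "minor ($) xs cs \<noteq> 0"
    using lin_indep_nonzero_minor[OF assms xs] by blast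
  assume E: "equimodular n X"
  have "eqmod n ($) X \<bar>minor ($) xs cs\<bar>"
  proof (rule eqmodI[OF xs _ _ cs])
    fix ds assume ds: "set ds \<subseteq> {..<n}" "length ds = length xs" "minor ($) xs ds \<noteq> 0"
    note c = max_minor_minor[OF X xs cs] and d = max_minor_minor[OF X xs ds]
    have "max_minor n X (set cs) \<noteq> 0" "max_minor n X (set ds) \<noteq> 0" using c d cs ds by auto
    then have "\<bar>max_minor n X (set cs)\<bar> = \<bar>max_minor n X (set ds)\<bar>"
      using E c(1) d(1) unfolding equimodular_def by blast
    then show "\<bar>minor ($) xs ds\<bar> = \<bar>minor ($) xs cs\<bar>" using c d by simp
  qed (use cs in simp)
  then show "\<exists>d. eqmod n ($) X d" by blast
next
  assume "\<exists>d. eqmod n ($) X d"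
  then obtain d where d: "eqmod n ($) X d" by blast
  have "\<bar>max_minor n X J\<bar> = \<bar>max_minor n X J'\<bar>"
    if "col_choice n X J" "col_choice n X J'" "max_minor n X J \<noteq> 0" "max_minor n X J' \<noteq> 0" for J J'
    using eqmod_max_minor[OF d that(1)] eqmod_max_minor[OF d that(2)] that(3,4) by auto
  then show "equimodular n X" using assms unfolding equimodular_def by blast
qed

lemma eqdet_eqmod:
  assumes E: "eqmod n ($) X d" shows "eqdet n X = d"
proof -
  have X: "finite X" using E eqmod_finite by blast
  obtain xs where xs: "distinct xs" "set xs = X" using finite_distinct_list[OF X] by blast
  obtain cs where cs: "set cs \<subseteq> {..<n}" "length cs = length xs" "\<bar>minor ($) xs cs\<bar> = d"
    using eqmod_nonzero[OF E xs] .
  have nz: "minor ($) xs cs \<noteq> 0" using cs eqmod_pos[OF E] by auto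
  note c = max_minor_minor[OF X xs cs(1,2) nz]
  show ?thesis unfolding eqdet_def
  proof (rule the_equality)
    show "\<exists>J. col_choice n X J \<and> max_minor n X J \<noteq> 0 \<and> d = \<bar>max_minor n X J\<bar>"
      using c cs nz by (intro exI[of _ "set cs"]) auto
    fix d' assume "\<exists>J. col_choice n X J \<and> max_minor n X J \<noteq> 0 \<and> d' = \<bar>max_minor n X J\<bar>"
    then obtain J where "col_choice n X J" "max_minor n X J \<noteq> 0" "d' = \<bar>max_minor n X J\<bar>" by blast
    then show "d' = d" using eqmod_max_minor[OF E, of J] by auto
  qed
qed

text \<open>A subdeterminant with row set \<open>I\<close> is a full minor of the corresponding
  subset of \<open>X\<close>. That subset is independent, so it also has the nonzero minor that
  \<open>eqmod\<close> demands.\<close>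

lemma totally_unimodular_iff_eqmod:
  assumes li: "lin_indep_set n X"
  shows "totally_unimodular n X \<longleftrightarrow> (\<forall>Y\<subseteq>X. eqmod n ($) Y 1)"
proof
  have X: "finite X" using li by (simp add: lin_indep_set_def)
  define xs where "xs = rows_list X"
  have xs: "distinct xs" "set xs = X" using rows_list[OF X] by (auto simp: xs_def)
  have len: "length xs = card X" using xs distinct_card by metis
  have pos: "distinct (map (\<lambda>i. xs ! pick I i) [0..<card I])"
     "set (map (\<lambda>i. xs ! pick I i) [0..<card I]) = (!) xs ` I" if I: "I \<subseteq> {..<card X}" for I
  proof -
    have fI: "finite I" using I finite_subset by blast
    have "inj_on ((!) xs) I"
      using I xs(1) len by (auto simp: inj_on_def nth_eq_iff_index_eq subset_iff)
    moreover define l where "l = map (pick I) [0..<card I]"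
    have "distinct l" "set l = I" using map_pick[OF fI] by (auto simp: l_def)
    moreover have "map (\<lambda>i. xs ! pick I i) [0..<card I] = map ((!) xs) l" by (simp add: l_def)
    ultimately show "distinct (map (\<lambda>i. xs ! pick I i) [0..<card I])"
     "set (map (\<lambda>i. xs ! pick I i) [0..<card I]) = (!) xs ` I"
      by (simp_all add: distinct_map)
  qed
  have det: "det (submatrix (mat_of_set n X) I J) =
    minor ($) (map (\<lambda>i. xs ! pick I i) [0..<card I]) (map (pick J) [0..<card J])"
    if "I \<subseteq> {..<card X}" "J \<subseteq> {..<n}" "card I = card J" for I J
    unfolding mat_of_set_def xs_def[symmetric] by (rule det_submatrix) (use that len in auto)
  {
    assume tu: "totally_unimodular n X"
    show "\<forall>Y\<subseteq>X. eqmod n ($) Y 1"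
    proof (intro allI impI)
      fix Y assume Y: "Y \<subseteq> X"
      define I where "I = {i. i < card X \<and> xs ! i \<in> Y}"
      have I: "I \<subseteq> {..<card X}" by (auto simp: I_def)
      have img: "(!) xs ` I = Y"
      proof
        show "Y \<subseteq> (!) xs ` I"
        proof
          fix y assume y: "y \<in> Y"
          then have "y \<in> set xs" using Y xs(2) by blast
          then obtain i where "i < length xs" "xs ! i = y" by (auto simp: in_set_conv_nth)
          then show "y \<in> (!) xs ` I" using y len by (auto simp: I_def)
        qed
      qed (auto simp: I_def)
      define ys where "ys = map (\<lambda>i. xs ! pick I i) [0..<card I]"
      have ys: "distinct ys" "set ys = Y" using pos[OF I] img by (auto simp: ys_def)
      obtain cs where cs: "set cs \<subseteq> {..<n}" "length cs = length ys" "minor ($) ys cs \<noteq> 0"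
        using lin_indep_nonzero_minor[OF lin_indep_subset[OF li Y] ys] by blast
      show "eqmod n ($) Y 1"
      proof (rule eqmodI[OF ys _ _ cs])
        fix ds assume ds: "set ds \<subseteq> {..<n}" "length ds = length ys" "minor ($) ys ds \<noteq> 0"
        have d: "distinct ds" using minor_nonzero_distinct_cols[OF ds(2,3)] .
        have c: "card I = card (set ds)" using ds(2) distinct_card[OF d] by (simp add: ys_def)
        have "mset ds = mset (map (pick (set ds)) [0..<card (set ds)])"
          using map_pick[of "set ds"] d by (metis List.finite_set set_eq_iff_mset_eq_distinct)
        then have "\<bar>minor ($) ys ds\<bar> = \<bar>minor ($) ys (map (pick (set ds)) [0..<card (set ds)])\<bar>"
          by (rule minor_perm_cols) (use ds in simp)
        also have "\<dots> = \<bar>det (submatrix (mat_of_set n X) I (set ds))\<bar>"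
          using det[OF I ds(1) c] by (simp add: ys_def)
        finally have e: "\<bar>minor ($) ys ds\<bar> = \<bar>det (submatrix (mat_of_set n X) I (set ds))\<bar>" .
        have "det (submatrix (mat_of_set n X) I (set ds)) \<in> {0, 1, -1}"
          using tu I ds(1) c unfolding totally_unimodular_def by blast
        then show "\<bar>minor ($) ys ds\<bar> = 1" using e ds(3) by auto
      qed simp
    qed
  }
  assume E: "\<forall>Y\<subseteq>X. eqmod n ($) Y 1"
  show "totally_unimodular n X" unfolding totally_unimodular_def
  proof (intro allI impI, elim conjE)
    fix I J assume IJ: "I \<subseteq> {..<card X}" "J \<subseteq> {..<n}" "card I = card J"
    define ys where "ys = map (\<lambda>i. xs ! pick I i) [0..<card I]"
    have ys: "distinct ys" "set ys = (!) xs ` I" using pos[OF IJ(1)] by (auto simp: ys_def)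
    have "(!) xs ` I \<subseteq> X" using IJ(1) xs(2) len by (auto simp: subset_iff)
    then have "eqmod n ($) ((!) xs ` I) 1" using E by blast
    from eqmod_minor[OF this ys, of "map (pick J) [0..<card J]"]
    have "\<bar>minor ($) ys (map (pick J) [0..<card J])\<bar> = 0 \<or> \<bar>minor ($) ys (map (pick J) [0..<card J])\<bar> = 1"
      using map_pick(2)[of J] finite_subset[OF IJ(2)] IJ by (simp add: ys_def)
    then show "det (submatrix (mat_of_set n X) I J) \<in> {0, 1, -1}"
      unfolding det[OF IJ] ys_def by (auto simp: abs_if split: if_splits)
  qed
qed

section \<open>Mutually-tu bricks form a te-set\<close>

text \<open>For each nonzero minor, \<open>R\<close> is contracted along columns of this very minor,
  so that the other columns are left for \<open>S\<close> and \<open>z\<close>. The product formulas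
  in the hypotheses say that, after scaling, pairs in \<open>S\<close> have determinant 2 and pairs
  with \<open>z\<close> determinant 1, which is the situation of
  \<open>minor_add_row_same_supp\<close>.\<close>

lemma eqmod_add_row:
  assumes fin: "finite R" "finite S" and disj: "R \<inter> S = {}" "z \<notin> R" "z \<notin> S"
    and R: "eqmod n r R (d R)" and Rz: "eqmod n r (insert z R) (d (insert z R))" and RS: "eqmod n r (R \<union> S) (d (R \<union> S))"
    and Rs: "\<And>s. s \<in> S \<Longrightarrow> eqmod n r (insert s R) (d (insert s R))"
    and Rss: "\<And>s t. s \<in> S \<Longrightarrow> t \<in> S \<Longrightarrow> s \<noteq> t \<Longrightarrow>
      eqmod n r (insert s (insert t R)) (d (insert s (insert t R))) \<and>
      d (insert s (insert t R)) * d R = 2 * (d (insert s R) * d (insert t R))"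
    and Rsz: "\<And>s. s \<in> S \<Longrightarrow> eqmod n r (insert s (insert z R)) (d (insert s (insert z R))) \<and>
      d (insert s (insert z R)) * d R = d (insert s R) * d (insert z R)"
    and xs: "distinct xs" "set xs = insert z (R \<union> S)" and js: "set js \<subseteq> {..<n}" "length js = length xs" "minor r xs js \<noteq> 0"
  shows "eqmod n r (insert z (R \<union> S)) (d (R \<union> S) * d (insert z R) / d R)"
proof (rule eqmodI[OF xs _ _ js])
  have pos: "d R > 0" "d (insert z R) > 0" "d (R \<union> S) > 0" and sp: "\<And>s. s \<in> S \<Longrightarrow> d (insert s R) > 0"
    using R Rz RS Rs eqmod_pos by blast+
  then show "d (R \<union> S) * d (insert z R) / d R > 0" by simp
  fix cs assume cs: "set cs \<subseteq> {..<n}" "length cs = length xs" "minor r xs cs \<noteq> 0"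
  obtain rs ss where rs: "distinct rs" "set rs = R" and ss: "distinct ss" "set ss = S"
    using finite_distinct_list fin by metis
  have dl: "distinct (rs @ ss @ [z])" "distinct ((ss @ [z]) @ rs)" using rs ss disj by auto
  have sl: "set (rs @ ss @ [z]) = set xs" "set ((ss @ [z]) @ rs) = set xs" using rs ss xs by auto
  have len: "length xs = length (ss @ [z]) + length rs"
    using distinct_card[OF dl(2)] distinct_card[OF xs(1)] sl by simp
  have "minor r ((ss @ [z]) @ rs) cs \<noteq> 0"
    using minor_abs_cong_set[OF dl(2) xs(1) sl(2), of r cs] cs(3) by auto
  then obtain bs ds where b: "mset cs = mset (bs @ ds)" "length bs = length rs" "length ds = length (ss @ [z])" "minor r rs bs \<noteq> 0"
    using minor_sub_nonzero[of r "ss @ [z]" rs cs] cs(2) len by auto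
  have sub: "set bs \<subseteq> {..<n}" "set ds \<subseteq> {..<n}" using mset_eq_setD[OF b(1)] cs(1) by auto
  have zS: "insert z S \<inter> set rs = {}" using rs disj by auto
  have E: "eqmod n r (insert x (set rs)) (d (insert x (set rs)))" if "x \<in> insert z S" for x
    using that Rz Rs rs by auto
  obtain \<psi> where 1: "\<And>xs cs. length cs = length xs \<Longrightarrow> set xs \<subseteq> insert z S \<Longrightarrow> distinct xs \<Longrightarrow>
       \<bar>minor r (rs @ xs) (bs @ cs)\<bar> = d R * (\<Prod>x\<in>set xs. d (insert x R) / d R) * \<bar>minor \<psi> xs cs\<bar>"
    and 2: "\<And>X. X \<subseteq> insert z S \<Longrightarrow> eqmod n r (R \<union> X) (d (R \<union> X)) \<Longrightarrow>
       eqmod n \<psi> X ((\<Prod>x\<in>X. d R / d (insert x R)) * (d (R \<union> X) / d R))"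
    by (rule eqmod_contract_normalized[OF rs(1) b(2) sub(1) b(4), of d "insert z S", unfolded rs(2)])
      (use R E zS that rs(2) in \<open>auto\<close>)
  have u: "eqmod n \<psi> {x} 1" if "x \<in> insert z S" for x
  proof -
    have "d (insert x R) > 0" using E[OF that] eqmod_pos rs by blast
    then show ?thesis using 2[of "{x}"] E[OF that] that rs pos(1) by auto
  qed
  have pz: "eqmod n \<psi> {s, z} 1" if "s \<in> S" for s
  proof -
    have "(\<Prod>x\<in>{s,z}. d R / d (insert x R)) * (d (R \<union> {s,z}) / d R) = 1"
    proof -
      have "s \<noteq> z" using that disj by auto
      then show ?thesis
        using Rsz[OF that] pos sp[OF that] by (simp add: insert_commute divide_simps mult_ac)
    qed
    then show ?thesis using 2[of "{s,z}"] Rsz[OF that] that by (auto simp: insert_commute)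
  qed
  have same: "same_supp n \<psi> s t" if st: "s \<in> S" "t \<in> S" for s t
  proof (cases "s = t")
    case False
    have "(\<Prod>x\<in>{s,t}. d R / d (insert x R)) * (d (R \<union> {s,t}) / d R) = 2"
      using Rss[OF st False] False pos sp[OF st(1)] sp[OF st(2)] by (auto simp: insert_commute divide_simps mult_ac)
    then have "eqmod n \<psi> {s, t} 2" using 2[of "{s,t}"] Rss[OF st False] st by (auto simp: insert_commute)
    then show ?thesis using eqmod_pair(2)[OF u[of s] u[of t]] st False by auto
  qed (simp add: same_supp_def)
  define dS where "dS = (\<Prod>x\<in>S. d R / d (insert x R)) * (d (R \<union> S) / d R)"
  have eS: "eqmod n \<psi> (set ss) dS" using 2[of S] RS ss by (auto simp: dS_def)
  have dd: "distinct (ss @ [z])" using ss disj by auto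
  have sR: "\<bar>minor r xs cs\<bar> = \<bar>minor r (rs @ (ss @ [z])) (bs @ ds)\<bar>"
    using minor_abs_cong_set[OF dl(1) xs(1) sl(1), of r cs] minor_perm_cols[OF b(1), of "rs @ ss @ [z]" r] cs(2) len by simp
  also have key: "\<dots> = d R * (\<Prod>x\<in>insert z S. d (insert x R) / d R) * \<bar>minor \<psi> (ss @ [z]) ds\<bar>"
    using 1[of ds "ss @ [z]"] b(3) dd ss by simp
  also have "\<bar>minor \<psi> (ss @ [z]) ds\<bar> = dS"
  proof (rule minor_add_row_same_supp[OF _ _ _ _ _ eS ss(1)])
    show "minor \<psi> (ss @ [z]) ds \<noteq> 0" using sR key cs(3) by auto
  qed (use u pz same ss disj sub b in auto)
  \<comment> \<open>The scaling factors of \<open>S\<close> cancel against those in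
    \<open>dS\<close>; only the factor of \<open>z\<close> remains.\<close>
  also have "d R * (\<Prod>x\<in>insert z S. d (insert x R) / d R) * dS = d (R \<union> S) * d (insert z R) / d R"
  proof -
    have "(\<Prod>x\<in>S. d (insert x R) / d R) * (\<Prod>x\<in>S. d R / d (insert x R)) = 1"
      unfolding prod.distrib[symmetric] by (rule prod.neutral) (use pos sp in \<open>force\<close>)
    moreover have "(\<Prod>x\<in>insert z S. d (insert x R) / d R) = d (insert z R) / d R * (\<Prod>x\<in>S. d (insert x R) / d R)"
      using fin disj by simp
    ultimately have "(\<Prod>x\<in>insert z S. d (insert x R) / d R) * (\<Prod>x\<in>S. d R / d (insert x R)) = d (insert z R) / d R"
      by (simp only: mult.assoc mult_1_right)
    moreover have "a * b * (c * e) = a * (b * c) * e" for a b c e :: real by simp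
    ultimately have "d R * (\<Prod>x\<in>insert z S. d (insert x R) / d R) * dS = d R * (d (insert z R) / d R) * (d (R \<union> S) / d R)"
      unfolding dS_def by presburger
    then show ?thesis using pos by simp
  qed
  finally show "\<bar>minor r xs cs\<bar> = d (R \<union> S) * d (insert z R) / d R" .
qed

section \<open>te-sets, tu-sets and te-laces expressed by \<open>eqmod\<close> and
  \<open>lg\<close>\<close>

locale pm1_indep =
  fixes n :: nat and A :: "real vec set"
  assumes pm1: "pm1_set n A" and indep: "lin_indep_set n A"
begin

lemma finA: "finite A" using indep by (simp add: lin_indep_set_def)

lemma pm1_sub: "X \<subseteq> A \<Longrightarrow> pm1_set n X"
  using pm1 unfolding pm1_set_def by blast

lemma indep_sub: "X \<subseteq> A \<Longrightarrow> lin_indep_set n X"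
  using indep lin_indep_subset by blast

lemma unit_eqmod:
  assumes x: "x \<in> A" shows "eqmod n ($) {x} 1"
proof -
  obtain cs where cs: "set cs \<subseteq> {..<n}" "length cs = length [x]" "minor ($) [x] cs \<noteq> 0"
    using lin_indep_nonzero_minor[OF indep_sub, of "{x}" "[x]"] x by auto
  show ?thesis
  proof (rule eqmodI[OF _ _ _ _ cs])
    fix ds assume ds: "set ds \<subseteq> {..<n}" "length ds = length [x]" "minor ($) [x] ds \<noteq> 0"
    then obtain j where j: "ds = [j]" by (auto simp: length_Suc_conv)
    then have "x $ j \<in> {0, 1, -1}" using pm1 x ds(1) unfolding pm1_set_def by auto
    then show "\<bar>minor ($) [x] ds\<bar> = 1" using ds(3) j by (auto simp: minor_single)
  qed auto
qed

text \<open>Every subset of \<open>A\<close> is independent, so total equimodularity is a condition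
  on all subsets, with \<open>eqdet\<close> as the common value.\<close>

lemma te_iff:
  assumes "X \<subseteq> A" shows "te_set n X \<longleftrightarrow> (\<forall>Y\<subseteq>X. eqmod n ($) Y (eqdet n Y))"
proof -
  have sub: "lin_indep_set n Y" if "Y \<subseteq> X" for Y using indep_sub that assms by simp
  have "te_set n X \<longleftrightarrow> (\<forall>Y\<subseteq>X. equimodular n Y)"
    using pm1_sub[OF assms] sub by (auto simp: te_set_def totally_equimodular_def)
  also have "\<dots> \<longleftrightarrow> (\<forall>Y\<subseteq>X. \<exists>d. eqmod n ($) Y d)"
    using equimodular_iff_eqmod[OF sub] by auto
  also have "\<dots> \<longleftrightarrow> (\<forall>Y\<subseteq>X. eqmod n ($) Y (eqdet n Y))"
  proof (intro all_cong1 imp_cong refl iffI)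
    fix Y assume "\<exists>d. eqmod n ($) Y d"
    then obtain d where "eqmod n ($) Y d" by blast
    then show "eqmod n ($) Y (eqdet n Y)" using eqdet_eqmod[of n Y d] by simp
  qed blast
  finally show ?thesis .
qed

lemma tu_iff:
  assumes "X \<subseteq> A" shows "tu_set n X \<longleftrightarrow> (\<forall>Y\<subseteq>X. eqmod n ($) Y 1)"
  using totally_unimodular_iff_eqmod[OF indep_sub[OF assms]] pm1_sub[OF assms] indep_sub[OF assms]
  by (simp add: tu_set_def)

lemma tu_subset: "X \<subseteq> A \<Longrightarrow> tu_set n X \<Longrightarrow> Y \<subseteq> X \<Longrightarrow> tu_set n Y"
  using tu_iff[of X] tu_iff[of Y] by auto

lemma tu_eqdet: "X \<subseteq> A \<Longrightarrow> tu_set n X \<Longrightarrow> eqdet n X = 1"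
  using tu_iff[of X] eqdet_eqmod[of n X 1] by blast

lemma tu_te:
  assumes "X \<subseteq> A" "tu_set n X" shows "te_set n X"
proof -
  have "eqmod n ($) Y (eqdet n Y)" if "Y \<subseteq> X" for Y
  proof -
    have "eqmod n ($) Y 1" using assms that by (simp add: tu_iff)
    then show ?thesis using eqdet_eqmod[of n Y 1] by simp
  qed
  then show ?thesis using assms(1) by (simp add: te_iff)
qed

lemma te_subset: "X \<subseteq> A \<Longrightarrow> te_set n X \<Longrightarrow> Y \<subseteq> X \<Longrightarrow> te_set n Y"
  using te_iff[of X] te_iff[of Y] by auto

lemma tu_empty: "tu_set n {}"
  using tu_iff[of "{}"] eqmod_empty by auto

lemma te_rows_te:
  assumes "X \<subseteq> A" "te_set n X" shows "te_rows n ($) X (eqdet n)"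
proof
  show "finite X" using assms finA finite_subset by blast
  show "eqmod n ($) Y (eqdet n Y)" if "Y \<subseteq> X" for Y using te_iff assms that by blast
  show "eqmod n ($) {x} 1" if "x \<in> X" for x using unit_eqmod assms that by blast
qed

lemma eqdet_single: "x \<in> A \<Longrightarrow> eqdet n {x} = 1" and eqdet_empty: "eqdet n {} = 1"
  using eqdet_eqmod unit_eqmod eqmod_empty by blast+

lemma tu_single: "x \<in> A \<Longrightarrow> tu_set n {x}"
proof -
  assume x: "x \<in> A"
  have "eqmod n ($) Y 1" if "Y \<subseteq> {x}" for Y
    using subset_singletonD[OF that] unit_eqmod[OF x] eqmod_empty by auto
  then show "tu_set n {x}" using tu_iff[of "{x}"] x by auto
qed

text \<open>\<open>lg\<close> is monotone and nonnegative, so its vanishing passes to all subsets,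
  as total unimodularity requires.\<close>

lemma tu_iff_lg:
  assumes X: "X \<subseteq> A" "te_set n X" and Y: "Y \<subseteq> X"
  shows "tu_set n Y \<longleftrightarrow> te_rows.lg (eqdet n) Y = 0"
proof -
  interpret te_rows n "($)" X "eqdet n" by (rule te_rows_te[OF X])
  have YA: "Y \<subseteq> A" using X Y by blast
  show ?thesis
  proof
    assume "tu_set n Y"
    then show "lg Y = 0" using tu_eqdet[OF YA] by (simp add: lg_def)
  next
    assume 0: "lg Y = 0"
    have "eqmod n ($) Z 1" if Z: "Z \<subseteq> Y" for Z
    proof -
      have ZX: "Z \<subseteq> X" using Z Y by blast
      have "lg Z = 0" using mono[OF Z Y] nonneg[OF ZX] 0 by simp
      then have "eqdet n Z = 1" using d_lg[OF ZX] by simp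
      then show ?thesis using eqm[OF ZX] by simp
    qed
    then show "tu_set n Y" using tu_iff[OF YA] by blast
  qed
qed

lemma te_lace_iff_flace:
  assumes X: "X \<subseteq> A" "te_set n X" and Y: "Y \<subseteq> X"
  shows "te_lace n Y \<longleftrightarrow> flace (te_rows.lg (eqdet n)) Y"
proof -
  have "te_set n Y" using te_subset X Y by blast
  moreover have "tu_set n Z \<longleftrightarrow> te_rows.lg (eqdet n) Z = 0" if "Z \<subseteq> Y" for Z
    using tu_iff_lg[OF X, of Z] that Y by blast
  ultimately show ?thesis unfolding te_lace_def flace_def by blast
qed

lemma te_lace_eqdet:
  assumes X: "X \<subseteq> A" "te_lace n X" shows "eqdet n X = 2" "\<And>Y. Y \<subset> X \<Longrightarrow> eqdet n Y = 1"
    "\<exists>x\<in>X. \<exists>y\<in>X. x \<noteq> y"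
proof -
  have te: "te_set n X" using X by (simp add: te_lace_def)
  interpret te_rows n "($)" X "eqdet n" by (rule te_rows_te[OF X(1) te])
  have f: "flace lg X" using te_lace_iff_flace[OF X(1) te subset_refl] X by blast
  obtain x y where xy: "x \<in> X" "y \<in> X" "x \<noteq> y" using flace_two[OF subset_refl f] .
  have "lg X = 1" using flace_gap(2)[OF subset_refl f xy] .
  then show "eqdet n X = 2" using d_lg[of X] by simp
  show "eqdet n Y = 1" if "Y \<subset> X" for Y
    using X that tu_eqdet[of Y] by (auto simp: te_lace_def)
  show "\<exists>x\<in>X. \<exists>y\<in>X. x \<noteq> y" using xy by blast
qed

text \<open>Provides the clique for \<open>eqmod_add_row\<close>; the product formula is the
  multiplicative form of a gap 1 at \<open>X - S\<close>. In a lace, \<open>X\<close> must be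
  everything, and any two elements serve once the rest is contracted. In an interlace all pairs have
  determinant 2 from the start, so \<open>S\<close> is \<open>X\<close>.\<close>

lemma brick_clique:
  assumes Q: "Q \<subseteq> A" "te_lace n Q \<or> te_interlace n Q" and X: "X \<subseteq> Q" "\<not> tu_set n X"
  obtains S x y where "S \<subseteq> X" "x \<in> S" "y \<in> S" "x \<noteq> y"
    "\<And>s t. s \<in> S \<Longrightarrow> t \<in> S \<Longrightarrow> s \<noteq> t \<Longrightarrow>
       eqdet n (insert s (insert t (X - S))) * eqdet n (X - S) = 2 * (eqdet n (insert s (X - S)) * eqdet n (insert t (X - S)))"
proof (cases "te_lace n Q")
  case True
  note l = te_lace_eqdet[OF Q(1) True]
  have "X = Q" using True X unfolding te_lace_def by blast
  obtain x y where xy: "x \<in> Q" "y \<in> Q" "x \<noteq> y" using l(3) by blast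
  have i: "insert x (insert y (Q - {x,y})) = Q" "insert y (insert x (Q - {x,y})) = Q" using xy by auto
  have d: "eqdet n (insert x (Q - {x,y})) = 1" "eqdet n (insert y (Q - {x,y})) = 1" "eqdet n (Q - {x,y}) = 1"
  proof -
    have "insert x (Q - {x,y}) = Q - {y}" "insert y (Q - {x,y}) = Q - {x}" using xy by auto
    moreover have "Q - {y} \<subset> Q" "Q - {x} \<subset> Q" "Q - {x,y} \<subset> Q" using xy by auto
    ultimately show "eqdet n (insert x (Q - {x,y})) = 1" "eqdet n (insert y (Q - {x,y})) = 1" "eqdet n (Q - {x,y}) = 1"
      using l(2) by auto
  qed
  show thesis
  proof (rule that[of "{x,y}" x y])
    fix s t assume "s \<in> {x,y}" "t \<in> {x,y}" "s \<noteq> t"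
    then have "(s = x \<and> t = y) \<or> (s = y \<and> t = x)" by auto
    then show "eqdet n (insert s (insert t (X - {x,y}))) * eqdet n (X - {x,y}) =
        2 * (eqdet n (insert s (X - {x,y})) * eqdet n (insert t (X - {x,y})))"
      unfolding \<open>X = Q\<close> using i d l(1) by auto
  qed (use xy \<open>X = Q\<close> in auto)
next
  case False
  then have int: "te_interlace n Q" using Q(2) by blast
  have "X \<noteq> {}" using X(2) tu_empty by auto
  then obtain x where x: "x \<in> X" by blast
  have "X \<noteq> {x}" using X tu_single[of x] x Q(1) by auto
  then obtain y where y: "y \<in> X" "x \<noteq> y" using x by blast
  show thesis
  proof (rule that[of X x y])
    fix s t assume st: "s \<in> X" "t \<in> X" "s \<noteq> t"
    then have "te_lace n {s,t}" "{s,t} \<subseteq> A" "s \<in> A" "t \<in> A" using int X(1) Q(1) unfolding te_interlace_def by auto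
    then have "eqdet n {s,t} = 2" "eqdet n {s} = 1" "eqdet n {t} = 1"
      using te_lace_eqdet(1)[of "{s,t}"] eqdet_single by auto
    then show "eqdet n (insert s (insert t (X - X))) * eqdet n (X - X) =
        2 * (eqdet n (insert s (X - X)) * eqdet n (insert t (X - X)))"
      by (simp add: eqdet_empty)
  qed (use x y in auto)
qed

text \<open>The induction carries the value of the determinant as well. Being a product over the
  bricks on proper subsets, it transfers the clique relation from \<open>Q\<close> to
  \<open>B\<close>, while a vector \<open>z\<close> outside of \<open>Q\<close> only affects the
  other factors.\<close>

lemma te_set_if_mutually_tu:
  assumes part: "A = \<Union>P" and disj: "\<And>Q Q'. Q \<in> P \<Longrightarrow> Q' \<in> P \<Longrightarrow> Q \<noteq> Q' \<Longrightarrow> Q \<inter> Q' = {}"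
    and brick: "\<And>Q. Q \<in> P \<Longrightarrow> tu_set n Q \<or> te_lace n Q \<or> te_interlace n Q"
    and mut: "\<And>X. X \<subseteq> A \<Longrightarrow> (\<And>Q. Q \<in> P \<Longrightarrow> tu_set n (X \<inter> Q)) \<Longrightarrow> tu_set n X"
  shows "te_set n A"
proof -
  have finP: "finite P" using part finA by (metis finite_UnionD)
  have QA: "Q \<subseteq> A" if "Q \<in> P" for Q using part that by blast
  let ?D = "eqdet n"
  have "eqmod n ($) B (\<Prod>Q\<in>P. ?D (B \<inter> Q))" if "B \<subseteq> A" for B
    using that
  proof (induction "card B" arbitrary: B rule: less_induct)
    case less
    have BA: "B \<subseteq> A" and finB: "finite B" using less.prems finA finite_subset by auto
    have teQ: "te_set n Q" if "Q \<in> P" for Q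
      using brick[OF that] tu_te[OF QA[OF that]] by (auto simp: te_lace_def te_interlace_def)
    show ?case
    proof (cases "\<forall>Q\<in>P. tu_set n (B \<inter> Q)")
      case True
      then have "eqmod n ($) B 1" using mut[OF BA] tu_iff[OF BA] by blast
      moreover have "(\<Prod>Q\<in>P. ?D (B \<inter> Q)) = 1"
        by (rule prod.neutral) (use True BA tu_eqdet in blast)
      ultimately show ?thesis by simp
    next
      case False
      then obtain Q where Q: "Q \<in> P" "\<not> tu_set n (B \<inter> Q)" by blast
      \<comment> \<open>The contribution of the other bricks, which does not depend on the elements
        of \<open>Q\<close>.\<close>
      define F where "F C = (\<Prod>Q'\<in>P - {Q}. ?D (C \<inter> Q'))" for C
      have prodF: "(\<Prod>Q'\<in>P. ?D (C \<inter> Q')) = ?D (C \<inter> Q) * F C" for C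
        unfolding F_def using prod.remove[OF finP Q(1)] .
      have F_cong: "F C = F C'" if "C - Q = C' - Q" for C C'
      proof -
        have "C \<inter> Q' = C' \<inter> Q'" if "Q' \<in> P - {Q}" for Q'
          using disj[of Q Q'] Q(1) that \<open>C - Q = C' - Q\<close> by blast
        then show ?thesis unfolding F_def by (intro prod.cong) auto
      qed
      show ?thesis
      proof (cases "B \<subseteq> Q")
        case True
        have "F B = F {}" by (rule F_cong) (use True in blast)
        also have "\<dots> = 1" unfolding F_def by (simp add: eqdet_empty)
        finally have "(\<Prod>Q\<in>P. ?D (B \<inter> Q)) = ?D B" using prodF[of B] True by (simp add: Int_absorb2)
        then show ?thesis using te_iff[OF QA[OF Q(1)]] teQ[OF Q(1)] True by auto
      next
        case False
        then obtain z where z: "z \<in> B" "z \<notin> Q" by blast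
        have nt: "\<not> tu_set n Q" using tu_subset[OF QA[OF Q(1)], of "B \<inter> Q"] Q(2) by blast
        have QQ: "te_lace n Q \<or> te_interlace n Q" using brick[OF Q(1)] nt by blast
        obtain S x y where S: "S \<subseteq> B \<inter> Q" and xy: "x \<in> S" "y \<in> S" "x \<noteq> y"
          and cl: "\<And>s t. s \<in> S \<Longrightarrow> t \<in> S \<Longrightarrow> s \<noteq> t \<Longrightarrow>
            ?D (insert s (insert t (B \<inter> Q - S))) * ?D (B \<inter> Q - S)
          = 2 * (?D (insert s (B \<inter> Q - S)) * ?D (insert t (B \<inter> Q - S)))"
          by (rule brick_clique[OF QA[OF Q(1)] QQ inf_le2 Q(2)]) (rule that; assumption)
        define R where "R = B - S - {z}"
        define T where "T = B \<inter> Q - S"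
        have IH: "eqmod n ($) C (?D C)" "?D C = ?D (C \<inter> Q) * F C" if "C \<subset> B" for C
        proof -
          have "eqmod n ($) C (\<Prod>Q\<in>P. ?D (C \<inter> Q))"
            by (rule less.hyps) (use that BA psubset_card_mono[OF finB that] in auto)
          then show "eqmod n ($) C (?D C)" "?D C = ?D (C \<inter> Q) * F C"
            using eqdet_eqmod prodF by metis+
        qed
        have zS: "z \<notin> S" using z S by blast
        have Bz: "B = insert z (R \<union> S)" using z S by (auto simp: R_def)
        have dRS: "R \<inter> S = {}" "z \<notin> R" by (auto simp: R_def)
        have ps: "R \<subset> B" "insert z R \<subset> B" "R \<union> S \<subset> B" using Bz zS dRS xy by auto
        have ps1: "insert s R \<subset> B" if "s \<in> S" for s using that Bz zS dRS by auto
        have ps2: "insert s (insert t R) \<subset> B" if "s \<in> S" "t \<in> S" for s t using that Bz zS dRS by auto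
        \<comment> \<open>A second element of the clique keeps this set proper, so that the
          induction hypothesis applies to it.\<close>
        have ps3: "insert s (insert z R) \<subset> B" if "s \<in> S" for s
        proof -
          obtain t where "t \<in> S" "t \<noteq> s" using xy by blast
          then show ?thesis using that Bz zS dRS by auto
        qed
        have RQ: "R \<inter> Q = T" "insert z R \<inter> Q = T" using z S by (auto simp: R_def T_def)
        have RQs: "insert s R \<inter> Q = insert s T" "insert s (insert z R) \<inter> Q = insert s T" if "s \<in> S" for s
          using RQ that S by auto
        have RQst: "insert s (insert t R) \<inter> Q = insert s (insert t T)" if "s \<in> S" "t \<in> S" for s t
          using RQ that S by auto
        have Fs: "F (insert s C) = F C" if "s \<in> S" for s C by (rule F_cong) (use that S in auto)
        have F2: "F (R \<union> S) = F R" by (rule F_cong) (use S in auto)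
        have F3: "F (insert z R) = F B" by (rule F_cong) (use Bz S in auto)
        have xs: "finite R" "finite S" using finB Bz by auto
        obtain xs where xl: "distinct xs" "set xs = B" using finite_distinct_list[OF finB] by blast
        obtain js where js: "set js \<subseteq> {..<n}" "length js = length xs" "minor ($) xs js \<noteq> 0"
          using lin_indep_nonzero_minor[OF indep_sub[OF BA] xl] by blast
        have "eqmod n ($) (insert z (R \<union> S)) (?D (R \<union> S) * ?D (insert z R) / ?D R)"
        proof (rule eqmod_add_row[OF xs dRS zS _ _ _ _ _ _ xl(1) _ js])
          show "set xs = insert z (R \<union> S)" using xl Bz by simp
          show "eqmod n ($) R (?D R)" "eqmod n ($) (insert z R) (?D (insert z R))" "eqmod n ($) (R \<union> S) (?D (R \<union> S))"
            using IH(1) ps by auto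
          show "eqmod n ($) (insert s R) (?D (insert s R))" if "s \<in> S" for s using IH(1) ps1[OF that] .
          show "eqmod n ($) (insert s (insert t R)) (?D (insert s (insert t R))) \<and>
             ?D (insert s (insert t R)) * ?D R = 2 * (?D (insert s R) * ?D (insert t R))"
            if st: "s \<in> S" "t \<in> S" "s \<noteq> t" for s t
          proof
            show "eqmod n ($) (insert s (insert t R)) (?D (insert s (insert t R)))" using IH(1) ps2[OF st(1,2)] .
            have c: "?D (insert s (insert t T)) * ?D T = 2 * (?D (insert s T) * ?D (insert t T))"
              using cl[OF st] by (simp add: T_def)
            have "?D (insert s (insert t R)) * ?D R = (?D (insert s (insert t T)) * ?D T) * (F R * F R)"
              unfolding IH(2)[OF ps2[OF st(1,2)]] IH(2)[OF ps(1)] RQ RQst[OF st(1,2)] Fs[OF st(1)] Fs[OF st(2)]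
              by simp
            also have "\<dots> = 2 * (?D (insert s R) * ?D (insert t R))"
              unfolding c IH(2)[OF ps1[OF st(1)]] IH(2)[OF ps1[OF st(2)]] RQs(1)[OF st(1)] RQs(1)[OF st(2)] Fs[OF st(1)] Fs[OF st(2)]
              by simp
            finally show "?D (insert s (insert t R)) * ?D R = 2 * (?D (insert s R) * ?D (insert t R))" .
          qed
          show "eqmod n ($) (insert s (insert z R)) (?D (insert s (insert z R))) \<and>
             ?D (insert s (insert z R)) * ?D R = ?D (insert s R) * ?D (insert z R)" if s: "s \<in> S" for s
          proof
            show "eqmod n ($) (insert s (insert z R)) (?D (insert s (insert z R)))" using IH(1) ps3[OF s] .
            show "?D (insert s (insert z R)) * ?D R = ?D (insert s R) * ?D (insert z R)"
              unfolding IH(2)[OF ps3[OF s]] IH(2)[OF ps(1)] IH(2)[OF ps1[OF s]] IH(2)[OF ps(2)] RQ RQs[OF s] Fs[OF s]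
              by simp
          qed
        qed
        moreover have "?D (R \<union> S) * ?D (insert z R) / ?D R = (\<Prod>Q\<in>P. ?D (B \<inter> Q))"
        proof -
          have "?D R > 0" using eqmod_pos[OF IH(1)[OF ps(1)]] .
          then have pos: "?D T \<noteq> 0" "F R \<noteq> 0" using IH(2)[OF ps(1)] RQ by auto
          have "(R \<union> S) \<inter> Q = B \<inter> Q" using Bz z by auto
          then have "?D (R \<union> S) = ?D (B \<inter> Q) * F R" using IH(2)[OF ps(3)] F2 by simp
          moreover have "?D (insert z R) = ?D T * F B" using IH(2)[OF ps(2)] RQ F3 by simp
          moreover have "?D R = ?D T * F R" using IH(2)[OF ps(1)] RQ by simp
          ultimately show ?thesis using pos by (simp add: prodF)
        qed
        ultimately show ?thesis using Bz by simp
      qed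
    qed
  qed
  then show ?thesis using te_iff[of A] eqdet_eqmod by (metis subset_refl)
qed

end

section \<open>Decomposition of te-sets\<close>

lemma pairwise_disjoint_listI:
  assumes "distinct bs" "\<And>X Y. X \<in> set bs \<Longrightarrow> Y \<in> set bs \<Longrightarrow> X \<noteq> Y \<Longrightarrow> X \<inter> Y = {}"
  shows "pairwise_disjoint_list bs"
  using assms unfolding pairwise_disjoint_list_def by (metis nth_eq_iff_index_eq nth_mem)

context pm1_indep
begin

lemma card_le_1_if_tu_interlace:
  assumes "te_interlace n Q" "Q \<subseteq> A" "tu_set n (X \<inter> Q)"
  shows "card (X \<inter> Q) \<le> 1"
proof (rule ccontr)
  assume neg: "\<not> card (X \<inter> Q) \<le> 1"
  have "finite (X \<inter> Q)" using assms(2) finA finite_subset by blast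
  then obtain x y where xy: "x \<in> X \<inter> Q" "y \<in> X \<inter> Q" "x \<noteq> y"
    using neg by (metis One_nat_def card_le_Suc0_iff_eq)
  then have "te_lace n {x, y}" using assms(1) unfolding te_interlace_def by blast
  moreover have "tu_set n {x, y}" by (rule tu_subset[OF _ assms(3)]) (use xy assms(2) in auto)
  ultimately show False by (simp add: te_lace_def)
qed

text \<open>Sets meeting two bricks are covered by \<open>mutually_tu\<close>: tu traces contain no
  lace brick and at most one vector of an interlace. A nonempty set that meets only one brick is its
  own trace there.\<close>

lemma te_set_if_decomposition:
  assumes disj: "pairwise_disjoint_list bs" and part: "A = \<Union>(set bs)" and mut: "mutually_tu n bs"
    and brick: "\<And>Q. Q \<in> set bs \<Longrightarrow> tu_set n Q \<or> te_lace n Q \<or> te_interlace n Q"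
  shows "te_set n A"
proof (rule te_set_if_mutually_tu[OF part])
  fix Q Q' assume "Q \<in> set bs" "Q' \<in> set bs" "Q \<noteq> Q'"
  then show "Q \<inter> Q' = {}" using disj unfolding pairwise_disjoint_list_def by (metis in_set_conv_nth)
next
  fix X assume X: "X \<subseteq> A" and tu: "\<And>Q. Q \<in> set bs \<Longrightarrow> tu_set n (X \<inter> Q)"
  have QA: "Q \<subseteq> A" if "Q \<in> set bs" for Q using that part by blast
  let ?I = "{i. i < length bs \<and> X \<inter> bs ! i \<noteq> {}}"
  show "tu_set n X"
  proof (cases "card ?I \<ge> 2")
    case True
    have "\<not> bs ! i \<subseteq> X" if "i < length bs" "te_lace n (bs ! i)" for i
      using tu[of "bs ! i"] that by (auto simp: te_lace_def Int_absorb1)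
    moreover have "card (X \<inter> bs ! i) \<le> 1" if "i < length bs" "te_interlace n (bs ! i)" for i
      using card_le_1_if_tu_interlace[OF that(2)] QA tu that(1) by simp
    ultimately show ?thesis using mut True X part unfolding mutually_tu_def by blast
  next
    case False
    have "finite ?I" by simp
    then have one: "i = j" if "i \<in> ?I" "j \<in> ?I" for i j
      using False that card_le_Suc0_iff_eq[of ?I] by auto
    show ?thesis
    proof (cases "X = {}")
      case True
      then show ?thesis using tu_empty by simp
    next
      case False
      then obtain x where x: "x \<in> X" by blast
      then obtain i where i: "i < length bs" "x \<in> bs ! i" using X part by (metis UnionE in_set_conv_nth subsetD)
      have "X \<subseteq> bs ! i"
      proof
        fix y assume y: "y \<in> X"
        then obtain j where j: "j < length bs" "y \<in> bs ! j" using X part by (metis UnionE in_set_conv_nth subsetD)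
        have "i = j" by (rule one) (use i j x y in auto)
        then show "y \<in> bs ! i" using j by simp
      qed
      then show ?thesis using tu[of "bs ! i"] i by (simp add: Int_absorb2)
    qed
  qed
qed (use brick in auto)

text \<open>Laces of size two are absorbed by the equivalence classes, so the lace bricks are those
  with at least three elements. By \<open>flaces_meet\<close> these are disjoint from each other and
  from the classes. A class that is a mere pair counts as a thin interlace.\<close>

lemma decomposition_if_te_set:
  assumes te: "te_set n A"
  shows "\<exists>U Ls Ss Ts. tu_set n U \<and> (\<forall>L\<in>set Ls. te_lace n L) \<and> (\<forall>S\<in>set Ss. thin_te_interlace n S) \<and>
       (\<forall>T\<in>set Ts. thick_te_interlace n T) \<and> pairwise_disjoint_list (U # Ls @ Ss @ Ts) \<and>
       A = \<Union>(set (U # Ls @ Ss @ Ts)) \<and> mutually_tu n (U # Ls @ Ss @ Ts)"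
proof -
  interpret te_rows n "($)" A "eqdet n" by (rule te_rows_te[OF subset_refl te])
  have tu: "tu_set n Y \<longleftrightarrow> lg Y = 0" and lace: "te_lace n Y \<longleftrightarrow> flace lg Y" if "Y \<subseteq> A" for Y
    using tu_iff_lg[OF subset_refl te that] te_lace_iff_flace[OF subset_refl te that] by auto
  define Cl where "Cl x = {y \<in> A. y = x \<or> lg {x, y} = 1}" for x
  define \<L> where "\<L> = {L. L \<subseteq> A \<and> flace lg L \<and> card L \<ge> 3}"
  define \<C> where "\<C> = {S \<in> Cl ` A. card S \<ge> 2}"
  define \<S> where "\<S> = {S \<in> \<C>. eqdet n S = 2 ^ (card S - 1)}"
  define \<T> where "\<T> = {S \<in> \<C>. eqdet n S = 2 ^ card S \<and> S \<notin> \<S>}"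
  define U where "U = A - \<Union>\<L> - \<Union>\<C>"
  \<comment> \<open>Transitivity of the gap at \<open>{}\<close>, with the coinciding cases included
    so that \<open>Cl\<close> can be handled as an equivalence class.\<close>
  have trans: "lg {x, z} = 1" if "x \<in> A" "y \<in> A" "z \<in> A" "x \<noteq> z" "y = x \<or> lg {x, y} = 1" "y = z \<or> lg {y, z} = 1" for x y z
  proof (cases "y = x \<or> y = z")
    case True
    then show ?thesis using that by auto
  next
    case False
    then show ?thesis
      using gap_trans[of "{}" x y z] that gap_pair by auto
  qed
  have ClA: "Cl x \<subseteq> A" for x by (auto simp: Cl_def)
  have pair: "lg {x, y} = 1" if "x \<in> Cl w" "y \<in> Cl w" "x \<noteq> y" "w \<in> A" for x y w
    by (rule trans[of x w y]) (use that in \<open>auto simp: Cl_def insert_commute\<close>)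
  have Cl_eq: "Cl x = Cl y" if "x \<in> A" "y \<in> A" "z \<in> Cl x" "z \<in> Cl y" for x y z
  proof -
    have sub: "Cl x \<subseteq> Cl y" if "x \<in> A" "y \<in> A" "z \<in> Cl x" "z \<in> Cl y" for x y
    proof
      fix w assume w: "w \<in> Cl x"
      have zw: "z = w \<or> lg {z, w} = 1" using pair[OF that(3) w _ that(1)] by blast
      show "w \<in> Cl y"
      proof (cases "w = y")
        case True
        then show ?thesis using that by (simp add: Cl_def)
      next
        case False
        have "lg {y, w} = 1"
          by (rule trans[of y z w]) (use that w zw False in \<open>auto simp: Cl_def\<close>)
        then show ?thesis using w by (simp add: Cl_def)
      qed
    qed
    show ?thesis using sub that by blast
  qed
  have CA: "S \<subseteq> A" if "S \<in> \<C>" for S using that ClA by (auto simp: \<C>_def)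
  have Cpair: "lg {x, y} = 1" if "S \<in> \<C>" "x \<in> S" "y \<in> S" "x \<noteq> y" for S x y
    using that pair by (auto simp: \<C>_def)
  have Cclique: "te_interlace n S" "eqdet n S = 2 ^ (card S - 1) \<or> eqdet n S = 2 ^ card S" "S \<noteq> {}" if S: "S \<in> \<C>" for S
  proof -
    note SA = CA[OF S]
    have S2: "card S \<ge> 2" using S by (simp add: \<C>_def)
    then show ne: "S \<noteq> {}" by auto
    have "lg S = card S - 1 \<or> lg S = card S"
      by (rule clique_lg[OF SA ne]) (use Cpair[OF S] in auto)
    moreover have "real (card S - 1) > 0" using S2 by simp
    ultimately have "lg S \<noteq> 0" by linarith
    then have "\<not> tu_set n S" using tu[OF SA] by simp
    moreover have "te_lace n {x, y}" if "x \<in> S" "y \<in> S" "x \<noteq> y" for x y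
      using flace_pair[of x y] Cpair[OF S that] that SA lace[of "{x,y}"] by auto
    ultimately show "te_interlace n S" using te_subset[OF subset_refl te SA] unfolding te_interlace_def by blast
    show "eqdet n S = 2 ^ (card S - 1) \<or> eqdet n S = 2 ^ card S"
      using eqdet_eqmod[OF eqm_pow[OF SA]] S2 \<open>lg S = card S - 1 \<or> lg S = card S\<close>
      by (auto simp: of_nat_diff)
  qed
  have CST: "\<C> = \<S> \<union> \<T>" using Cclique(2) by (auto simp: \<S>_def \<T>_def)
  have meet: "L = L'" if "L \<in> \<L>" "L' \<subseteq> A" "flace lg L'" "L \<inter> L' \<noteq> {}" for L L'
    using flaces_meet[OF excess_axioms, of L L'] that by (auto simp: \<L>_def)
  have LC: "L \<inter> S = {}" if L: "L \<in> \<L>" and S: "S \<in> \<C>" for L S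
  proof (rule ccontr)
    assume "L \<inter> S \<noteq> {}"
    then obtain x where x: "x \<in> L" "x \<in> S" by blast
    have "S \<noteq> {x}" using S by (auto simp: \<C>_def)
    then obtain y where y: "y \<in> S" "x \<noteq> y" using x by blast
    have "{x, y} \<subseteq> A" using x y CA[OF S] by blast
    moreover from this have "flace lg {x, y}" using flace_pair[of x y] Cpair[OF S x(2) y] by auto
    ultimately have "L = {x, y}" using meet[OF L, of "{x,y}"] x(1) by blast
    then show False using L y(2) by (simp add: \<L>_def)
  qed
  have CC: "S \<inter> S' = {}" if "S \<in> \<C>" "S' \<in> \<C>" "S \<noteq> S'" for S S'
    using that Cl_eq by (fastforce simp: \<C>_def)
  \<comment> \<open>Every lace is thereby located: it belongs to \<open>\<L>\<close> or lies inside
    a single class.\<close>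
  have small: "\<exists>S\<in>\<C>. L \<subseteq> S" if L: "L \<subseteq> A" "flace lg L" "L \<notin> \<L>" for L
  proof -
    have "card L = 2" using L flace_card[OF L(1,2)] by (simp add: \<L>_def)
    then obtain x y where xy: "L = {x, y}" "x \<noteq> y" by (auto simp: card_2_iff)
    have "lg {x, y} = 1" using flace_gap(2)[OF L(1,2), of x y] xy by simp
    then have LC: "L \<subseteq> Cl x" using xy L(1) by (auto simp: Cl_def)
    have "card (Cl x) \<ge> 2" using card_mono[OF flace_finite[OF ClA] LC] \<open>card L = 2\<close> by simp
    then have "Cl x \<in> \<C>" using xy L(1) by (auto simp: \<C>_def)
    then show ?thesis using LC by blast
  qed
  have fP: "finite (Pow A)" using finA by simp
  have "finite \<L>" by (rule finite_subset[OF _ fP]) (auto simp: \<L>_def)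
  then obtain Ls where Ls: "distinct Ls" "set Ls = \<L>" using finite_distinct_list by blast
  have "finite \<S>" by (rule finite_subset[OF _ fP]) (use CA in \<open>auto simp: \<S>_def\<close>)
  then obtain Ss where Ss: "distinct Ss" "set Ss = \<S>" using finite_distinct_list by blast
  have "finite \<T>" by (rule finite_subset[OF _ fP]) (use CA in \<open>auto simp: \<T>_def\<close>)
  then obtain Ts where Ts: "distinct Ts" "set Ts = \<T>" using finite_distinct_list by blast
  note ls = Ls Ss Ts
  let ?bs = "U # Ls @ Ss @ Ts"
  have setbs: "set ?bs = insert U (\<L> \<union> \<C>)" using ls CST by auto
  have Lne: "L \<noteq> {}" if "L \<in> \<L>" for L using that by (auto simp: \<L>_def)
  \<comment> \<open>A lace inside \<open>U\<close> would belong to \<open>\<L>\<close> or lie in a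
    class, and \<open>U\<close> is disjoint from both.\<close>
  have "tu_set n U"
  proof (rule ccontr)
    assume "\<not> tu_set n U"
    then have "lg U \<noteq> 0" using tu[of U] by (auto simp: U_def)
    then obtain L where L: "L \<subseteq> U" "flace lg L" using flace_exists[of U] by (auto simp: U_def)
    have LA: "L \<subseteq> A" using L by (auto simp: U_def)
    have "L \<noteq> {}" using L(2) f_empty by (auto simp: flace_def)
    then show False using small[OF LA L(2)] L(1) by (auto simp: U_def)
  qed
  moreover have "\<forall>L\<in>set Ls. te_lace n L" using ls lace by (auto simp: \<L>_def)
  moreover have "\<forall>S\<in>set Ss. thin_te_interlace n S"
    using ls Cclique(1) by (auto simp: \<S>_def thin_te_interlace_def)
  moreover have "\<forall>T\<in>set Ts. thick_te_interlace n T"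
    using ls Cclique(1) by (auto simp: \<T>_def thick_te_interlace_def)
  moreover have "pairwise_disjoint_list ?bs"
  proof (rule pairwise_disjoint_listI)
    have "U \<notin> \<L> \<union> \<C>"
    proof
      assume U: "U \<in> \<L> \<union> \<C>"
      then have "U \<noteq> {}" using Lne Cclique(3) by auto
      moreover have "U \<inter> U = {}" using U by (auto simp: U_def)
      ultimately show False by simp
    qed
    moreover have "\<L> \<inter> \<C> = {}"
    proof (rule ccontr)
      assume "\<L> \<inter> \<C> \<noteq> {}"
      then obtain X where "X \<in> \<L>" "X \<in> \<C>" by blast
      then show False using LC[of X X] Lne[of X] by simp
    qed
    moreover have "\<S> \<inter> \<T> = {}" by (auto simp: \<T>_def)
    ultimately show "distinct ?bs" using ls unfolding CST by auto
    fix X Y assume XY: "X \<in> set ?bs" "Y \<in> set ?bs" "X \<noteq> Y"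
    have UX: "U \<inter> Z = {}" "Z \<inter> U = {}" if "Z \<in> \<L> \<or> Z \<in> \<C>" for Z using that by (auto simp: U_def)
    have CL: "S \<inter> L = {}" if "L \<in> \<L>" "S \<in> \<C>" for L S using LC[OF that] by blast
    have LL: "L \<inter> L' = {}" if "L \<in> \<L>" "L' \<in> \<L>" "L \<noteq> L'" for L L'
      using meet[of L L'] that by (auto simp: \<L>_def)
    show "X \<inter> Y = {}" using XY unfolding setbs
      by (elim insertE UnE) (simp_all add: UX LL LC CL CC)
  qed
  moreover have "A = \<Union>(set ?bs)" 
  proof -
    have "\<Union>\<L> \<subseteq> A" "\<Union>\<C> \<subseteq> A" using CA by (auto simp: \<L>_def)
    then show ?thesis unfolding setbs by (auto simp: U_def)
  qed
  moreover have "mutually_tu n ?bs" unfolding mutually_tu_def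
  proof (intro allI impI, elim conjE)
    fix X assume XA: "X \<subseteq> \<Union>(set ?bs)"
      and nl: "\<forall>i<length ?bs. te_lace n (?bs ! i) \<longrightarrow> \<not> ?bs ! i \<subseteq> X"
      and ni: "\<forall>i<length ?bs. te_interlace n (?bs ! i) \<longrightarrow> card (X \<inter> ?bs ! i) \<le> 1"
    have nl': "\<not> L \<subseteq> X" if "L \<in> \<L>" for L
    proof -
      have "L \<in> set ?bs" using that setbs by blast
      moreover have "te_lace n L" using that lace by (auto simp: \<L>_def)
      ultimately show ?thesis using nl by (metis in_set_conv_nth)
    qed
    have ni': "card (X \<inter> S) \<le> 1" if "S \<in> \<C>" for S
    proof -
      have "S \<in> set ?bs" using that setbs by blast
      then show ?thesis using ni Cclique(1)[OF that] by (metis in_set_conv_nth)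
    qed
    have XA': "X \<subseteq> A" using XA \<open>A = \<Union>(set ?bs)\<close> by simp
    \<comment> \<open>The same alternative: a lace inside \<open>X\<close> is either a whole lace
      brick or contains two vectors of one interlace, and both are forbidden.\<close>
    show "tu_set n X"
    proof (rule ccontr)
      assume "\<not> tu_set n X"
      then have "lg X \<noteq> 0" using tu[OF XA'] by simp
      then obtain L where L: "L \<subseteq> X" "flace lg L" using flace_exists[OF XA'] by blast
      have LA: "L \<subseteq> A" using L XA' by blast
      have "L \<notin> \<L>" using nl' L(1) by blast
      then obtain S where S: "S \<in> \<C>" "L \<subseteq> S" using small[OF LA L(2)] by blast
      have "card L \<le> card (X \<inter> S)" using S L(1) flace_finite[OF XA'] by (intro card_mono) auto
      then show False using ni'[OF S(1)] flace_card[OF LA L(2)] by simp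
    qed
  qed
  ultimately show ?thesis by blast
qed

end

theorem mainTheorem4:
  fixes n :: nat and A :: "real vec set"
  assumes "pm1_set n A" and "lin_indep_set n A"
  shows "te_set n A \<longleftrightarrow>
    (\<exists>U Ls Ss Ts.
       tu_set n U \<and>
       (\<forall>L\<in>set Ls. te_lace n L) \<and>
       (\<forall>S\<in>set Ss. thin_te_interlace n S) \<and>
       (\<forall>T\<in>set Ts. thick_te_interlace n T) \<and>
       pairwise_disjoint_list (U # Ls @ Ss @ Ts) \<and>
       A = \<Union>(set (U # Ls @ Ss @ Ts)) \<and>
       mutually_tu n (U # Ls @ Ss @ Ts))"
proof -
  interpret pm1_indep n A by unfold_locales (fact assms)+
  show ?thesis
  proof
    assume "te_set n A"
    then show "\<exists>U Ls Ss Ts. tu_set n U \<and> (\<forall>L\<in>set Ls. te_lace n L) \<and> (\<forall>S\<in>set Ss. thin_te_interlace n S) \<and>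
       (\<forall>T\<in>set Ts. thick_te_interlace n T) \<and> pairwise_disjoint_list (U # Ls @ Ss @ Ts) \<and>
       A = \<Union>(set (U # Ls @ Ss @ Ts)) \<and> mutually_tu n (U # Ls @ Ss @ Ts)"
      by (rule decomposition_if_te_set)
  next
    assume "\<exists>U Ls Ss Ts. tu_set n U \<and> (\<forall>L\<in>set Ls. te_lace n L) \<and> (\<forall>S\<in>set Ss. thin_te_interlace n S) \<and>
       (\<forall>T\<in>set Ts. thick_te_interlace n T) \<and> pairwise_disjoint_list (U # Ls @ Ss @ Ts) \<and>
       A = \<Union>(set (U # Ls @ Ss @ Ts)) \<and> mutually_tu n (U # Ls @ Ss @ Ts)"
    then obtain U Ls Ss Ts where d: "tu_set n U" "\<forall>L\<in>set Ls. te_lace n L" "\<forall>S\<in>set Ss. thin_te_interlace n S"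
      "\<forall>T\<in>set Ts. thick_te_interlace n T" "pairwise_disjoint_list (U # Ls @ Ss @ Ts)"
      "A = \<Union>(set (U # Ls @ Ss @ Ts))" "mutually_tu n (U # Ls @ Ss @ Ts)" by (elim exE conjE)
    show "te_set n A"
      by (rule te_set_if_decomposition[OF d(5,6,7)])
        (use d(1-4) in \<open>auto simp: thin_te_interlace_def thick_te_interlace_def\<close>)
  qed
qed

end
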